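(* Assume that for every $t\in\mathcal T$, $x\in\mathcal X$, $a\in A$, $\theta\in\Theta$ and $x'\in\mathcal X$ the optimizer sets are singletons: $\Lambda_t^{*,\theta}(x,a)=\{\lambda_t^\star(x,a,\theta)\}$ and $Y^*_{t,\theta,\lambda_t^\star(x,a,\theta)}(x,a;x')=\{y_t^\star(x,a,x',\theta)\}$. Assume also that $(x,a)\mapsto\mathbb P_t^0(x,a,\cdot)$ is weakly continuous for every $t\in\mathcal T$ and that the policy class is regular (see context). Then for all $(t,x)\in\mathcal T\times\mathcal X$, $$\nabla_\theta V_T^\theta(x)=0,\qquad \nabla_\theta V_t^\theta(x)=\int_A\Big[G_t^\theta(x,a)\,\nabla_\theta\log\pi_t^\theta(x,a)+\nabla_\theta G_t^\theta(x,a)\Big]\pi_t^\theta(x,da).$$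
   Context: Model. $\mathcal X\subset\mathbb R^d$, $A\subset\mathbb R^m$ are nonempty compact sets, $T\ge1$ an integer, $\mathcal T=\{0,\dots,T-1\}$, $q\ge1$ an integer, $\varepsilon>0$, $c(x,y)=\|x-y\|^q$ (Euclidean norm). $\mathcal P(\mathcal X)$ is the set of Borel probability measures on $\mathcal X$ and $W_q$ the $q$-Wasserstein distance for the Euclidean metric. Rewards: $f:\mathcal T\times\mathcal X\times A\times\mathcal X\to\mathbb R$ and $g:\mathcal X\to\mathbb R$, with $f(t,\cdot,\cdot,\cdot)$ (for every $t$) and $g$ continuous. For $t\in\mathcal T$, $\mathbb P_t^0$ is a Borel (nominal) transition kernel from $\mathcal X\times A$ to $\mathcal X$, and $\mathbb B_t(x,a)=\{\mathbb P\in\mathcal P(\mathcal X):W_q(\mathbb P,\mathbb P_t^0(x,a,\cdot))\le\varepsilon\}$. Policies. $\Theta\subset\mathbb R^{d_\theta}$ is compact, $\nu$ is a reference measure on $A$, and for $\theta\in\Theta$, $\pi_t^\theta(x,da)=\pi_t^\theta(x,a)\,\nu(da)$ is a probability measure on $A$ for each $(t,x)\in\mathcal T\times\mathcal X$. The policy class is regular if for each $t$: $(\theta,x)\mapsto\pi_t^\theta(x,\cdot)$ is weakly continuous on $\Theta\times\mathcal X$; for every $\varphi\in C(A)$, $\theta\mapsto\int_A\varphi(a)\pi_t^\theta(x,da)$ is $C^1$ on $\Theta$ with derivative continuous in $(\theta,x)$; and $\sup_{\theta,t,x,a}\|\nabla_\theta\log\pi_t^\theta(x,a)\|<\infty$.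 Value functions. $V_t^\theta(x)=\inf\mathbb E\big[\sum_{l=t}^{T-1}f(l,X_l,a_l,X_{l+1})+g(X_T)\big]$, the infimum being over path laws $\delta_x(dx_t)\prod_{l=t}^{T-1}\pi_l^\theta(x_l,da_l)\mathbb P_l(x_l,a_l,dx_{l+1})$ with Borel kernels $\mathbb P_l$ such that $\mathbb P_l(x',a',\cdot)\in\mathbb B_l(x',a')$ for all $(x',a')$; $V_T^\theta=g$. Dual objects. For $\lambda\ge0$, $$F_t^\theta(\lambda;x,a)=\int_{\mathcal X}\inf_{y\in\mathcal X}\{f(t,x,a,y)+V_{t+1}^\theta(y)+\lambda c(x',y)\}\,\mathbb P_t^0(x,a,dx')-\varepsilon^q\lambda,$$ $Y_{t,\theta,\lambda}^*(x,a;x')=\arg\min_{y\in\mathcal X}\{f(t,x,a,y)+V_{t+1}^\theta(y)+\lambda c(x',y)\}$, $\Lambda_t^{*,\theta}(x,a)=\arg\max_{\lambda\ge0}F_t^\theta(\lambda;x,a)$, and $G_t^\theta(x,a)=\sup_{\lambda\ge0}F_t^\theta(\lambda;x,a)$. The dynamic programming recursion is $V_T^\theta=g$, $V_t^\theta(x)=\int_AG_t^\theta(x,a)\pi_t^\theta(x,da)$. Gradients. $\nabla_\theta V_t^\theta(x)$ and $\nabla_\theta G_t^\theta(x,a)$ denote the vectors representing the directional derivatives (linear in $r\in\mathbb R^{d_\theta}$) $r\mapsto\lim_{h\to0}(V_t^{\theta+hr}(x)-V_t^\theta(x))/h$ and $r\mapsto\lim_{h\to0}(G_t^{\theta+hr}(x,a)-G_t^\theta(x,a))/h$.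 Derivatives in $\theta$ are taken at points $\theta\in\mathrm{int}(\Theta)$ (at boundary points, only along feasible directions). *)

theory Defs
  imports "HOL-Probability.Probability"
begin

abbreviation borel_on :: "'s::topological_space set \<Rightarrow> 's measure" where
  "borel_on S \<equiv> restrict_space borel S"



section \<open>Kernels, weak continuity, Wasserstein balls\<close>

definition markov_kernel ::
  "'x::euclidean_space set \<Rightarrow> 'a::euclidean_space set \<Rightarrow> ('x \<Rightarrow> 'a \<Rightarrow> 'x measure) \<Rightarrow> bool" where
  "markov_kernel X A K \<longleftrightarrow>
     (\<lambda>(x, a). K x a) \<in> borel_on X \<Otimes>\<^sub>M borel_on A \<rightarrow>\<^sub>M prob_algebra (borel_on X)"

definition weakly_continuous_on ::
  "'s::topological_space set \<Rightarrow> 'y::topological_space set \<Rightarrow> ('s \<Rightarrow> 'y measure) \<Rightarrow> bool" where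
  "weakly_continuous_on S Y K \<longleftrightarrow>
     (\<forall>\<phi> :: 'y \<Rightarrow> real. continuous_on Y \<phi> \<and> bounded (\<phi> ` Y) \<longrightarrow>
        continuous_on S (\<lambda>s. LINT y|K s. \<phi> y))"

definition couplings :: "'x measure \<Rightarrow> 'x measure \<Rightarrow> ('x \<times> 'x) measure set" where
  "couplings \<mu> \<nu> = {\<gamma>. prob_space \<gamma> \<and> sets \<gamma> = sets (\<mu> \<Otimes>\<^sub>M \<nu>) \<and>
     distr \<gamma> \<mu> fst = \<mu> \<and> distr \<gamma> \<nu> snd = \<nu>}"

definition cost :: "nat \<Rightarrow> 'x::real_normed_vector \<Rightarrow> 'x \<Rightarrow> real" where
  "cost q x y = norm (x - y) ^ q"

text \<open>Meant for measures on a bounded set: there the cost is integrable with respect to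
  every coupling.\<close>

definition wasserstein :: "nat \<Rightarrow> 'x::euclidean_space measure \<Rightarrow> 'x measure \<Rightarrow> real" where
  "wasserstein q \<mu> \<nu> = root q (INF \<gamma>\<in>couplings \<mu> \<nu>. LINT (x, y)|\<gamma>. cost q x y)"

definition wasserstein_ball ::
  "'x::euclidean_space set \<Rightarrow> nat \<Rightarrow> real \<Rightarrow> 'x measure \<Rightarrow> 'x measure set" where
  "wasserstein_ball X q \<epsilon> \<mu> =
     {P \<in> space (prob_algebra (borel_on X)). wasserstein q P \<mu> \<le> \<epsilon>}"


section \<open>Path laws and robust value functions\<close>

text \<open>A path started at time \<open>t\<close> and observed for \<open>n\<close> steps is a pair \<open>(\<xi>, \<alpha>)\<close> with states
  \<open>\<xi> t, \<dots>, \<xi> (t + n)\<close> and actions \<open>\<alpha> t, \<dots>, \<alpha> (t + n - 1)\<close>.\<close>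

definition path_space :: "'x::euclidean_space set \<Rightarrow> 'a::euclidean_space set \<Rightarrow> nat \<Rightarrow> nat \<Rightarrow>
    ((nat \<Rightarrow> 'x) \<times> (nat \<Rightarrow> 'a)) measure" where
  "path_space X A t n =
     (\<Pi>\<^sub>M i\<in>{t..t + n}. borel_on X) \<Otimes>\<^sub>M (\<Pi>\<^sub>M i\<in>{t..<t + n}. borel_on A)"

primrec path_law :: "'x::euclidean_space set \<Rightarrow> 'a::euclidean_space set \<Rightarrow>
    (nat \<Rightarrow> 'x \<Rightarrow> 'a measure) \<Rightarrow> (nat \<Rightarrow> 'x \<Rightarrow> 'a \<Rightarrow> 'x measure) \<Rightarrow> nat \<Rightarrow> 'x \<Rightarrow> nat \<Rightarrow>
    ((nat \<Rightarrow> 'x) \<times> (nat \<Rightarrow> 'a)) measure" where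
  "path_law X A \<pi> P t x 0 =
     return (path_space X A t 0) (\<lambda>i\<in>{t}. x, \<lambda>i. undefined)"
| "path_law X A \<pi> P t x (Suc n) =
     path_law X A \<pi> P t x n \<bind> (\<lambda>(\<xi>, \<alpha>).
       \<pi> (t + n) (\<xi> (t + n)) \<bind> (\<lambda>a.
         P (t + n) (\<xi> (t + n)) a \<bind> (\<lambda>y.
           return (path_space X A t (Suc n)) (\<xi>(t + Suc n := y), \<alpha>(t + n := a)))))"

definition admissible_kernels :: "'x::euclidean_space set \<Rightarrow> 'a::euclidean_space set \<Rightarrow> nat \<Rightarrow> nat \<Rightarrow>
    real \<Rightarrow> (nat \<Rightarrow> 'x \<Rightarrow> 'a \<Rightarrow> 'x measure) \<Rightarrow> nat \<Rightarrow> (nat \<Rightarrow> 'x \<Rightarrow> 'a \<Rightarrow> 'x measure) set" where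
  "admissible_kernels X A T q \<epsilon> P0 t =
     {P. \<forall>l\<in>{t..<T}. markov_kernel X A (P l) \<and>
        (\<forall>x\<in>X. \<forall>a\<in>A. P l x a \<in> wasserstein_ball X q \<epsilon> (P0 l x a))}"

definition robust_value :: "'x::euclidean_space set \<Rightarrow> 'a::euclidean_space set \<Rightarrow> nat \<Rightarrow> nat \<Rightarrow>
    real \<Rightarrow> (nat \<Rightarrow> 'x \<Rightarrow> 'a \<Rightarrow> 'x \<Rightarrow> real) \<Rightarrow> ('x \<Rightarrow> real) \<Rightarrow> (nat \<Rightarrow> 'x \<Rightarrow> 'a \<Rightarrow> 'x measure) \<Rightarrow>
    (nat \<Rightarrow> 'x \<Rightarrow> 'a measure) \<Rightarrow> nat \<Rightarrow> 'x \<Rightarrow> real" where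
  "robust_value X A T q \<epsilon> f g P0 \<pi> t x =
     (INF P\<in>admissible_kernels X A T q \<epsilon> P0 t.
        LINT (\<xi>, \<alpha>)|path_law X A \<pi> P t x (T - t).
          (\<Sum>l = t..<T. f l (\<xi> l) (\<alpha> l) (\<xi> (Suc l))) + g (\<xi> T))"


section \<open>Dual objects\<close>

text \<open>The argument \<open>u\<close> stands for \<open>y \<mapsto> f(t, x, a, y) + V\<^sub>t\<^sub>+\<^sub>1(y)\<close> and \<open>\<mu>\<close> for the
  nominal law \<open>P0 t x a\<close>.\<close>

definition dual_fun ::
  "'x::euclidean_space set \<Rightarrow> nat \<Rightarrow> real \<Rightarrow> ('x \<Rightarrow> real) \<Rightarrow> 'x measure \<Rightarrow> real \<Rightarrow> real" where
  "dual_fun X q \<epsilon> u \<mu> l = (LINT x'|\<mu>. (INF y\<in>X. u y + l * cost q x' y)) - \<epsilon> ^ q * l"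

definition dual_value ::
  "'x::euclidean_space set \<Rightarrow> nat \<Rightarrow> real \<Rightarrow> ('x \<Rightarrow> real) \<Rightarrow> 'x measure \<Rightarrow> real" where
  "dual_value X q \<epsilon> u \<mu> = (SUP l\<in>{0..}. dual_fun X q \<epsilon> u \<mu> l)"

definition dual_optimizers ::
  "'x::euclidean_space set \<Rightarrow> nat \<Rightarrow> real \<Rightarrow> ('x \<Rightarrow> real) \<Rightarrow> 'x measure \<Rightarrow> real set" where
  "dual_optimizers X q \<epsilon> u \<mu> = {l. is_arg_max (dual_fun X q \<epsilon> u \<mu>) (\<lambda>l. 0 \<le> l) l}"

definition inner_optimizers ::
  "'x::euclidean_space set \<Rightarrow> nat \<Rightarrow> ('x \<Rightarrow> real) \<Rightarrow> real \<Rightarrow> 'x \<Rightarrow> 'x set" where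
  "inner_optimizers X q u l x' = {y. is_arg_min (\<lambda>y. u y + l * cost q x' y) (\<lambda>y. y \<in> X) y}"


section \<open>Gradients on a parameter set\<close>

text \<open>The increments \<open>h\<close> range over those for which the whole segment from \<open>\<theta>\<close> to
  \<open>\<theta> + h r\<close> stays in \<open>\<Theta>\<close>. At an interior point the limit is therefore the usual two-sided
  one; at a boundary point it only concerns the directions \<open>r\<close> with \<open>r\<close> or \<open>- r\<close> feasible,
  and for all other \<open>r\<close> the filter is trivial.\<close>

definition has_dir_gradient ::
  "'p::euclidean_space set \<Rightarrow> ('p \<Rightarrow> real) \<Rightarrow> 'p \<Rightarrow> 'p \<Rightarrow> bool" where
  "has_dir_gradient \<Theta> F \<theta> v \<longleftrightarrow>
     (\<forall>r. ((\<lambda>h. (F (\<theta> + h *\<^sub>R r) - F \<theta>) / h) \<longlongrightarrow> v \<bullet> r)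
        (at 0 within {h. closed_segment \<theta> (\<theta> + h *\<^sub>R r) \<subseteq> \<Theta>}))"

definition dir_differentiable ::
  "'p::euclidean_space set \<Rightarrow> ('p \<Rightarrow> real) \<Rightarrow> 'p \<Rightarrow> bool" where
  "dir_differentiable \<Theta> F \<theta> \<longleftrightarrow> (\<exists>v. has_dir_gradient \<Theta> F \<theta> v)"

definition feasible_directions :: "'p::euclidean_space set \<Rightarrow> 'p \<Rightarrow> 'p set" where
  "feasible_directions \<Theta> \<theta> = {r. \<exists>\<delta>>0. closed_segment \<theta> (\<theta> + \<delta> *\<^sub>R r) \<subseteq> \<Theta>}"

text \<open>At an interior point the span is the whole space. At a boundary point a representing vector
  is determined only up to the orthogonal complement of the feasible directions; the one in
  their span is chosen, which is also the one of least norm.\<close>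

definition dir_gradient ::
  "'p::euclidean_space set \<Rightarrow> ('p \<Rightarrow> real) \<Rightarrow> 'p \<Rightarrow> 'p" where
  "dir_gradient \<Theta> F \<theta> =
     (THE v. v \<in> span (feasible_directions \<Theta> \<theta>) \<and> has_dir_gradient \<Theta> F \<theta> v)"


section \<open>Policies\<close>

definition policy :: "'a measure \<Rightarrow> (nat \<Rightarrow> 'p \<Rightarrow> 'x \<Rightarrow> 'a \<Rightarrow> real) \<Rightarrow> 'p \<Rightarrow> nat \<Rightarrow> 'x \<Rightarrow> 'a measure"
  where "policy \<nu> p \<theta> t x = density \<nu> (\<lambda>a. ennreal (p t \<theta> x a))"

definition policy_class :: "'x::euclidean_space set \<Rightarrow> 'a::euclidean_space set \<Rightarrow>
    'p::euclidean_space set \<Rightarrow> nat \<Rightarrow> 'a measure \<Rightarrow> (nat \<Rightarrow> 'p \<Rightarrow> 'x \<Rightarrow> 'a \<Rightarrow> real) \<Rightarrow> bool" where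
  "policy_class X A \<Theta> T \<nu> p \<longleftrightarrow>
     sets \<nu> = sets (borel_on A) \<and>
     (\<forall>t<T. \<forall>\<theta>\<in>\<Theta>. \<forall>x\<in>X. p t \<theta> x \<in> borel_measurable \<nu> \<and> (\<forall>a\<in>A. 0 \<le> p t \<theta> x a) \<and>
        prob_space (policy \<nu> p \<theta> t x))"

text \<open>In the second condition the derivative at boundary points is any continuous field that
  represents the derivatives along feasible directions. The third condition makes sense only for
  positive densities whose logarithm is differentiable in \<open>\<theta>\<close>, which is part of it.\<close>

definition regular_policy_class :: "'x::euclidean_space set \<Rightarrow> 'a::euclidean_space set \<Rightarrow>
    'p::euclidean_space set \<Rightarrow> nat \<Rightarrow> 'a measure \<Rightarrow> (nat \<Rightarrow> 'p \<Rightarrow> 'x \<Rightarrow> 'a \<Rightarrow> real) \<Rightarrow> bool" where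
  "regular_policy_class X A \<Theta> T \<nu> p \<longleftrightarrow>
     (\<forall>t<T. weakly_continuous_on (\<Theta> \<times> X) A (\<lambda>(\<theta>, x). policy \<nu> p \<theta> t x)) \<and>
     (\<forall>t<T. \<forall>\<phi> :: 'a \<Rightarrow> real. continuous_on A \<phi> \<longrightarrow>
        (\<exists>D. continuous_on (\<Theta> \<times> X) (\<lambda>(\<theta>, x). D \<theta> x) \<and>
          (\<forall>\<theta>\<in>\<Theta>. \<forall>x\<in>X.
             has_dir_gradient \<Theta> (\<lambda>\<theta>. LINT a|policy \<nu> p \<theta> t x. \<phi> a) \<theta> (D \<theta> x)))) \<and>
     (\<forall>t<T. \<forall>\<theta>\<in>\<Theta>. \<forall>x\<in>X. \<forall>a\<in>A.
        0 < p t \<theta> x a \<and> dir_differentiable \<Theta> (\<lambda>\<theta>. ln (p t \<theta> x a)) \<theta>) \<and>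
     (\<exists>C. \<forall>t<T. \<forall>\<theta>\<in>\<Theta>. \<forall>x\<in>X. \<forall>a\<in>A.
        norm (dir_gradient \<Theta> (\<lambda>\<theta>. ln (p t \<theta> x a)) \<theta>) \<le> C)"

end

theory Submission
  imports Defs
begin

text \<open>
  Uniqueness of the optimizers replaces abstract duality and measurable selection: the unique
  minimizer \<open>y\<^sup>*\<close> and multiplier \<open>\<lambda>\<^sup>*\<close> depend continuously on all parameters, and the first-order
  condition for \<open>\<lambda>\<^sup>*\<close> says that the push-forward of the nominal law under \<open>y\<^sup>*\<close> lies in the
  Wasserstein ball and attains the dual value. These push-forwards form a weakly continuous worst-case
  kernel. The dynamic programming recursion follows because the expected reward collected
  up to time \<open>l\<close> plus the value at the state reached at \<open>l\<close> is nondecreasing in \<open>l\<close> under every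
  admissible kernel and constant under the worst-case one.

  For the gradient, the dual value is a minimum of integrals over a ball that does not depend on \<open>\<theta>\<close>,
  so its difference quotient in \<open>\<theta>\<close> is squeezed between the integrals of the quotient of the next
  value function against the worst-case laws at the two parameters; both converge. The
  policy average is then differentiated by the product rule, the derivative of the policy being its
  score. Continuity in \<open>\<theta>\<close> is propagated backwards in time only along segments contained
  in \<open>\<Theta>\<close>: at boundary points the gradient itself need not be continuous.
\<close>

section \<open>Minimization over compact sets\<close>

text \<open>The score is bounded but not assumed continuous, so continuity of the score term of the
  gradient cannot be read off pointwise. It is available only after integration against a fixed
  continuous test function, where the integral must agree along segments with the continuous
  derivative field granted by regularity. The score bound makes this uniform in the test function,
  which may then be the moving \<open>G\<close>. Apart from the recursion itself, each stage hands
  two facts to the preceding time: joint continuity of the value in \<open>(\<theta>, x)\<close>,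
  which makes the worst-case kernel weakly continuous, and continuous differentiability along
  segments, which feeds the envelope argument. The first-order condition yields a primal solution
  because the averaged inner infimum has, as its slope in the multiplier, the mean cost of moving
  \<open>x'\<close> to its minimizer. The dual function cannot increase to the right of its
  maximizer, which bounds this cost by the \<open>q\<close>-th power of \<open>\<epsilon>\<close>
  and puts the law in the ball; at a positive maximizer the slope vanishes, which is complementary
  slackness and equates primal and dual values.\<close>

lemma eventually_uniform_on_compact:
  fixes f :: "'s::topological_space \<Rightarrow> 'y::topological_space \<Rightarrow> real"
  assumes "continuous_on (S \<times> Y) (\<lambda>(s, y). f s y)" "compact Y" "s0 \<in> S" "0 < e"
  shows "\<forall>\<^sub>F s in at s0 within S. \<forall>y\<in>Y. \<bar>f s y - f s0 y\<bar> \<le> e"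
proof -
  obtain X0 where "s0 \<in> X0" "open X0" and
    *: "\<forall>s\<in>X0 \<inter> S. \<forall>y\<in>Y. dist (f s y) (f s0 y) \<le> e"
    using continuous_on_prod_compactE[OF assms] by (auto simp: split_beta)
  have "\<forall>\<^sub>F s in at s0 within S. s \<in> X0 \<inter> S"
    using \<open>s0 \<in> X0\<close> \<open>open X0\<close> eventually_at_topological by auto
  then show ?thesis
    by eventually_elim (use * in \<open>auto simp: dist_real_def\<close>)
qed

lemma continuous_on_slice:
  assumes "continuous_on (S \<times> Y) (\<lambda>(s, y). f s y)"
  shows "s \<in> S \<Longrightarrow> continuous_on Y (f s)" "y \<in> Y \<Longrightarrow> continuous_on S (\<lambda>s. f s y)"
  by (auto intro!: continuous_on_compose2[OF assms, where f="\<lambda>y. (s, y)", simplified]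
      continuous_on_compose2[OF assms, where f="\<lambda>s. (s, y)", simplified] continuous_intros)

lemma bdd_image_compact:
  fixes f :: "'y::topological_space \<Rightarrow> real"
  assumes "compact Y" "continuous_on Y f"
  shows "bdd_below (f ` Y)" "bdd_above (f ` Y)" "bounded (f ` Y)"
  using compact_imp_bounded[OF compact_continuous_image[OF assms(2,1)]]
  by (auto simp: bounded_imp_bdd_below bounded_imp_bdd_above)

text \<open>Compactness of \<open>Y\<close> makes the slices of a jointly continuous function
  uniformly close (tube lemma), and an infimum is 1-Lipschitz in the uniform distance.\<close>

lemma continuous_on_INF_compact:
  fixes f :: "'s::topological_space \<Rightarrow> 'y::topological_space \<Rightarrow> real"
  assumes cont: "continuous_on (S \<times> Y) (\<lambda>(s, y). f s y)" and Y: "compact Y" "Y \<noteq> {}"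
  shows "continuous_on S (\<lambda>s. INF y\<in>Y. f s y)"
  unfolding continuous_on_def
proof (intro ballI tendstoI)
  fix s0 and e :: real
  assume s0: "s0 \<in> S" and "0 < e"
  have "\<forall>\<^sub>F s in at s0 within S. s \<in> S"
    by (simp add: eventually_at_filter)
  with eventually_uniform_on_compact[OF cont Y(1) s0 half_gt_zero[OF \<open>0 < e\<close>]]
  show "\<forall>\<^sub>F s in at s0 within S. dist (INF y\<in>Y. f s y) (INF y\<in>Y. f s0 y) < e"
  proof eventually_elim
    case (elim s)
    have bdd: "bdd_below (f s ` Y)" "bdd_below (f s0 ` Y)"
      using elim s0 Y(1) continuous_on_slice[OF cont] by (auto intro: bdd_image_compact)
    have "(INF y\<in>Y. f s0 y) - e / 2 \<le> (INF y\<in>Y. f s y)"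
    proof (rule cINF_greatest[OF Y(2)])
      fix y assume "y \<in> Y"
      with elim have "\<bar>f s y - f s0 y\<bar> \<le> e / 2" by blast
      moreover have "(INF y\<in>Y. f s0 y) \<le> f s0 y"
        using bdd(2) \<open>y \<in> Y\<close> by (rule cINF_lower)
      ultimately show "(INF y\<in>Y. f s0 y) - e / 2 \<le> f s y" by linarith
    qed
    moreover have "(INF y\<in>Y. f s y) - e / 2 \<le> (INF y\<in>Y. f s0 y)"
    proof (rule cINF_greatest[OF Y(2)])
      fix y assume "y \<in> Y"
      with elim have "\<bar>f s y - f s0 y\<bar> \<le> e / 2" by blast
      moreover have "(INF y\<in>Y. f s y) \<le> f s y"
        using bdd(1) \<open>y \<in> Y\<close> by (rule cINF_lower)
      ultimately show "(INF y\<in>Y. f s y) - e / 2 \<le> f s0 y" by linarith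
    qed
    ultimately show ?case
      using \<open>0 < e\<close> unfolding dist_real_def by linarith
  qed
qed

text \<open>Off a neighbourhood of \<open>y0\<close> the minimum of \<open>f s0\<close> exceeds
  \<open>f s0 y0\<close> by a positive gap, and a uniformly small perturbation cannot bridge it.
  Uniqueness is imposed at \<open>s0\<close> alone, and \<open>\<eta> s\<close> only has to do as
  well as \<open>y0\<close>. The derivative in the multiplier requires this form, since there
  uniqueness is known only at the optimal multiplier.\<close>

lemma tendsto_unique_minimizer:
  fixes f :: "'s::topological_space \<Rightarrow> 'y::topological_space \<Rightarrow> real"
  assumes cont: "continuous_on (S \<times> Y) (\<lambda>(s, y). f s y)" and Y: "compact Y"
    and s0: "s0 \<in> S" "y0 \<in> Y"
    and unique: "\<And>y. y \<in> Y \<Longrightarrow> f s0 y \<le> f s0 y0 \<Longrightarrow> y = y0"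
    and min: "\<And>s. s \<in> S \<Longrightarrow> \<eta> s \<in> Y" "\<And>s. s \<in> S \<Longrightarrow> f s (\<eta> s) \<le> f s y0"
  shows "(\<eta> \<longlongrightarrow> y0) (at s0 within S)"
proof (rule topological_tendstoI)
  fix U assume U: "open U" "y0 \<in> U"
  have ev: "\<forall>\<^sub>F s in at s0 within S. s \<in> S"
    by (simp add: eventually_at_filter)
  show "\<forall>\<^sub>F s in at s0 within S. \<eta> s \<in> U"
  proof (cases "Y - U = {}")
    case True
    with ev show ?thesis
      by (auto elim!: eventually_mono dest: min(1))
  next
    case False
    have "continuous_on (Y - U) (f s0)"
      using continuous_on_slice(1)[OF cont s0(1)] by (rule continuous_on_subset) auto
    then obtain y1 where y1: "y1 \<in> Y - U" "\<And>y. y \<in> Y - U \<Longrightarrow> f s0 y1 \<le> f s0 y"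
      using continuous_attains_inf[OF compact_diff[OF Y U(1)] False] by blast
    have gap: "f s0 y0 < f s0 y1"
      using unique[of y1] y1(1) U(2) by (metis Diff_iff not_le_imp_less)
    \<comment> \<open>A third of the gap: passing between \<open>s\<close> and \<open>s0\<close>
      costs \<open>e\<close> at \<open>\<eta> s\<close> and another \<open>e\<close> at
      \<open>y0\<close>, so the total error stays below the gap.\<close>
    define e where "e = (f s0 y1 - f s0 y0) / 3"
    have "0 < e" using gap by (simp add: e_def)
    from eventually_uniform_on_compact[OF cont Y s0(1) this] ev show ?thesis
    proof eventually_elim
      case (elim s)
      show ?case
      proof (rule ccontr)
        assume "\<eta> s \<notin> U"
        then have "f s0 y1 \<le> f s0 (\<eta> s)"
          using y1(2) min(1) elim(2) by auto
        moreover have "f s0 (\<eta> s) - f s (\<eta> s) \<le> e" "f s y0 - f s0 y0 \<le> e"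
          using elim min(1)[of s] s0 by (auto simp: abs_le_iff)
        moreover have "f s (\<eta> s) \<le> f s y0"
          using min(2) elim by auto
        ultimately show False
          using e_def gap \<open>0 < e\<close> by argo
      qed
    qed
  qed
qed

lemma continuous_on_unique_minimizer:
  fixes f :: "'s::topological_space \<Rightarrow> 'y::topological_space \<Rightarrow> real"
  assumes cont: "continuous_on (S \<times> Y) (\<lambda>(s, y). f s y)" and Y: "compact Y"
    and \<eta>: "\<And>s. s \<in> S \<Longrightarrow> \<eta> s \<in> Y" "\<And>s y. s \<in> S \<Longrightarrow> y \<in> Y \<Longrightarrow> f s (\<eta> s) \<le> f s y"
    and unique: "\<And>s y. s \<in> S \<Longrightarrow> y \<in> Y \<Longrightarrow> f s y \<le> f s (\<eta> s) \<Longrightarrow> y = \<eta> s"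
  shows "continuous_on S \<eta>"
  unfolding continuous_on_def
  using assms by (auto intro!: tendsto_unique_minimizer[OF cont Y])

section \<open>Integration against weakly continuous kernels\<close>

lemma prob_borel_onD:
  assumes "\<mu> \<in> space (prob_algebra (borel_on Y))"
  shows "prob_space \<mu>" "sets \<mu> = sets (borel_on Y)" "space \<mu> = Y"
  using assms by (auto simp: space_prob_algebra space_restrict_space dest: sets_eq_imp_space_eq)

lemma measurable_continuous_on_borel_on:
  assumes "continuous_on Y \<phi>" "sets \<mu> = sets (borel_on Y)"
  shows "\<phi> \<in> borel_measurable \<mu>"
  using borel_measurable_continuous_on_restrict[OF assms(1)] assms(2)
  by (simp cong: measurable_cong_sets)

lemma integrable_continuous_on:
  fixes \<phi> :: "'y::topological_space \<Rightarrow> 'b::{banach, second_countable_topology}"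
  assumes "compact Y" "\<mu> \<in> space (prob_algebra (borel_on Y))" "continuous_on Y \<phi>"
  shows "integrable \<mu> \<phi>"
proof -
  interpret prob_space \<mu> using prob_borel_onD assms by blast
  obtain B where "\<And>y. y \<in> Y \<Longrightarrow> norm (\<phi> y) \<le> B"
    using compact_imp_bounded[OF compact_continuous_image[OF assms(3,1)]] by (auto simp: bounded_iff)
  then show ?thesis
    using assms prob_borel_onD(3)[OF assms(2)]
    by (intro integrable_const_bound[of _ B])
      (auto intro!: measurable_continuous_on_borel_on prob_borel_onD(2))
qed

text \<open>\<open>\<phi>\<close> carries no measurability assumption: the integral of a
  non-integrable function is 0 by convention, and in that case \<open>0 \<le> B\<close> gives the
  bound.\<close>

lemma prob_integral_abs_le:
  fixes \<phi> :: "'y::topological_space \<Rightarrow> real"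
  assumes "\<mu> \<in> space (prob_algebra (borel_on Y))" "\<And>y. y \<in> Y \<Longrightarrow> \<bar>\<phi> y\<bar> \<le> B" "0 \<le> B"
  shows "\<bar>LINT y|\<mu>. \<phi> y\<bar> \<le> B"
proof (cases "integrable \<mu> \<phi>")
  case True
  interpret prob_space \<mu> using prob_borel_onD assms by blast
  have "\<bar>LINT y|\<mu>. \<phi> y\<bar> \<le> (LINT y|\<mu>. \<bar>\<phi> y\<bar>)"
    by (rule integral_abs_bound)
  also have "\<dots> \<le> (LINT y|\<mu>. B)"
    using True assms prob_borel_onD(3)[OF assms(1)] by (intro integral_mono) auto
  finally show ?thesis by (simp add: prob_space)
qed (use assms in \<open>simp add: not_integrable_integral_eq\<close>)

lemma continuous_on_lipschitz_functional:
  fixes \<psi> :: "'s::topological_space \<Rightarrow> 'y::topological_space \<Rightarrow> real" and \<Lambda> :: "'s \<Rightarrow> ('y \<Rightarrow> real) \<Rightarrow> real"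
  assumes lip: "\<And>s \<phi> \<phi>' e. s \<in> S \<Longrightarrow> continuous_on Y \<phi> \<Longrightarrow> continuous_on Y \<phi>' \<Longrightarrow> 0 < e \<Longrightarrow>
      (\<And>y. y \<in> Y \<Longrightarrow> \<bar>\<phi> y - \<phi>' y\<bar> \<le> e) \<Longrightarrow> \<bar>\<Lambda> s \<phi> - \<Lambda> s \<phi>'\<bar> \<le> B * e"
    and fixed: "\<And>\<phi>. continuous_on Y \<phi> \<Longrightarrow> continuous_on S (\<lambda>s. \<Lambda> s \<phi>)"
    and Y: "compact Y" and cont: "continuous_on (S \<times> Y) (\<lambda>(s, y). \<psi> s y)"
  shows "continuous_on S (\<lambda>s. \<Lambda> s (\<psi> s))"
  unfolding continuous_on_def
proof (intro ballI tendstoI)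
  fix s0 and e :: real
  assume s0: "s0 \<in> S" and "0 < e"
  define e' where "e' = e / (2 * (\<bar>B\<bar> + 1))"
  have e': "0 < e'" "B * e' \<le> e / 2"
  proof -
    show "0 < e'" using \<open>0 < e\<close> by (simp add: e'_def add_nonneg_pos)
    have "B * e' \<le> (\<bar>B\<bar> + 1) * e'"
      using \<open>0 < e'\<close> by (intro mult_right_mono) auto
    also have "\<dots> = e / 2" by (simp add: e'_def field_simps)
    finally show "B * e' \<le> e / 2" .
  qed
  have ev: "\<forall>\<^sub>F s in at s0 within S. s \<in> S"
    by (simp add: eventually_at_filter)
  have "((\<lambda>s. \<Lambda> s (\<psi> s0)) \<longlongrightarrow> \<Lambda> s0 (\<psi> s0)) (at s0 within S)"
    using fixed[OF continuous_on_slice(1)[OF cont s0]] s0 by (auto simp: continuous_on_def)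
  then have "\<forall>\<^sub>F s in at s0 within S. dist (\<Lambda> s (\<psi> s0)) (\<Lambda> s0 (\<psi> s0)) < e / 2"
    using \<open>0 < e\<close> by (intro tendstoD) auto
  then show "\<forall>\<^sub>F s in at s0 within S. dist (\<Lambda> s (\<psi> s)) (\<Lambda> s0 (\<psi> s0)) < e"
    using eventually_uniform_on_compact[OF cont Y s0 e'(1)] ev
  proof eventually_elim
    case (elim s)
    have "\<bar>\<Lambda> s (\<psi> s) - \<Lambda> s (\<psi> s0)\<bar> \<le> B * e'"
      using elim s0 e'(1) by (intro lip continuous_on_slice[OF cont]) auto
    then show ?case
      using elim(1) e'(2) unfolding dist_real_def by linarith
  qed
qed

lemma continuous_on_kernel_integral:
  fixes \<psi> :: "'s::topological_space \<Rightarrow> 'y::topological_space \<Rightarrow> real"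
  assumes K: "weakly_continuous_on S Y K" "\<And>s. s \<in> S \<Longrightarrow> K s \<in> space (prob_algebra (borel_on Y))"
    and Y: "compact Y" and cont: "continuous_on (S \<times> Y) (\<lambda>(s, y). \<psi> s y)"
  shows "continuous_on S (\<lambda>s. LINT y|K s. \<psi> s y)"
proof (rule continuous_on_lipschitz_functional[where \<Lambda>="\<lambda>s \<phi>. LINT y|K s. \<phi> y" and B=1, OF _ _ Y cont])
  show "continuous_on S (\<lambda>s. LINT y|K s. \<phi> y)" if "continuous_on Y \<phi>" for \<phi> :: "'y \<Rightarrow> real"
    using K(1) that bdd_image_compact(3)[OF Y that] by (simp add: weakly_continuous_on_def)
next
  fix s and \<phi> \<phi>' :: "'y \<Rightarrow> real" and e :: real
  assume s: "s \<in> S" and \<phi>: "continuous_on Y \<phi>" "continuous_on Y \<phi>'"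
    and "0 < e" and close: "\<And>y. y \<in> Y \<Longrightarrow> \<bar>\<phi> y - \<phi>' y\<bar> \<le> e"
  have "(LINT y|K s. \<phi> y) - (LINT y|K s. \<phi>' y) = (LINT y|K s. \<phi> y - \<phi>' y)"
    using integrable_continuous_on[OF Y K(2)[OF s] \<phi>(1)] integrable_continuous_on[OF Y K(2)[OF s] \<phi>(2)]
    by simp
  also have "\<bar>\<dots>\<bar> \<le> e"
    using close \<open>0 < e\<close> by (intro prob_integral_abs_le[OF K(2)[OF s]]) auto
  finally show "\<bar>(LINT y|K s. \<phi> y) - (LINT y|K s. \<phi>' y)\<bar> \<le> 1 * e" by simp
qed

text \<open>Closed subsets of \<open>Y\<close> form an intersection-stable generator, and the mass
  of a closed set is a pointwise limit of integrals of continuous functions, each continuous in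
  \<open>s\<close>. In this way weak continuity supplies the Borel measurability demanded of
  policies and admissible kernels.\<close>

lemma measurable_weakly_continuous_kernel:
  fixes K :: "'s::topological_space \<Rightarrow> 'y::metric_space measure"
  assumes K: "weakly_continuous_on S Y K" "\<And>s. s \<in> S \<Longrightarrow> K s \<in> space (prob_algebra (borel_on Y))"
    and Y: "compact Y"
  shows "K \<in> borel_on S \<rightarrow>\<^sub>M prob_algebra (borel_on Y)"
proof (rule measurable_prob_algebra_generated)
  let ?G = "{C. closed C \<and> C \<subseteq> Y}"
  have "closed Y" by (rule compact_imp_closed[OF Y])
  show "?G \<subseteq> Pow Y" "Int_stable ?G"
    by (auto simp: Int_stable_def)
  show "sets (borel_on Y) = sigma_sets Y ?G"
  proof -
    have "sets (borel_on Y) = (\<inter>) Y ` sigma_sets UNIV (Collect closed)"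
      by (simp add: sets_restrict_space borel_eq_closed)
    also have "\<dots> = sigma_sets Y ((\<inter>) Y ` Collect closed)"
      using restricted_sigma[of Y UNIV "Collect closed"] \<open>closed Y\<close> by auto
    also have "(\<inter>) Y ` Collect closed = ?G"
      using \<open>closed Y\<close> by (auto simp: image_iff intro: closed_Int)
    finally show ?thesis .
  qed
  fix C assume "C \<in> ?G"
  then have C: "closed C" "C \<subseteq> Y" by auto
  show "(\<lambda>s. emeasure (K s) C) \<in> borel_measurable (borel_on S)"
  proof (cases "C = {}")
    case False
    \<comment> \<open>Continuous cut-offs decreasing to the indicator of \<open>C\<close>. The empty
      set is treated apart because \<open>infdist\<close> to it is 0 by convention, which would make
      every cut-off constantly 1.\<close>
    define \<phi> where "\<phi> n y = max 0 (1 - real n * infdist y C)" for n :: nat and y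
    have \<phi>_cont: "continuous_on Y (\<phi> n)" for n
      unfolding \<phi>_def by (intro continuous_intros)
    have [measurable]: "(\<lambda>s. LINT y|K s. \<phi> n y) \<in> borel_measurable (borel_on S)" for n
      using \<phi>_cont bdd_image_compact(3)[OF Y \<phi>_cont] K(1)
      by (intro borel_measurable_continuous_on_restrict) (auto simp: weakly_continuous_on_def)
    have lim: "(\<lambda>n. LINT y|K s. \<phi> n y) \<longlonglongrightarrow> measure (K s) C" if s: "s \<in> S" for s
    proof -
      interpret prob_space "K s" using prob_borel_onD K(2)[OF s] by blast
      have C_sets: "C \<in> sets (K s)"
        using C \<open>closed Y\<close> prob_borel_onD(2)[OF K(2)[OF s]]
        by (auto simp: sets_restrict_space image_iff intro!: bexI[of _ C])
      have "(\<lambda>n. LINT y|K s. \<phi> n y) \<longlonglongrightarrow> (LINT y|K s. indicator C y)"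
      proof (rule integral_dominated_convergence[where w="\<lambda>_. 1"])
        show "\<phi> n \<in> borel_measurable (K s)" for n
          using \<phi>_cont prob_borel_onD(2)[OF K(2)[OF s]] by (rule measurable_continuous_on_borel_on)
        show "AE y in K s. norm (\<phi> n y) \<le> 1" for n
          by (auto simp: \<phi>_def infdist_nonneg)
        show "AE y in K s. (\<lambda>n. \<phi> n y) \<longlonglongrightarrow> indicator C y"
        proof (rule AE_I2)
          fix y
          show "(\<lambda>n. \<phi> n y) \<longlonglongrightarrow> indicator C y"
          proof (cases "y \<in> C")
            case True then show ?thesis by (simp add: \<phi>_def)
          next
            case y: False
            then have "0 < infdist y C"
              using C(1) False in_closed_iff_infdist_zero[of C y] infdist_nonneg[of y C] by force
            then obtain N where N: "1 < real N * infdist y C"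
              using reals_Archimedean3 by blast
            have "\<phi> n y = 0" if "N \<le> n" for n
              using mult_right_mono[of "real N" "real n" "infdist y C"] that N infdist_nonneg[of y C]
              by (auto simp: \<phi>_def)
            then have "(\<lambda>n. \<phi> n y) \<longlonglongrightarrow> 0"
              by (intro tendsto_eventually) (auto simp: eventually_sequentially)
            with y show ?thesis by simp
          qed
        qed
      qed (use C_sets in auto)
      then show ?thesis using C_sets by simp
    qed
    have "(\<lambda>s. measure (K s) C) \<in> borel_measurable (borel_on S)"
      by (rule borel_measurable_LIMSEQ_real[of _ "\<lambda>n s. LINT y|K s. \<phi> n y"])
        (auto simp: space_restrict_space lim)
    then have "(\<lambda>s. ennreal (measure (K s) C)) \<in> borel_measurable (borel_on S)"
      by simp
    then show ?thesis
      by (rule measurable_cong[THEN iffD1, rotated])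
        (auto simp: space_restrict_space intro!: finite_measure.emeasure_eq_measure[symmetric]
          prob_space.finite_measure prob_borel_onD(1) K(2))
  qed simp
qed (auto simp: space_restrict_space intro: prob_borel_onD(1)[OF K(2)] prob_borel_onD(2)[OF K(2), THEN equalityD1, THEN subsetD]
      prob_borel_onD(2)[OF K(2), THEN equalityD2, THEN subsetD])

text \<open>Second countability puts the open sets of the product space into the product
  sigma-algebra. Jointly continuous functions thereby become measurable for the sigma-algebra on
  which kernels and couplings are defined.\<close>

lemma measurable_pair_borel_on:
  fixes X :: "'x::second_countable_topology set" and Y :: "'y::second_countable_topology set"
  shows "(\<lambda>z. z) \<in> borel_on X \<Otimes>\<^sub>M borel_on Y \<rightarrow>\<^sub>M borel_on (X \<times> Y)"
proof (rule measurable_restrict_space2)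
  have [measurable]: "fst \<in> borel_on X \<Otimes>\<^sub>M borel_on Y \<rightarrow>\<^sub>M borel"
    "snd \<in> borel_on X \<Otimes>\<^sub>M borel_on Y \<rightarrow>\<^sub>M borel"
    using measurable_compose[OF measurable_fst measurable_restrict_space1[OF measurable_ident]]
      measurable_compose[OF measurable_snd measurable_restrict_space1[OF measurable_ident]]
    by (auto simp: id_def)
  have "(\<lambda>z. (fst z, snd z)) \<in> borel_on X \<Otimes>\<^sub>M borel_on Y \<rightarrow>\<^sub>M borel"
    by measurable
  then show "(\<lambda>z. z) \<in> borel_on X \<Otimes>\<^sub>M borel_on Y \<rightarrow>\<^sub>M borel"
    by simp
qed (auto simp: space_pair_measure space_restrict_space)

section \<open>Directional gradients\<close>

lemma segment_point_mem:
  fixes \<theta> r :: "'p::real_vector"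
  assumes "closed_segment \<theta> (\<theta> + r) \<subseteq> \<Theta>" "s \<in> {0..1}"
  shows "\<theta> + s *\<^sub>R r \<in> \<Theta>"
proof -
  have "\<theta> + s *\<^sub>R r = (1 - s) *\<^sub>R \<theta> + s *\<^sub>R (\<theta> + r)"
    by (simp add: algebra_simps)
  then show ?thesis
    using assms by (auto simp: in_segment subset_iff)
qed

text \<open>Moving from one point of the segment to another stays on the segment by convexity, so
  \<open>y - s\<close> is among the increments that \<open>has_dir_gradient\<close> admits at the
  point with parameter \<open>s\<close>. All differentiation thereby reduces to one-variable
  calculus on the unit interval.\<close>

lemma segment_point_deriv:
  assumes grad: "has_dir_gradient \<Theta> F (\<theta> + s *\<^sub>R r) v"
    and seg: "closed_segment \<theta> (\<theta> + r) \<subseteq> \<Theta>" and s: "s \<in> {0..1}"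
  shows "((\<lambda>s. F (\<theta> + s *\<^sub>R r)) has_real_derivative v \<bullet> r) (at s within {0..1})"
proof -
  let ?\<theta> = "\<theta> + s *\<^sub>R r"
  let ?H = "{h. closed_segment ?\<theta> (?\<theta> + h *\<^sub>R r) \<subseteq> \<Theta>}"
  have "filterlim (\<lambda>y. y - s) (at 0 within ?H) (at s within {0..1})"
    unfolding filterlim_at
  proof
    have "closed_segment ?\<theta> (?\<theta> + (y - s) *\<^sub>R r) \<subseteq> \<Theta>" if "y \<in> {0..1}" for y
    proof -
      have "?\<theta> + (y - s) *\<^sub>R r = \<theta> + y *\<^sub>R r" by (simp add: algebra_simps)
      moreover have "\<theta> + y *\<^sub>R r \<in> closed_segment \<theta> (\<theta> + r)" "?\<theta> \<in> closed_segment \<theta> (\<theta> + r)"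
        by (rule segment_point_mem[OF order_refl], use that s in simp)+
      ultimately show ?thesis
        using closed_segment_subset[of ?\<theta> _ "\<theta> + y *\<^sub>R r", OF _ _ convex_closed_segment]
        by (metis seg subset_trans)
    qed
    then show "\<forall>\<^sub>F y in at s within {0..1}. y - s \<in> ?H \<and> y - s \<noteq> 0"
      by (auto simp: eventually_at_filter)
    show "((\<lambda>y. y - s) \<longlongrightarrow> 0) (at s within {0..1})"
      by (auto intro!: tendsto_eq_intros)
  qed
  from filterlim_compose[OF grad[unfolded has_dir_gradient_def, THEN spec, of r] this]
  show ?thesis
    by (simp add: has_field_derivative_iff algebra_simps)
qed

text \<open>Positive and negative increments along \<open>r\<close> are separate one-sided limits.
  Each is the right derivative at 0 along a single feasible segment, of direction
  \<open>\<delta> *\<^sub>R r\<close> with \<open>\<delta>\<close> of the appropriate sign, after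
  rescaling the increment by \<open>\<delta>\<close>.\<close>

lemma has_dir_gradientI:
  assumes "\<And>r. closed_segment \<theta> (\<theta> + r) \<subseteq> \<Theta> \<Longrightarrow>
    ((\<lambda>s. F (\<theta> + s *\<^sub>R r)) has_real_derivative v \<bullet> r) (at 0 within {0..1})"
  shows "has_dir_gradient \<Theta> F \<theta> v"
  unfolding has_dir_gradient_def
proof
  fix r
  let ?H = "{h. closed_segment \<theta> (\<theta> + h *\<^sub>R r) \<subseteq> \<Theta>}"
  let ?Q = "\<lambda>h. (F (\<theta> + h *\<^sub>R r) - F \<theta>) / h"
  \<comment> \<open>The sign \<open>c\<close> is 1 or -1, so both half-lines are treated at once. If
    no admissible increment has this sign, the filter is trivial and nothing is to be shown.\<close>
  have half: "(?Q \<longlongrightarrow> v \<bullet> r) (at 0 within {h \<in> ?H. 0 < c * h})" if c: "\<bar>c\<bar> = 1" for c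
  proof (cases "{h \<in> ?H. 0 < c * h} = {}")
    case False
    then obtain \<delta> where \<delta>: "\<delta> \<in> ?H" "0 < c * \<delta>" by auto
    have [simp]: "\<delta> \<noteq> 0" using \<delta>(2) by auto
    let ?L = "at 0 within {h \<in> ?H. 0 < c * h}"
    have "filterlim (\<lambda>h. h / \<delta>) (at 0 within {0..1}) ?L"
      unfolding filterlim_at
    proof
      have "\<forall>\<^sub>F h in ?L. \<bar>h\<bar> < \<bar>\<delta>\<bar>"
        unfolding eventually_at using \<delta>(2) by (auto intro!: exI[of _ "\<bar>\<delta>\<bar>"])
      moreover have "\<forall>\<^sub>F h in ?L. 0 < c * h"
        by (auto simp: eventually_at_filter)
      ultimately show "\<forall>\<^sub>F h in ?L. h / \<delta> \<in> {0..1} \<and> h / \<delta> \<noteq> 0"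
      proof eventually_elim
        case (elim h)
        then show ?case
          using \<delta>(2) c
          by (cases "c = 1") (auto simp: abs_if divide_le_eq_1 zero_le_divide_iff split: if_splits)
      qed
      show "((\<lambda>h. h / \<delta>) \<longlongrightarrow> 0) ?L"
        by (auto intro!: tendsto_eq_intros)
    qed
    moreover have "((\<lambda>s. (F (\<theta> + s *\<^sub>R \<delta> *\<^sub>R r) - F \<theta>) / s) \<longlongrightarrow> v \<bullet> (\<delta> *\<^sub>R r)) (at 0 within {0..1})"
      using assms[of "\<delta> *\<^sub>R r"] \<delta>(1) by (simp add: has_field_derivative_iff)
    ultimately have "((\<lambda>h. (F (\<theta> + (h / \<delta>) *\<^sub>R \<delta> *\<^sub>R r) - F \<theta>) / (h / \<delta>)) \<longlongrightarrow> v \<bullet> (\<delta> *\<^sub>R r)) ?L"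
      by (rule filterlim_compose[rotated])
    then have "((\<lambda>h. (F (\<theta> + (h / \<delta>) *\<^sub>R \<delta> *\<^sub>R r) - F \<theta>) / (h / \<delta>) / \<delta>) \<longlongrightarrow> v \<bullet> (\<delta> *\<^sub>R r) / \<delta>) ?L"
      by (intro tendsto_intros) auto
    then show ?thesis by simp
  next
    case True
    show ?thesis unfolding True by simp
  qed
  have "?H - {0} = ({h \<in> ?H. 0 < 1 * h} \<union> {h \<in> ?H. 0 < (- 1) * h}) - {0}"
    by auto
  then have "at 0 within ?H = at 0 within ({h \<in> ?H. 0 < 1 * h} \<union> {h \<in> ?H. 0 < (- 1) * h})"
    by (simp only: at_within_def)
  then show "(?Q \<longlongrightarrow> v \<bullet> r) (at 0 within ?H)"
    using half[of 1] half[of "- 1"] by (simp add: Lim_within_Un)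
qed

section \<open>Uniqueness and choice of the representing vector\<close>

lemma feasible_directionsE:
  assumes "r \<in> feasible_directions \<Theta> \<theta>"
  obtains \<delta> where "0 < \<delta>" "closed_segment \<theta> (\<theta> + \<delta> *\<^sub>R r) \<subseteq> \<Theta>"
  using assms by (auto simp: feasible_directions_def)

lemma feasible_directionsI:
  "closed_segment \<theta> (\<theta> + r) \<subseteq> \<Theta> \<Longrightarrow> r \<in> feasible_directions \<Theta> \<theta>"
  by (auto simp: feasible_directions_def intro!: exI[of _ 1])

lemma real_derivative_unique_unit:
  assumes "(\<phi> has_real_derivative D) (at s within {0..1})"
    "(\<phi> has_real_derivative E) (at s within {0..1})" "s \<in> {0..1}"
  shows "D = E"
proof -
  have "at s within {0..1} \<noteq> bot"
    using assms(3) by (simp add: trivial_limit_within islimpt_Icc)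
  then show ?thesis
    using assms(1,2) unfolding has_field_derivative_iff by (rule tendsto_unique)
qed

lemma has_dir_gradient_inner_unique:
  assumes "has_dir_gradient \<Theta> F \<theta> v" "has_dir_gradient \<Theta> F \<theta> w"
    "r \<in> span (feasible_directions \<Theta> \<theta>)"
  shows "v \<bullet> r = w \<bullet> r"
  using assms(3)
proof (induction rule: span_induct)
  case base
  show ?case by (auto simp: subspace_def inner_right_distrib)
next
  case (step r)
  then obtain \<delta> where \<delta>: "0 < \<delta>" "closed_segment \<theta> (\<theta> + \<delta> *\<^sub>R r) \<subseteq> \<Theta>"
    by (rule feasible_directionsE)
  have "v \<bullet> (\<delta> *\<^sub>R r) = w \<bullet> (\<delta> *\<^sub>R r)"
    using segment_point_deriv[of \<Theta> F \<theta> 0 "\<delta> *\<^sub>R r"] \<delta>(2) assms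
    by (intro real_derivative_unique_unit[of "\<lambda>s. F (\<theta> + s *\<^sub>R \<delta> *\<^sub>R r)" _ 0]) auto
  with \<delta>(1) show ?case by simp
qed

lemma orthogonal_decomp_span:
  fixes b :: "'p::euclidean_space"
  obtains s z where "s \<in> span S" "b = s + z" "\<And>v. v \<in> span S \<Longrightarrow> v \<bullet> z = 0"
proof -
  obtain s z where "s \<in> span S" "\<And>w. w \<in> span S \<Longrightarrow> orthogonal z w" "b = s + z"
    using orthogonal_subspace_decomp_exists[of S b] by blast
  then show thesis
    using that[of s z] by (auto simp: orthogonal_def inner_commute)
qed

lemma has_dir_gradient_unique:
  assumes "has_dir_gradient \<Theta> F \<theta> v" "has_dir_gradient \<Theta> F \<theta> w"
    "v \<in> span (feasible_directions \<Theta> \<theta>)" "w \<in> span (feasible_directions \<Theta> \<theta>)"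
  shows "v = w"
proof -
  have "v - w \<in> span (feasible_directions \<Theta> \<theta>)"
    using assms by (intro span_diff)
  from has_dir_gradient_inner_unique[OF assms(1,2) this] have "(v - w) \<bullet> (v - w) = 0"
    by (simp only: inner_diff_left)
  then show ?thesis by simp
qed

lemma dir_gradient_eqI:
  assumes "has_dir_gradient \<Theta> F \<theta> v" "v \<in> span (feasible_directions \<Theta> \<theta>)"
  shows "dir_gradient \<Theta> F \<theta> = v"
  unfolding dir_gradient_def using assms has_dir_gradient_unique by (intro the_equality) auto

text \<open>Projecting any representing vector orthogonally onto the span of the feasible directions
  leaves its product with every feasible direction unchanged. So the description in
  \<open>dir_gradient\<close> has a witness as soon as some representing vector exists.\<close>

lemma dir_gradient_props:
  assumes "dir_differentiable \<Theta> F \<theta>"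
  shows "has_dir_gradient \<Theta> F \<theta> (dir_gradient \<Theta> F \<theta>)"
    "dir_gradient \<Theta> F \<theta> \<in> span (feasible_directions \<Theta> \<theta>)"
proof -
  obtain v where v: "has_dir_gradient \<Theta> F \<theta> v"
    using assms by (auto simp: dir_differentiable_def)
  obtain s z where s: "s \<in> span (feasible_directions \<Theta> \<theta>)" and vs: "v = s + z"
    and orth: "\<And>v. v \<in> span (feasible_directions \<Theta> \<theta>) \<Longrightarrow> v \<bullet> z = 0"
    using orthogonal_decomp_span[of "feasible_directions \<Theta> \<theta>" v] by metis
  have "has_dir_gradient \<Theta> F \<theta> s"
  proof (rule has_dir_gradientI)
    fix r assume r: "closed_segment \<theta> (\<theta> + r) \<subseteq> \<Theta>"
    have "v \<bullet> r = s \<bullet> r"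
      using orth[OF span_base[OF feasible_directionsI[OF r]]] vs
      by (simp add: inner_add_left inner_add_right inner_commute)
    then show "((\<lambda>s. F (\<theta> + s *\<^sub>R r)) has_real_derivative s \<bullet> r) (at 0 within {0..1})"
      using segment_point_deriv[of \<Theta> F \<theta> 0 r v] v r by simp
  qed
  then show "has_dir_gradient \<Theta> F \<theta> (dir_gradient \<Theta> F \<theta>)"
    "dir_gradient \<Theta> F \<theta> \<in> span (feasible_directions \<Theta> \<theta>)"
    using s dir_gradient_eqI[of \<Theta> F \<theta> s] by auto
qed

lemma has_dir_gradient_cong:
  assumes "\<And>\<theta>. \<theta> \<in> \<Theta> \<Longrightarrow> F \<theta> = F' \<theta>"
  shows "has_dir_gradient \<Theta> F \<theta> v \<longleftrightarrow> has_dir_gradient \<Theta> F' \<theta> v"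
  unfolding has_dir_gradient_def
proof (intro iff_allI tendsto_cong)
  fix r
  have quotient: "(F (\<theta> + h *\<^sub>R r) - F \<theta>) / h = (F' (\<theta> + h *\<^sub>R r) - F' \<theta>) / h"
    if "closed_segment \<theta> (\<theta> + h *\<^sub>R r) \<subseteq> \<Theta>" for h
    using that assms by (auto simp: subset_iff)
  show "\<forall>\<^sub>F h in at 0 within {h. closed_segment \<theta> (\<theta> + h *\<^sub>R r) \<subseteq> \<Theta>}.
      (F (\<theta> + h *\<^sub>R r) - F \<theta>) / h = (F' (\<theta> + h *\<^sub>R r) - F' \<theta>) / h"
    unfolding eventually_at_filter by (intro always_eventually allI impI quotient) simp
qed

lemma dir_gradient_cong:
  assumes "\<And>\<theta>. \<theta> \<in> \<Theta> \<Longrightarrow> F \<theta> = F' \<theta>"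
  shows "dir_gradient \<Theta> F \<theta> = dir_gradient \<Theta> F' \<theta>"
    "dir_differentiable \<Theta> F \<theta> \<longleftrightarrow> dir_differentiable \<Theta> F' \<theta>"
proof -
  have "has_dir_gradient \<Theta> F \<theta> = has_dir_gradient \<Theta> F' \<theta>"
    by (rule ext, rule has_dir_gradient_cong, rule assms)
  then show "dir_gradient \<Theta> F \<theta> = dir_gradient \<Theta> F' \<theta>"
    "dir_differentiable \<Theta> F \<theta> \<longleftrightarrow> dir_differentiable \<Theta> F' \<theta>"
    by (simp_all add: dir_gradient_def dir_differentiable_def)
qed

lemma has_dir_gradient_const: "has_dir_gradient \<Theta> (\<lambda>_. c) \<theta> 0"
  by (simp add: has_dir_gradient_def)

lemma dir_gradient_const: "dir_gradient \<Theta> (\<lambda>_. c) \<theta> = 0"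
  by (rule dir_gradient_eqI[OF has_dir_gradient_const span_zero])

text \<open>Since \<open>v\<close> takes values in the span of \<open>S\<close>, the component along
  \<open>b\<close> equals the component along the projection of \<open>b\<close> onto that span, and
  the latter is a linear combination of components along members of \<open>S\<close>. This passes
  from feasible directions, where difference quotients exist, to all coordinates.\<close>

lemma span_component_induct:
  fixes v :: "'y \<Rightarrow> 'p::euclidean_space"
  assumes span: "\<And>y. y \<in> Y \<Longrightarrow> v y \<in> span S"
    and base: "\<And>r. r \<in> S \<Longrightarrow> P (\<lambda>y. v y \<bullet> r)"
    and zero: "P (\<lambda>_. 0 :: real)" and add: "\<And>f g. P f \<Longrightarrow> P g \<Longrightarrow> P (\<lambda>y. f y + g y)"
    and scale: "\<And>c f. P f \<Longrightarrow> P (\<lambda>y. c * f y)"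
    and cong: "\<And>f g. (\<And>y. y \<in> Y \<Longrightarrow> f y = g y) \<Longrightarrow> P f \<Longrightarrow> P g"
  shows "P (\<lambda>y. v y \<bullet> b)"
proof -
  obtain s z where s: "s \<in> span S" "b = s + z" "\<And>v. v \<in> span S \<Longrightarrow> v \<bullet> z = 0"
    using orthogonal_decomp_span[of S b] by metis
  have "P (\<lambda>y. v y \<bullet> s)"
    using s(1) by (induction rule: span_induct)
      (auto simp: subspace_def inner_right_distrib zero add scale base)
  then show ?thesis
    by (rule cong[rotated]) (use s span in \<open>simp add: inner_right_distrib\<close>)
qed

lemma continuous_on_span_valued:
  fixes v :: "'y::topological_space \<Rightarrow> 'p::euclidean_space"
  assumes "\<And>y. y \<in> Y \<Longrightarrow> v y \<in> span S" "\<And>r. r \<in> S \<Longrightarrow> continuous_on Y (\<lambda>y. v y \<bullet> r)"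
  shows "continuous_on Y v"
proof -
  have "continuous_on Y (\<lambda>y. v y \<bullet> b)" for b
  proof (rule span_component_induct[where P="continuous_on Y", OF assms])
    show "continuous_on Y f \<Longrightarrow> continuous_on Y g" if "\<And>y. y \<in> Y \<Longrightarrow> f y = g y" for f g
      using continuous_on_eq[of Y f g] that by blast
  qed (auto intro: continuous_intros)
  then have "continuous_on Y (\<lambda>y. \<Sum>b\<in>Basis. (v y \<bullet> b) *\<^sub>R b)"
    by (intro continuous_on_sum continuous_on_scaleR continuous_on_const)
  then show ?thesis
    by (simp only: euclidean_representation)
qed

lemma borel_measurable_span_valued:
  fixes v :: "'y \<Rightarrow> 'p::euclidean_space"
  assumes "\<And>y. y \<in> space M \<Longrightarrow> v y \<in> span S"
    "\<And>r. r \<in> S \<Longrightarrow> (\<lambda>y. v y \<bullet> r) \<in> borel_measurable M"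
  shows "v \<in> borel_measurable M"
proof (rule borel_measurable_euclidean_space[THEN iffD2], rule)
  fix b :: 'p
  show "(\<lambda>y. v y \<bullet> b) \<in> borel_measurable M"
  proof (rule span_component_induct[where P="\<lambda>f. f \<in> borel_measurable M", OF assms])
    show "f \<in> borel_measurable M \<Longrightarrow> g \<in> borel_measurable M"
      if "\<And>y. y \<in> space M \<Longrightarrow> f y = g y" for f g
      using measurable_cong[of M f g borel, OF that] by blast
  qed auto
qed

section \<open>Families of class C1 along segments\<close>

text \<open>At boundary points of \<open>\<Theta>\<close> the gradient may fail to be continuous in \<open>\<theta>\<close>, because the
  span of the feasible directions jumps; the derivative along a fixed segment does not see this.\<close>

definition C1_on_segments ::
  "'p::euclidean_space set \<Rightarrow> 'y::topological_space set \<Rightarrow> ('p \<Rightarrow> 'y \<Rightarrow> real) \<Rightarrow> bool" where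
  "C1_on_segments \<Theta> Y F \<longleftrightarrow>
     (\<forall>\<theta>\<in>\<Theta>. \<forall>y\<in>Y. dir_differentiable \<Theta> (\<lambda>\<theta>. F \<theta> y) \<theta>) \<and>
     (\<forall>\<theta> r. closed_segment \<theta> (\<theta> + r) \<subseteq> \<Theta> \<longrightarrow>
        continuous_on ({0..1} \<times> Y)
          (\<lambda>(s, y). dir_gradient \<Theta> (\<lambda>\<theta>. F \<theta> y) (\<theta> + s *\<^sub>R r) \<bullet> r))"

lemma C1_on_segmentsD:
  assumes "C1_on_segments \<Theta> Y F" "closed_segment \<theta> (\<theta> + r) \<subseteq> \<Theta>"
  shows "continuous_on ({0..1} \<times> Y) (\<lambda>(s, y). dir_gradient \<Theta> (\<lambda>\<theta>. F \<theta> y) (\<theta> + s *\<^sub>R r) \<bullet> r)"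
    "\<And>s y. s \<in> {0..1} \<Longrightarrow> y \<in> Y \<Longrightarrow> ((\<lambda>s. F (\<theta> + s *\<^sub>R r) y) has_real_derivative
      dir_gradient \<Theta> (\<lambda>\<theta>. F \<theta> y) (\<theta> + s *\<^sub>R r) \<bullet> r) (at s within {0..1})"
proof -
  show "continuous_on ({0..1} \<times> Y) (\<lambda>(s, y). dir_gradient \<Theta> (\<lambda>\<theta>. F \<theta> y) (\<theta> + s *\<^sub>R r) \<bullet> r)"
    using assms by (simp add: C1_on_segments_def)
next
  fix s y assume *: "s \<in> {0..1::real}" "y \<in> Y"
  then have "dir_differentiable \<Theta> (\<lambda>\<theta>. F \<theta> y) (\<theta> + s *\<^sub>R r)"
    using assms(1) segment_point_mem[OF assms(2)] by (simp add: C1_on_segments_def)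
  from segment_point_deriv[OF dir_gradient_props(1)[OF this] assms(2) *(1)]
  show "((\<lambda>s. F (\<theta> + s *\<^sub>R r) y) has_real_derivative
      dir_gradient \<Theta> (\<lambda>\<theta>. F \<theta> y) (\<theta> + s *\<^sub>R r) \<bullet> r) (at s within {0..1})" .
qed

text \<open>At a fixed \<open>\<theta>\<close> the span of the feasible directions does not move.
  The parameter value 0 on each feasible segment then gives continuity in \<open>y\<close> of all
  relevant components, hence of the gradient vector, which can therefore be integrated over
  \<open>y\<close>.\<close>

lemma C1_on_segments_gradient_continuous:
  assumes C1: "C1_on_segments \<Theta> Y F" and \<theta>: "\<theta> \<in> \<Theta>"
  shows "continuous_on Y (\<lambda>y. dir_gradient \<Theta> (\<lambda>\<theta>. F \<theta> y) \<theta>)"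
proof (rule continuous_on_span_valued)
  show "dir_gradient \<Theta> (\<lambda>\<theta>. F \<theta> y) \<theta> \<in> span (feasible_directions \<Theta> \<theta>)" if "y \<in> Y" for y
    using C1 \<theta> that by (auto simp: C1_on_segments_def intro: dir_gradient_props(2))
next
  fix r assume "r \<in> feasible_directions \<Theta> \<theta>"
  then obtain \<delta> where \<delta>: "0 < \<delta>" "closed_segment \<theta> (\<theta> + \<delta> *\<^sub>R r) \<subseteq> \<Theta>"
    by (rule feasible_directionsE)
  have "continuous_on Y (\<lambda>y. dir_gradient \<Theta> (\<lambda>\<theta>. F \<theta> y) \<theta> \<bullet> (\<delta> *\<^sub>R r) / \<delta>)"
    using continuous_on_slice(1)[OF C1_on_segmentsD(1)[OF C1 \<delta>(2)], of 0]
    by (intro continuous_on_divide continuous_on_const) (use \<delta>(1) in auto)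
  then show "continuous_on Y (\<lambda>y. dir_gradient \<Theta> (\<lambda>\<theta>. F \<theta> y) \<theta> \<bullet> r)"
    using \<delta>(1) by simp
qed

lemma C1_on_segments_cong:
  assumes C1: "C1_on_segments \<Theta> Y F" and eq: "\<And>\<theta> y. \<theta> \<in> \<Theta> \<Longrightarrow> y \<in> Y \<Longrightarrow> F \<theta> y = F' \<theta> y"
  shows "C1_on_segments \<Theta> Y F'"
  unfolding C1_on_segments_def
proof (intro conjI ballI allI impI)
  show "dir_differentiable \<Theta> (\<lambda>\<theta>. F' \<theta> y) \<theta>" if "\<theta> \<in> \<Theta>" "y \<in> Y" for \<theta> y
    using C1 that dir_gradient_cong(2)[of \<Theta> "\<lambda>\<theta>. F \<theta> y" "\<lambda>\<theta>. F' \<theta> y" \<theta>] eq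
    by (simp add: C1_on_segments_def)
  fix \<theta> r assume "closed_segment \<theta> (\<theta> + r) \<subseteq> \<Theta>"
  from C1_on_segmentsD(1)[OF C1 this]
  show "continuous_on ({0..1} \<times> Y) (\<lambda>(s, y). dir_gradient \<Theta> (\<lambda>\<theta>. F' \<theta> y) (\<theta> + s *\<^sub>R r) \<bullet> r)"
  proof (rule continuous_on_eq)
    fix w assume "w \<in> {0..1::real} \<times> Y"
    then show "(\<lambda>(s, y). dir_gradient \<Theta> (\<lambda>\<theta>. F \<theta> y) (\<theta> + s *\<^sub>R r) \<bullet> r) w =
        (\<lambda>(s, y). dir_gradient \<Theta> (\<lambda>\<theta>. F' \<theta> y) (\<theta> + s *\<^sub>R r) \<bullet> r) w"
      using dir_gradient_cong(1)[of \<Theta> "\<lambda>\<theta>. F \<theta> (snd w)" "\<lambda>\<theta>. F' \<theta> (snd w)"] eq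
      by (auto simp: case_prod_beta)
  qed
qed

text \<open>Hadamard's lemma: the quotient is the mean of the derivative over the segment from \<open>s\<close>
  to \<open>s'\<close>, hence jointly continuous.\<close>

lemma continuous_difference_quotient:
  fixes v d :: "real \<Rightarrow> 'y::topological_space \<Rightarrow> real"
  assumes deriv: "\<And>s y. s \<in> {0..1} \<Longrightarrow> y \<in> Y \<Longrightarrow>
      ((\<lambda>s. v s y) has_real_derivative d s y) (at s within {0..1})"
    and cont: "continuous_on ({0..1} \<times> Y) (\<lambda>(s, y). d s y)" and s: "s \<in> {0..1}"
  obtains k where "continuous_on ({0..1} \<times> Y) (\<lambda>(s', y). k s' y)"
    "\<And>s' y. s' \<in> {0..1} \<Longrightarrow> y \<in> Y \<Longrightarrow> v s' y - v s y = (s' - s) * k s' y"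
    "\<And>y. y \<in> Y \<Longrightarrow> k s y = d s y"
proof -
  define k where "k s' y = integral {0..1} (\<lambda>\<tau>. d (s + \<tau> * (s' - s)) y)" for s' y
  have mid: "s + \<tau> * (s' - s) \<in> {0..1}" if "s' \<in> {0..1}" "\<tau> \<in> {0..1}" for s' \<tau>
  proof -
    have "s + \<tau> * (s' - s) = (1 - \<tau>) * s + \<tau> * s'" by (simp add: algebra_simps)
    moreover have "(1 - \<tau>) * s + \<tau> * s' \<in> {0..1}"
      using convexD_alt[OF convex_real_interval(5)[of 0 1], of s s' \<tau>] that s by simp
    ultimately show ?thesis by simp
  qed
  show thesis
  proof
    have "continuous_on (({0..1} \<times> Y) \<times> cbox 0 1) 
        (\<lambda>(z, \<tau>). d (s + \<tau> * (fst z - s)) (snd z))"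
      unfolding split_beta
      by (rule continuous_on_compose2[OF cont,
            where f="\<lambda>z. (s + snd z * (fst (fst z) - s), snd (fst z))", simplified split_beta fst_conv snd_conv])
        (use mid in \<open>auto intro!: continuous_intros\<close>)
    from integral_continuous_on_param[OF this]
    show "continuous_on ({0..1} \<times> Y) (\<lambda>(s', y). k s' y)"
      by (simp add: k_def split_beta)
  next
    fix s' :: real and y assume s': "s' \<in> {0..1}" and y: "y \<in> Y"
    have "((\<lambda>\<tau>. (s' - s) * d (s + \<tau> * (s' - s)) y) has_integral
        v (s + 1 * (s' - s)) y - v (s + 0 * (s' - s)) y) {0..1}"
    proof (rule fundamental_theorem_of_calculus)
      fix \<tau> :: real assume \<tau>: "\<tau> \<in> {0..1}"
      have "((\<lambda>\<tau>. v (s + \<tau> * (s' - s)) y) has_real_derivative d (s + \<tau> * (s' - s)) y * (s' - s))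
          (at \<tau> within {0..1})"
      proof (rule DERIV_image_chain[where g="\<lambda>\<tau>. s + \<tau> * (s' - s)" and f="\<lambda>s. v s y", unfolded o_def])
        show "((\<lambda>s. v s y) has_real_derivative d (s + \<tau> * (s' - s)) y)
            (at (s + \<tau> * (s' - s)) within (\<lambda>\<tau>. s + \<tau> * (s' - s)) ` {0..1})"
          by (rule has_field_derivative_subset[OF deriv[OF mid[OF s' \<tau>] y]]) (use mid[OF s'] in blast)
        show "((\<lambda>\<tau>. s + \<tau> * (s' - s)) has_real_derivative s' - s) (at \<tau> within {0..1})"
          by (auto intro!: derivative_eq_intros)
      qed
      then show "((\<lambda>\<tau>. v (s + \<tau> * (s' - s)) y) has_vector_derivative
          (s' - s) * d (s + \<tau> * (s' - s)) y) (at \<tau> within {0..1})"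
        by (simp add: has_real_derivative_iff_has_vector_derivative mult.commute)
    qed simp
    from integral_unique[OF this] show "v s' y - v s y = (s' - s) * k s' y"
      by (simp add: k_def)
  qed (simp add: k_def)
qed

text \<open>The part \<open>z\<close> of the integral orthogonal to the span has product 0 with
  every value of \<open>f\<close>, hence with the integral, so \<open>z \<bullet> z = 0\<close>.
  This certifies that an average of chosen gradients is again a chosen gradient.\<close>

lemma integral_in_span:
  fixes f :: "'y \<Rightarrow> 'p::euclidean_space"
  assumes f: "integrable M f" and span: "\<And>y. y \<in> space M \<Longrightarrow> f y \<in> span S"
  shows "(LINT y|M. f y) \<in> span S"
proof -
  obtain s z where s: "s \<in> span S" "(LINT y|M. f y) = s + z" "\<And>v. v \<in> span S \<Longrightarrow> v \<bullet> z = 0"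
    using orthogonal_decomp_span[of S "LINT y|M. f y"] by metis
  have "(LINT y|M. f y) \<bullet> z = (LINT y|M. f y \<bullet> z)"
    using f by simp
  also have "\<dots> = (LINT y|M. 0)"
    using s(3) span by (intro Bochner_Integration.integral_cong) auto
  finally have "z = 0"
    using s by (simp add: inner_add_left)
  with s show ?thesis by simp
qed

lemma weakly_continuous_on_compose:
  assumes "weakly_continuous_on S Y K" "continuous_on R h" "h ` R \<subseteq> S"
  shows "weakly_continuous_on R Y (\<lambda>s. K (h s))"
  unfolding weakly_continuous_on_def
proof (intro allI impI)
  fix \<phi> :: "_ \<Rightarrow> real" assume "continuous_on Y \<phi> \<and> bounded (\<phi> ` Y)"
  then have "continuous_on S (\<lambda>s. LINT y|K s. \<phi> y)"
    using assms(1) by (simp add: weakly_continuous_on_def)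
  from continuous_on_compose2[OF this assms(2,3)]
  show "continuous_on R (\<lambda>s. LINT y|K (h s). \<phi> y)" .
qed

lemma weakly_continuous_on_segment:
  fixes \<theta> r :: "'p::real_normed_vector"
  assumes "weakly_continuous_on (\<Theta> \<times> Z) Y (\<lambda>(\<theta>, z). K \<theta> z)" "closed_segment \<theta> (\<theta> + r) \<subseteq> \<Theta>"
  shows "weakly_continuous_on ({0..1} \<times> Z) Y (\<lambda>(s, z). K (\<theta> + s *\<^sub>R r) z)"
proof -
  let ?h = "\<lambda>w. (\<theta> + fst w *\<^sub>R r, snd w)"
  have "continuous_on ({0..1} \<times> Z) ?h"
    by (intro continuous_intros)
  moreover have "?h ` ({0..1} \<times> Z) \<subseteq> \<Theta> \<times> Z"
    using segment_point_mem[OF assms(2)] by auto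
  ultimately have "weakly_continuous_on ({0..1} \<times> Z) Y (\<lambda>w. case ?h w of (\<theta>, z) \<Rightarrow> K \<theta> z)"
    by (rule weakly_continuous_on_compose[OF assms(1)])
  then show ?thesis
    by (simp add: case_prod_beta')
qed

lemma continuous_on_insert_middle:
  assumes "continuous_on (S \<times> Y) (\<lambda>(s, y). f s y)"
  shows "continuous_on ((S \<times> Z) \<times> Y) (\<lambda>(w, y). f (fst w) y)"
proof -
  have "continuous_on ((S \<times> Z) \<times> Y) (\<lambda>w. (fst (fst w), snd w))"
    by (intro continuous_intros)
  from continuous_on_compose2[OF assms this] show ?thesis
    by (force simp: split_beta)
qed

section \<open>Envelope theorem\<close>

text \<open>Hypothesis \<open>le\<close> says that the optimal law for one parameter competes at
  every other one. Hence the increment of \<open>G\<close> from \<open>s\<close> to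
  \<open>s'\<close> is at most \<open>s' - s\<close> times the mean of the quotient of
  \<open>V\<close> under the law at \<open>s\<close>, and at least the same with the law at
  \<open>s'\<close>. The first mean converges because the quotient is continuous, the second because
  in addition the law varies weakly continuously. The derivative is thus the mean derivative of
  \<open>V\<close> under the optimal law, as in Danskin's theorem.\<close>

lemma envelope_C1_on_segments:
  fixes V :: "'p::euclidean_space \<Rightarrow> 'y::topological_space \<Rightarrow> real"
    and G :: "'p \<Rightarrow> 'z::topological_space \<Rightarrow> real"
  assumes C1: "C1_on_segments \<Theta> Y V" and Y: "compact Y"
    and K: "weakly_continuous_on (\<Theta> \<times> Z) Y (\<lambda>(\<theta>, z). K \<theta> z)"
      "\<And>\<theta> z. \<theta> \<in> \<Theta> \<Longrightarrow> z \<in> Z \<Longrightarrow> K \<theta> z \<in> space (prob_algebra (borel_on Y))"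
    and attained: "\<And>\<theta> z. \<theta> \<in> \<Theta> \<Longrightarrow> z \<in> Z \<Longrightarrow> G \<theta> z = (LINT y|K \<theta> z. c z y + V \<theta> y)"
    and le: "\<And>\<theta> \<theta>' z. \<theta> \<in> \<Theta> \<Longrightarrow> \<theta>' \<in> \<Theta> \<Longrightarrow> z \<in> Z \<Longrightarrow> G \<theta>' z \<le> (LINT y|K \<theta> z. c z y + V \<theta>' y)"
    and c: "\<And>z. z \<in> Z \<Longrightarrow> continuous_on Y (c z)" and V: "\<And>\<theta>. \<theta> \<in> \<Theta> \<Longrightarrow> continuous_on Y (V \<theta>)"
  shows "C1_on_segments \<Theta> Z G"
proof -
  have deriv: "((\<lambda>s. G (\<theta> + s *\<^sub>R r) z) has_real_derivative
      (LINT y|K (\<theta> + s *\<^sub>R r) z. dir_gradient \<Theta> (\<lambda>\<theta>. V \<theta> y) (\<theta> + s *\<^sub>R r) \<bullet> r)) (at s within {0..1})"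
    if seg: "closed_segment \<theta> (\<theta> + r) \<subseteq> \<Theta>" and s: "s \<in> {0..1}" and z: "z \<in> Z" for \<theta> r s z
  proof -
    define v where "v s = V (\<theta> + s *\<^sub>R r)" for s
    define d where "d s y = dir_gradient \<Theta> (\<lambda>\<theta>. V \<theta> y) (\<theta> + s *\<^sub>R r) \<bullet> r" for s y
    define k where "k s = K (\<theta> + s *\<^sub>R r) z" for s
    note mem = segment_point_mem[OF seg]
    have k: "k s \<in> space (prob_algebra (borel_on Y))" if "s \<in> {0..1}" for s
      unfolding k_def using K(2) mem that z by blast
    have k_weak: "weakly_continuous_on {0..1} Y k"
    proof -
      have "continuous_on {0..1::real} (\<lambda>s. (s, z))"
        by (intro continuous_on_Pair continuous_on_id continuous_on_const)
      from weakly_continuous_on_compose[OF weakly_continuous_on_segment[OF K(1) seg] this] z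
      show ?thesis by (auto simp: k_def[abs_def])
    qed
    have "\<And>s y. s \<in> {0..1} \<Longrightarrow> y \<in> Y \<Longrightarrow> ((\<lambda>s. v s y) has_real_derivative d s y) (at s within {0..1})"
      "continuous_on ({0..1} \<times> Y) (\<lambda>(s, y). d s y)"
      using C1_on_segmentsD[OF C1 seg] by (auto simp: v_def d_def)
    from continuous_difference_quotient[OF this s] obtain \<kappa> where
      \<kappa>: "continuous_on ({0..1} \<times> Y) (\<lambda>(s', y). \<kappa> s' y)"
        "\<And>s' y. s' \<in> {0..1} \<Longrightarrow> y \<in> Y \<Longrightarrow> v s' y - v s y = (s' - s) * \<kappa> s' y"
        "\<And>y. y \<in> Y \<Longrightarrow> \<kappa> s y = d s y" by metis
    define D where "D = (LINT y|k s. d s y)"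
    have increment: "(LINT y|k s1. c z y + v s' y) - (LINT y|k s1. c z y + v s y)
        = (s' - s) * (LINT y|k s1. \<kappa> s' y)"
      if "s' \<in> {0..1}" "s1 \<in> {0..1}" for s' s1
    proof -
      have "integrable (k s1) (\<lambda>y. c z y + v s y)" "integrable (k s1) (\<lambda>y. c z y + v s' y)"
        using that s z mem unfolding v_def
        by (auto intro!: integrable_continuous_on[OF Y k] continuous_intros c V)
      then have "(LINT y|k s1. c z y + v s' y) - (LINT y|k s1. c z y + v s y)
          = (LINT y|k s1. (c z y + v s' y) - (c z y + v s y))"
        by (rule Bochner_Integration.integral_diff[symmetric, rotated])
      also have "\<dots> = (LINT y|k s1. (s' - s) * \<kappa> s' y)"
        using that \<kappa>(2) prob_borel_onD(3)[OF k] by (intro Bochner_Integration.integral_cong) auto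
      finally show ?thesis by simp
    qed
    have G: "G (\<theta> + s *\<^sub>R r) z = (LINT y|k s. c z y + v s y)"
      "G (\<theta> + s' *\<^sub>R r) z \<le> (LINT y|k s1. c z y + v s' y)"
      if "s \<in> {0..1}" "s' \<in> {0..1}" "s1 \<in> {0..1}" for s s' s1
      using attained le mem z that by (auto simp: k_def v_def)
    have upper: "((\<lambda>s'. LINT y|k s. \<kappa> s' y) \<longlongrightarrow> D) (at s within {0..1})"
    proof -
      have "continuous_on {0..1} (\<lambda>s'. LINT y|k s. \<kappa> s' y)"
        using k[OF s] by (intro continuous_on_kernel_integral[OF _ _ Y \<kappa>(1)])
          (auto simp: weakly_continuous_on_def)
      moreover have "(LINT y|k s. \<kappa> s y) = D"
        unfolding D_def using \<kappa>(3) prob_borel_onD(3)[OF k[OF s]]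
        by (intro Bochner_Integration.integral_cong) auto
      ultimately show ?thesis using s by (auto simp: continuous_on_def)
    qed
    have lower: "((\<lambda>s'. LINT y|k s'. \<kappa> s' y) \<longlongrightarrow> D) (at s within {0..1})"
    proof -
      have "continuous_on {0..1} (\<lambda>s'. LINT y|k s'. \<kappa> s' y)"
        by (rule continuous_on_kernel_integral[OF k_weak k Y \<kappa>(1)])
      moreover have "(LINT y|k s. \<kappa> s y) = D"
        unfolding D_def using \<kappa>(3) prob_borel_onD(3)[OF k[OF s]]
        by (intro Bochner_Integration.integral_cong) auto
      ultimately show ?thesis using s by (auto simp: continuous_on_def)
    qed
    let ?Q = "\<lambda>s'. (G (\<theta> + s' *\<^sub>R r) z - G (\<theta> + s *\<^sub>R r) z) / (s' - s)"
    let ?L = "\<lambda>s'. LINT y|k s'. \<kappa> s' y" and ?U = "\<lambda>s'. LINT y|k s. \<kappa> s' y"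
    \<comment> \<open>Dividing the two bounds by \<open>s' - s\<close> reverses them when
      \<open>s' < s\<close>; \<open>min\<close> and \<open>max\<close> cover both signs.\<close>
    have between: "min (?L s') (?U s') \<le> ?Q s' \<and> ?Q s' \<le> max (?L s') (?U s')"
      if s': "s' \<in> {0..1}" "s' \<noteq> s" for s'
    proof -
      have "G (\<theta> + s' *\<^sub>R r) z - G (\<theta> + s *\<^sub>R r) z \<le> (s' - s) * ?U s'"
        using G(1)[of s s s] G(2)[of s s' s] increment[of s' s] s s' by auto
      moreover have "(s' - s) * ?L s' \<le> G (\<theta> + s' *\<^sub>R r) z - G (\<theta> + s *\<^sub>R r) z"
        using G(1)[of s' s s] G(2)[of s s s'] increment[of s' s'] s s' by auto
      ultimately show ?thesis
        using s'(2) by (cases "s < s'") (auto simp: field_simps min_le_iff_disj le_max_iff_disj)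
    qed
    have "\<forall>\<^sub>F s' in at s within {0..1}. min (?L s') (?U s') \<le> ?Q s' \<and> ?Q s' \<le> max (?L s') (?U s')"
      unfolding eventually_at_filter by (intro always_eventually allI impI between)
    then have "\<forall>\<^sub>F s' in at s within {0..1}. min (?L s') (?U s') \<le> ?Q s'"
      "\<forall>\<^sub>F s' in at s within {0..1}. ?Q s' \<le> max (?L s') (?U s')"
      by (auto elim: eventually_mono)
    then have "(?Q \<longlongrightarrow> D) (at s within {0..1})"
      by (rule tendsto_sandwich)
        (use tendsto_min[OF lower upper] tendsto_max[OF lower upper] in simp_all)
    then show ?thesis
      by (simp add: has_field_derivative_iff D_def d_def k_def)
  qed
  have diff: "dir_differentiable \<Theta> (\<lambda>\<theta>. G \<theta> z) \<theta>" if \<theta>: "\<theta> \<in> \<Theta>" and z: "z \<in> Z" for \<theta> z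
  proof -
    \<comment> \<open>The candidate gradient is a vector-valued integral; it exists because at fixed
      \<open>\<theta>\<close> the gradient of \<open>V\<close> is continuous in
      \<open>y\<close>.\<close>
    let ?w = "LINT y|K \<theta> z. dir_gradient \<Theta> (\<lambda>\<theta>. V \<theta> y) \<theta>"
    have "integrable (K \<theta> z) (\<lambda>y. dir_gradient \<Theta> (\<lambda>\<theta>. V \<theta> y) \<theta>)"
      by (rule integrable_continuous_on[OF Y K(2)[OF \<theta> z] C1_on_segments_gradient_continuous[OF C1 \<theta>]])
    then have "has_dir_gradient \<Theta> (\<lambda>\<theta>. G \<theta> z) \<theta> ?w"
      using deriv[of \<theta> _ 0 z] z by (intro has_dir_gradientI) simp
    then show ?thesis
      by (auto simp: dir_differentiable_def)
  qed
  show ?thesis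
    unfolding C1_on_segments_def
  proof (intro conjI allI impI ballI diff)
    fix \<theta> r assume seg: "closed_segment \<theta> (\<theta> + r) \<subseteq> \<Theta>"
    note mem = segment_point_mem[OF seg]
    let ?D = "\<lambda>s z. LINT y|K (\<theta> + s *\<^sub>R r) z. dir_gradient \<Theta> (\<lambda>\<theta>. V \<theta> y) (\<theta> + s *\<^sub>R r) \<bullet> r"
    have "continuous_on ({0..1} \<times> Z) (\<lambda>w. LINT y|(case w of (s, z) \<Rightarrow> K (\<theta> + s *\<^sub>R r) z).
        (case w of (s, z) \<Rightarrow> dir_gradient \<Theta> (\<lambda>\<theta>. V \<theta> y) (\<theta> + s *\<^sub>R r) \<bullet> r))"
      using continuous_on_insert_middle[OF C1_on_segmentsD(1)[OF C1 seg], of Z] K(2) mem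
      by (intro continuous_on_kernel_integral[OF weakly_continuous_on_segment[OF K(1) seg] _ Y])
        (auto simp: split_beta)
    then have "continuous_on ({0..1} \<times> Z) (\<lambda>(s, z). ?D s z)"
      by (simp add: split_beta)
    then show "continuous_on ({0..1} \<times> Z) (\<lambda>(s, z). dir_gradient \<Theta> (\<lambda>\<theta>. G \<theta> z) (\<theta> + s *\<^sub>R r) \<bullet> r)"
    proof (rule continuous_on_eq)
      fix w assume "w \<in> {0..1::real} \<times> Z"
      then obtain s z where w: "w = (s, z)" "s \<in> {0..1}" "z \<in> Z" by auto
      \<comment> \<open>Derivatives along a segment are unique, so the chosen gradient of
        \<open>G\<close> has the same product with \<open>r\<close> as the integral, whose joint
        continuity is already known.\<close>
      have "?D s z = dir_gradient \<Theta> (\<lambda>\<theta>. G \<theta> z) (\<theta> + s *\<^sub>R r) \<bullet> r"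
        using deriv[OF seg w(2,3)] segment_point_deriv[OF dir_gradient_props(1)[OF diff[OF mem[OF w(2)] w(3)]] seg w(2)] w(2)
        by (rule real_derivative_unique_unit)
      with w show "(\<lambda>(s, z). ?D s z) w = (\<lambda>(s, z). dir_gradient \<Theta> (\<lambda>\<theta>. G \<theta> z) (\<theta> + s *\<^sub>R r) \<bullet> r) w"
        by simp
    qed
  qed
qed


section \<open>Differentiating a policy average\<close>

text \<open>Positivity of the densities lets every policy on the segment be written as a likelihood
  ratio times the policy at \<open>\<theta>\<close>. The differentiation then takes place under one
  fixed probability measure, for which bounded functions are integrable although
  \<open>\<nu>\<close> itself may be infinite. The bound on the score dominates the difference
  quotients of the ratio, whose limit at 0 is the score component along \<open>r\<close>.\<close>

lemma
  fixes P :: "'p::euclidean_space \<Rightarrow> 'a::topological_space \<Rightarrow> real" and \<phi> :: "'a \<Rightarrow> real"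
  assumes \<nu>: "sets \<nu> = sets (borel_on A)" and A: "compact A"
    and P: "\<And>\<theta>. \<theta> \<in> \<Theta> \<Longrightarrow> P \<theta> \<in> borel_measurable \<nu>" "\<And>\<theta> a. \<theta> \<in> \<Theta> \<Longrightarrow> a \<in> A \<Longrightarrow> 0 < P \<theta> a"
      "\<And>\<theta>. \<theta> \<in> \<Theta> \<Longrightarrow> prob_space (density \<nu> (\<lambda>a. ennreal (P \<theta> a)))"
    and diff: "\<And>\<theta> a. \<theta> \<in> \<Theta> \<Longrightarrow> a \<in> A \<Longrightarrow> dir_differentiable \<Theta> (\<lambda>\<theta>. ln (P \<theta> a)) \<theta>"
    and bound: "\<And>\<theta> a. \<theta> \<in> \<Theta> \<Longrightarrow> a \<in> A \<Longrightarrow> norm (dir_gradient \<Theta> (\<lambda>\<theta>. ln (P \<theta> a)) \<theta>) \<le> C"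
    and \<theta>: "\<theta> \<in> \<Theta>"
  shows score_measurable: "(\<lambda>a. dir_gradient \<Theta> (\<lambda>\<theta>. ln (P \<theta> a)) \<theta>) \<in> borel_measurable \<nu>"
    and has_dir_gradient_policy_integral: "continuous_on A \<phi> \<Longrightarrow>
      has_dir_gradient \<Theta> (\<lambda>\<theta>. LINT a|density \<nu> (\<lambda>a. ennreal (P \<theta> a)). \<phi> a) \<theta>
        (LINT a|density \<nu> (\<lambda>a. ennreal (P \<theta> a)). \<phi> a *\<^sub>R dir_gradient \<Theta> (\<lambda>\<theta>. ln (P \<theta> a)) \<theta>)"
proof -
  define S where "S \<theta> a = dir_gradient \<Theta> (\<lambda>\<theta>. ln (P \<theta> a)) \<theta>" for \<theta> a
  have space: "space \<nu> = A"
    using sets_eq_imp_space_eq[OF \<nu>] by (simp add: space_restrict_space)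
  have ln_deriv: "((\<lambda>s. ln (P (\<theta> + s *\<^sub>R r) a)) has_real_derivative S (\<theta> + s *\<^sub>R r) a \<bullet> r) (at s within {0..1})"
    if "closed_segment \<theta> (\<theta> + r) \<subseteq> \<Theta>" "s \<in> {0..1}" "a \<in> A" for r s a
    unfolding S_def
    by (rule segment_point_deriv[OF dir_gradient_props(1)[OF diff[OF segment_point_mem[OF that(1,2)] that(3)]] that(1,2)])
  show meas: "(\<lambda>a. S \<theta> a) \<in> borel_measurable \<nu>" unfolding S_def[symmetric]
  proof (rule borel_measurable_span_valued)
    show "S \<theta> a \<in> span (feasible_directions \<Theta> \<theta>)" if "a \<in> space \<nu>" for a
      unfolding S_def using that space by (intro dir_gradient_props diff \<theta>) auto
  next
    fix r assume "r \<in> feasible_directions \<Theta> \<theta>"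
    then obtain \<delta> where \<delta>: "0 < \<delta>" "closed_segment \<theta> (\<theta> + \<delta> *\<^sub>R r) \<subseteq> \<Theta>"
      by (rule feasible_directionsE)
    \<comment> \<open>Nonzero parameters tending to 0 on a feasible segment: along them the score
      component is a sequential limit of measurable quotients.\<close>
    define h where "h n = 1 / real (Suc n)" for n
    have h: "h n \<in> {0..1}" "h n \<noteq> 0" for n
      by (auto simp: h_def divide_simps)
    have h_lim: "h \<longlonglongrightarrow> 0"
      unfolding h_def using LIMSEQ_inverse_real_of_nat by (simp add: inverse_eq_divide)
    have "(\<lambda>a. S \<theta> a \<bullet> (\<delta> *\<^sub>R r)) \<in> borel_measurable \<nu>"
    proof (rule borel_measurable_LIMSEQ_real)
      show "(\<lambda>a. (ln (P (\<theta> + h n *\<^sub>R \<delta> *\<^sub>R r) a) - ln (P \<theta> a)) / h n) \<in> borel_measurable \<nu>" for n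
        using P(1)[OF \<theta>] P(1)[OF segment_point_mem[OF \<delta>(2) h(1)]] by measurable
      fix a assume "a \<in> space \<nu>"
      then have "((\<lambda>s. (ln (P (\<theta> + s *\<^sub>R \<delta> *\<^sub>R r) a) - ln (P \<theta> a)) / s) \<longlongrightarrow> S \<theta> a \<bullet> (\<delta> *\<^sub>R r)) (at 0 within {0..1})"
        using ln_deriv[OF \<delta>(2), of 0 a] space by (simp add: has_field_derivative_iff)
      then show "(\<lambda>n. (ln (P (\<theta> + h n *\<^sub>R \<delta> *\<^sub>R r) a) - ln (P \<theta> a)) / h n) \<longlonglongrightarrow> S \<theta> a \<bullet> (\<delta> *\<^sub>R r)"
        by (rule filterlim_compose) (use h h_lim in \<open>auto simp: filterlim_at\<close>)
    qed
    then have "(\<lambda>a. S \<theta> a \<bullet> (\<delta> *\<^sub>R r) / \<delta>) \<in> borel_measurable \<nu>"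
      by measurable
    then show "(\<lambda>a. S \<theta> a \<bullet> r) \<in> borel_measurable \<nu>"
      using \<delta>(1) by simp
  qed
  let ?\<pi> = "\<lambda>\<theta>. density \<nu> (\<lambda>a. ennreal (P \<theta> a))"
  assume \<phi>: "continuous_on A \<phi>"
  interpret \<pi>: prob_space "?\<pi> \<theta>" by (rule P(3)[OF \<theta>])
  have \<phi>_meas [measurable]: "\<phi> \<in> borel_measurable \<nu>"
    using \<phi> \<nu> by (rule measurable_continuous_on_borel_on)
  obtain M where M: "\<And>a. a \<in> A \<Longrightarrow> \<bar>\<phi> a\<bar> \<le> M"
    using bdd_image_compact(3)[OF A \<phi>] by (auto simp: bounded_iff)
  have int_S: "integrable (?\<pi> \<theta>) (\<lambda>a. \<phi> a *\<^sub>R S \<theta> a)"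
  proof (rule \<pi>.integrable_const_bound)
    show "AE a in ?\<pi> \<theta>. norm (\<phi> a *\<^sub>R S \<theta> a) \<le> M * C"
    proof (rule AE_I2)
      fix a assume "a \<in> space (?\<pi> \<theta>)"
      then have "a \<in> A" using space by simp
      then show "norm (\<phi> a *\<^sub>R S \<theta> a) \<le> M * C"
        using mult_mono[OF M bound[OF \<theta>], of a a] order_trans[OF abs_ge_zero M] by (simp add: S_def)
    qed
  qed (use meas in measurable)
  show "has_dir_gradient \<Theta> (\<lambda>\<theta>. LINT a|?\<pi> \<theta>. \<phi> a) \<theta> (LINT a|?\<pi> \<theta>. \<phi> a *\<^sub>R S \<theta> a)"
  proof (rule has_dir_gradientI)
    fix r assume seg: "closed_segment \<theta> (\<theta> + r) \<subseteq> \<Theta>"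
    note mem = segment_point_mem[OF seg]
    \<comment> \<open>The likelihood ratio relative to the policy at \<open>\<theta>\<close>,
      written through logarithms because the score bound controls exactly their differences.\<close>
    define \<rho> where "\<rho> s a = exp (ln (P (\<theta> + s *\<^sub>R r) a) - ln (P \<theta> a))" for s a
    define B where "B = C * norm r"
    have S_bound: "\<bar>S (\<theta> + s *\<^sub>R r) a \<bullet> r\<bar> \<le> B" if "s \<in> {0..1}" "a \<in> A" for s a
      using Cauchy_Schwarz_ineq2[of "S (\<theta> + s *\<^sub>R r) a" r]
        mult_right_mono[OF bound[OF mem[OF that(1)] that(2)] norm_ge_zero[of r]]
      by (simp add: B_def S_def)
    have \<rho>_deriv: "((\<lambda>s. \<rho> s a) has_real_derivative \<rho> s a * (S (\<theta> + s *\<^sub>R r) a \<bullet> r)) (at s within {0..1})"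
      if "s \<in> {0..1}" "a \<in> A" for s a
    proof -
      have "((\<lambda>s. exp (l s - c)) has_real_derivative exp (l s - c) * D) (at s within {0..1})"
        if "(l has_real_derivative D) (at s within {0..1})" for l c D
        using that by (auto intro!: derivative_eq_intros)
      from this[OF ln_deriv[OF seg that]] show ?thesis
        by (simp add: \<rho>_def)
    qed
    have \<rho>_0: "\<rho> 0 a = 1" for a by (simp add: \<rho>_def)
    have \<rho>_pos: "0 < \<rho> s a" for s a by (simp add: \<rho>_def)
    have \<rho>_le: "\<rho> s a \<le> exp B" if s: "s \<in> {0..1}" and a: "a \<in> A" for s a
    proof -
      have "0 \<le> B" using S_bound[OF s a] by linarith
      have "\<bar>ln (P (\<theta> + s *\<^sub>R r) a) - ln (P (\<theta> + 0 *\<^sub>R r) a)\<bar> \<le> B * \<bar>s - 0\<bar>"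
        using field_differentiable_bound[of "{0..1}" "\<lambda>s. ln (P (\<theta> + s *\<^sub>R r) a)"
            "\<lambda>s. S (\<theta> + s *\<^sub>R r) a \<bullet> r" B s 0] ln_deriv[OF seg _ a] S_bound[OF _ a] s by simp
      also have "\<dots> \<le> B" using s \<open>0 \<le> B\<close> by (auto intro: mult_left_le)
      finally show ?thesis by (simp add: \<rho>_def)
    qed
    \<comment> \<open>The derivative of the ratio is the ratio times the score component, hence at
      most \<open>exp B * B\<close> in absolute value; divided by \<open>s\<close>, this estimate is
      the dominating constant used below.\<close>
    have \<rho>_lip: "\<bar>\<rho> s a - 1\<bar> \<le> exp B * B * s" if s: "s \<in> {0..1}" and a: "a \<in> A" for s a
    proof -
      have "\<bar>\<rho> s a - \<rho> 0 a\<bar> \<le> exp B * B * \<bar>s - 0\<bar>"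
      proof (rule field_differentiable_bound[of "{0..1}" _ "\<lambda>s. \<rho> s a * (S (\<theta> + s *\<^sub>R r) a \<bullet> r)", simplified real_norm_def])
        fix s' :: real assume s': "s' \<in> {0..1}"
        show "\<bar>\<rho> s' a * (S (\<theta> + s' *\<^sub>R r) a \<bullet> r)\<bar> \<le> exp B * B"
          using mult_mono[OF \<rho>_le[OF s' a] S_bound[OF s' a]] \<rho>_pos[of s' a] by (simp add: abs_mult)
      qed (use \<rho>_deriv a s in auto)
      then show ?thesis using s by (simp add: \<rho>_0)
    qed
    have ratio: "(LINT a|?\<pi> (\<theta> + s *\<^sub>R r). \<phi> a) = (LINT a|?\<pi> \<theta>. \<rho> s a * \<phi> a)"
      and \<rho>_meas: "\<rho> s \<in> borel_measurable \<nu>" if s: "s \<in> {0..1}" for s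
    proof -
      note [measurable] = P(1)[OF \<theta>] P(1)[OF mem[OF s]]
      show [measurable]: "\<rho> s \<in> borel_measurable \<nu>"
        unfolding \<rho>_def by measurable
      have "(LINT a|?\<pi> (\<theta> + s *\<^sub>R r). \<phi> a) = (LINT a|\<nu>. P (\<theta> + s *\<^sub>R r) a *\<^sub>R \<phi> a)"
        using P(2)[OF mem[OF s]] space by (intro integral_density AE_I2) (auto intro: less_imp_le)
      also have "\<dots> = (LINT a|\<nu>. P \<theta> a *\<^sub>R (\<rho> s a * \<phi> a))"
      proof (rule Bochner_Integration.integral_cong)
        fix a assume "a \<in> space \<nu>"
        then have "P (\<theta> + s *\<^sub>R r) a = P \<theta> a * \<rho> s a"
          using P(2)[OF \<theta>, of a] P(2)[OF mem[OF s], of a] space by (simp add: \<rho>_def exp_diff)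
        then show "P (\<theta> + s *\<^sub>R r) a *\<^sub>R \<phi> a = P \<theta> a *\<^sub>R (\<rho> s a * \<phi> a)" by simp
      qed simp
      also have "\<dots> = (LINT a|?\<pi> \<theta>. \<rho> s a * \<phi> a)"
        using P(2)[OF \<theta>] space by (intro integral_density[symmetric] AE_I2) (auto intro: less_imp_le)
      finally show "(LINT a|?\<pi> (\<theta> + s *\<^sub>R r). \<phi> a) = (LINT a|?\<pi> \<theta>. \<rho> s a * \<phi> a)" .
    qed
    let ?Q = "\<lambda>s. ((LINT a|?\<pi> (\<theta> + s *\<^sub>R r). \<phi> a) - (LINT a|?\<pi> \<theta>. \<phi> a)) / s"
    have "(?Q \<longlongrightarrow> (LINT a|?\<pi> \<theta>. \<phi> a *\<^sub>R S \<theta> a) \<bullet> r) (at 0 within {0..1})"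
      unfolding tendsto_at_iff_sequentially comp_def
    proof (intro allI impI)
      fix h assume h: "\<forall>n. h n \<in> {0..1} - {0::real}" and h_lim: "h \<longlonglongrightarrow> 0"
      have h': "h n \<in> {0..1}" "h n \<noteq> 0" for n using h by auto
      have "(\<lambda>n. LINT a|?\<pi> \<theta>. (\<rho> (h n) a - 1) / h n * \<phi> a) \<longlonglongrightarrow> (LINT a|?\<pi> \<theta>. (S \<theta> a \<bullet> r) * \<phi> a)"
      proof (rule integral_dominated_convergence[where w="\<lambda>_. exp B * B * M"])
        show "(\<lambda>a. (S \<theta> a \<bullet> r) * \<phi> a) \<in> borel_measurable (?\<pi> \<theta>)"
          using meas by measurable
        show "(\<lambda>a. (\<rho> (h n) a - 1) / h n * \<phi> a) \<in> borel_measurable (?\<pi> \<theta>)" for n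
          using \<rho>_meas[OF h'(1)] by measurable
        show "AE a in ?\<pi> \<theta>. norm ((\<rho> (h n) a - 1) / h n * \<phi> a) \<le> exp B * B * M" for n
        proof (rule AE_I2)
          fix a assume "a \<in> space (?\<pi> \<theta>)"
          then have a: "a \<in> A" using space by simp
          have "\<bar>(\<rho> (h n) a - 1) / h n\<bar> \<le> exp B * B"
            using \<rho>_lip[OF h'(1)[of n] a] h'[of n] by (simp add: divide_simps)
          then show "norm ((\<rho> (h n) a - 1) / h n * \<phi> a) \<le> exp B * B * M"
            using mult_mono[OF _ M[OF a], of "\<bar>(\<rho> (h n) a - 1) / h n\<bar>" "exp B * B"]
              order_trans[OF abs_ge_zero \<open>\<bar>(\<rho> (h n) a - 1) / h n\<bar> \<le> exp B * B\<close>]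
            by (simp add: abs_mult)
        qed
        show "AE a in ?\<pi> \<theta>. (\<lambda>n. (\<rho> (h n) a - 1) / h n * \<phi> a) \<longlonglongrightarrow> (S \<theta> a \<bullet> r) * \<phi> a"
        proof (rule AE_I2)
          fix a assume "a \<in> space (?\<pi> \<theta>)"
          then have a: "a \<in> A" using space by simp
          have "((\<lambda>s. (\<rho> s a - 1) / s) \<longlongrightarrow> S \<theta> a \<bullet> r) (at 0 within {0..1})"
            using \<rho>_deriv[of 0 a] a by (simp add: has_field_derivative_iff \<rho>_0)
          then have "(\<lambda>n. (\<rho> (h n) a - 1) / h n) \<longlonglongrightarrow> S \<theta> a \<bullet> r"
            by (rule filterlim_compose) (use h h_lim in \<open>auto simp: filterlim_at\<close>)
          then show "(\<lambda>n. (\<rho> (h n) a - 1) / h n * \<phi> a) \<longlonglongrightarrow> (S \<theta> a \<bullet> r) * \<phi> a"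
            by (intro tendsto_intros)
        qed
      qed simp
      moreover have "(LINT a|?\<pi> \<theta>. (\<rho> (h n) a - 1) / h n * \<phi> a) = ?Q (h n)" for n
      proof -
        have "integrable (?\<pi> \<theta>) \<phi>"
          using M space by (intro \<pi>.integrable_const_bound[of _ M]) auto
        moreover have "integrable (?\<pi> \<theta>) (\<lambda>a. \<rho> (h n) a * \<phi> a)"
        proof (rule \<pi>.integrable_const_bound)
          show "AE a in ?\<pi> \<theta>. norm (\<rho> (h n) a * \<phi> a) \<le> exp B * M"
            using mult_mono[OF \<rho>_le[OF h'(1)] M] \<rho>_pos space
            by (intro AE_I2) (auto simp: abs_mult abs_of_pos[OF \<rho>_pos])
        qed (use \<rho>_meas[OF h'(1)] in measurable)
        ultimately have "(LINT a|?\<pi> \<theta>. \<rho> (h n) a * \<phi> a) - (LINT a|?\<pi> \<theta>. \<phi> a)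
            = (LINT a|?\<pi> \<theta>. \<rho> (h n) a * \<phi> a - \<phi> a)"
          by (intro Bochner_Integration.integral_diff[symmetric])
        then show ?thesis
          unfolding ratio[OF h'(1)]
          by (simp add: left_diff_distrib flip: integral_divide_zero)
      qed
      moreover have "(LINT a|?\<pi> \<theta>. (S \<theta> a \<bullet> r) * \<phi> a) = (LINT a|?\<pi> \<theta>. \<phi> a *\<^sub>R S \<theta> a) \<bullet> r"
        using int_S by (simp add: mult.commute flip: integral_inner_left)
      ultimately show "(\<lambda>n. ?Q (h n)) \<longlonglongrightarrow> (LINT a|?\<pi> \<theta>. \<phi> a *\<^sub>R S \<theta> a) \<bullet> r"
        by (simp only:)
    qed
    then show "((\<lambda>s. LINT a|?\<pi> (\<theta> + s *\<^sub>R r). \<phi> a) has_real_derivative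
        (LINT a|?\<pi> \<theta>. \<phi> a *\<^sub>R S \<theta> a) \<bullet> r) (at 0 within {0..1})"
      by (simp add: has_field_derivative_iff)
  qed
qed


text \<open>A product rule in which \<open>S\<close> is the score. Formula and continuity come from
  different hypotheses: \<open>S_grad\<close> identifies the derivative of a policy average with a
  fixed test function, while \<open>regular\<close> says that this derivative varies continuously.
  The bound on \<open>S\<close> extends the continuity to the test function \<open>G\<close>, which
  moves with the parameter.\<close>

lemma
  fixes \<pi> :: "'p::euclidean_space \<Rightarrow> 'x::topological_space \<Rightarrow> 'a::topological_space measure"
    and S :: "'p \<Rightarrow> 'x \<Rightarrow> 'a \<Rightarrow> 'p" and G :: "'p \<Rightarrow> 'x \<Rightarrow> 'a \<Rightarrow> real"
  assumes A: "compact A"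
    and \<pi>: "weakly_continuous_on (\<Theta> \<times> X) A (\<lambda>(\<theta>, x). \<pi> \<theta> x)"
      "\<And>\<theta> x. \<theta> \<in> \<Theta> \<Longrightarrow> x \<in> X \<Longrightarrow> \<pi> \<theta> x \<in> space (prob_algebra (borel_on A))"
    and regular: "\<And>\<phi> :: 'a \<Rightarrow> real. continuous_on A \<phi> \<Longrightarrow> \<exists>D. continuous_on (\<Theta> \<times> X) (\<lambda>(\<theta>, x). D \<theta> x) \<and>
      (\<forall>\<theta>\<in>\<Theta>. \<forall>x\<in>X. has_dir_gradient \<Theta> (\<lambda>\<theta>. LINT a|\<pi> \<theta> x. \<phi> a) \<theta> (D \<theta> x))"
    and S_meas: "\<And>\<theta> x. \<theta> \<in> \<Theta> \<Longrightarrow> x \<in> X \<Longrightarrow> S \<theta> x \<in> borel_measurable (borel_on A)"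
    and S_bound: "\<And>\<theta> x a. \<theta> \<in> \<Theta> \<Longrightarrow> x \<in> X \<Longrightarrow> a \<in> A \<Longrightarrow> norm (S \<theta> x a) \<le> C"
    and S_span: "\<And>\<theta> x a. \<theta> \<in> \<Theta> \<Longrightarrow> x \<in> X \<Longrightarrow> a \<in> A \<Longrightarrow> S \<theta> x a \<in> span (feasible_directions \<Theta> \<theta>)"
    and S_grad: "\<And>\<theta> x \<phi>. \<theta> \<in> \<Theta> \<Longrightarrow> x \<in> X \<Longrightarrow> continuous_on A \<phi> \<Longrightarrow>
      has_dir_gradient \<Theta> (\<lambda>\<theta>. LINT a|\<pi> \<theta> x. \<phi> a) \<theta> (LINT a|\<pi> \<theta> x. \<phi> a *\<^sub>R S \<theta> x a)"
    and G_cont: "continuous_on (\<Theta> \<times> (X \<times> A)) (\<lambda>(\<theta>, x, a). G \<theta> x a)"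
    and G_C1: "C1_on_segments \<Theta> (X \<times> A) (\<lambda>\<theta> (x, a). G \<theta> x a)"
  defines "W \<equiv> \<lambda>\<theta> x. LINT a|\<pi> \<theta> x. G \<theta> x a"
    and "w \<equiv> \<lambda>\<theta> x a. G \<theta> x a *\<^sub>R S \<theta> x a + dir_gradient \<Theta> (\<lambda>\<theta>. G \<theta> x a) \<theta>"
  shows policy_average_C1: "C1_on_segments \<Theta> X W"
    and policy_average_integrable: "\<And>\<theta> x. \<theta> \<in> \<Theta> \<Longrightarrow> x \<in> X \<Longrightarrow> integrable (\<pi> \<theta> x) (w \<theta> x)"
    and policy_average_dir_gradient: "\<And>\<theta> x. \<theta> \<in> \<Theta> \<Longrightarrow> x \<in> X \<Longrightarrow>
      dir_gradient \<Theta> (\<lambda>\<theta>. W \<theta> x) \<theta> = (LINT a|\<pi> \<theta> x. w \<theta> x a)"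
proof -
  define DG where "DG \<theta> x a = dir_gradient \<Theta> (\<lambda>\<theta>. G \<theta> x a) \<theta>" for \<theta> x a
  have slice: "continuous_on A (\<lambda>a. (x, a))" for x :: 'x
    by (intro continuous_on_Pair continuous_on_const continuous_on_id)
  have G_slice: "continuous_on A (G \<theta> x)" if "\<theta> \<in> \<Theta>" "x \<in> X" for \<theta> x
    using continuous_on_compose2[OF continuous_on_slice(1)[OF G_cont that(1)] slice[of x]] that by auto
  have DG_slice: "continuous_on A (DG \<theta> x)" if "\<theta> \<in> \<Theta>" "x \<in> X" for \<theta> x
    using continuous_on_compose2[OF C1_on_segments_gradient_continuous[OF G_C1 that(1)] slice[of x]] that
    by (auto simp: DG_def[abs_def])
  have S_integrable: "integrable (\<pi> \<theta> x) (\<lambda>a. \<phi> a *\<^sub>R S \<theta> x a)"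
    if \<theta>: "\<theta> \<in> \<Theta>" and x: "x \<in> X" and \<phi>: "continuous_on A \<phi>" for \<theta> x \<phi>
  proof -
    note \<pi>' = prob_borel_onD[OF \<pi>(2)[OF \<theta> x]]
    interpret prob_space "\<pi> \<theta> x" by (rule \<pi>'(1))
    obtain M where M: "\<And>a. a \<in> A \<Longrightarrow> \<bar>\<phi> a\<bar> \<le> M"
      using bdd_image_compact(3)[OF A \<phi>] by (auto simp: bounded_iff)
    have [measurable]: "\<phi> \<in> borel_measurable (\<pi> \<theta> x)"
      by (rule measurable_continuous_on_borel_on[OF \<phi> \<pi>'(2)])
    have [measurable]: "S \<theta> x \<in> borel_measurable (\<pi> \<theta> x)"
      using S_meas[OF \<theta> x] \<pi>'(2) by (simp cong: measurable_cong_sets)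
    show ?thesis
    proof (rule integrable_const_bound)
      show "AE a in \<pi> \<theta> x. norm (\<phi> a *\<^sub>R S \<theta> x a) \<le> M * C"
        using mult_mono[OF M S_bound[OF \<theta> x]] order_trans[OF abs_ge_zero M] \<pi>'(3)
        by (intro AE_I2) auto
    qed measurable
  qed
  have DG_integrable: "integrable (\<pi> \<theta> x) (DG \<theta> x)" if "\<theta> \<in> \<Theta>" "x \<in> X" for \<theta> x
    by (rule integrable_continuous_on[OF A \<pi>(2) DG_slice]) (use that in auto)
  show w_integrable: "integrable (\<pi> \<theta> x) (w \<theta> x)" if "\<theta> \<in> \<Theta>" "x \<in> X" for \<theta> x
    using S_integrable[OF that G_slice[OF that]] DG_integrable[OF that]
    unfolding w_def DG_def[symmetric] by (rule Bochner_Integration.integrable_add)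
  have W_deriv: "((\<lambda>s. W (\<theta> + s *\<^sub>R r) x) has_real_derivative
      (LINT a|\<pi> (\<theta> + s *\<^sub>R r) x. G (\<theta> + s *\<^sub>R r) x a *\<^sub>R S (\<theta> + s *\<^sub>R r) x a) \<bullet> r
      + (LINT a|\<pi> (\<theta> + s *\<^sub>R r) x. DG (\<theta> + s *\<^sub>R r) x a \<bullet> r)) (at s within {0..1})"
    if seg: "closed_segment \<theta> (\<theta> + r) \<subseteq> \<Theta>" and s: "s \<in> {0..1}" and x: "x \<in> X" for \<theta> r s x
  proof -
    note mem = segment_point_mem[OF seg]
    let ?\<theta> = "\<lambda>s. \<theta> + s *\<^sub>R r"
    note k = \<pi>(2)[OF mem x]
    have k_weak: "weakly_continuous_on {0..1} A (\<lambda>s. \<pi> (?\<theta> s) x)"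
    proof -
      have "continuous_on {0..1::real} (\<lambda>s. (s, x))"
        by (intro continuous_on_Pair continuous_on_id continuous_on_const)
      from weakly_continuous_on_compose[OF weakly_continuous_on_segment[OF \<pi>(1) seg] this] x
      show ?thesis by auto
    qed
    have G_deriv: "\<And>s a. s \<in> {0..1} \<Longrightarrow> a \<in> A \<Longrightarrow> ((\<lambda>s. G (?\<theta> s) x a) has_real_derivative DG (?\<theta> s) x a \<bullet> r) (at s within {0..1})"
      using C1_on_segmentsD(2)[OF G_C1 seg, of _ "(x, _)"] x by (auto simp: DG_def)
    have DG_cont: "continuous_on ({0..1} \<times> A) (\<lambda>(s, a). DG (?\<theta> s) x a \<bullet> r)"
    proof -
      have "continuous_on ({0..1::real} \<times> A) (\<lambda>w. (fst w, x, snd w))"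
        by (intro continuous_intros)
      from continuous_on_compose2[OF C1_on_segmentsD(1)[OF G_C1 seg] this] x
      have "continuous_on ({0..1} \<times> A) (\<lambda>w. DG (?\<theta> (fst w)) x (snd w) \<bullet> r)"
        by (simp add: DG_def case_prod_beta' image_subset_iff)
      then show ?thesis by (simp add: case_prod_beta')
    qed
    from continuous_difference_quotient[OF G_deriv DG_cont s] obtain \<kappa> where
      \<kappa>: "continuous_on ({0..1} \<times> A) (\<lambda>(s', a). \<kappa> s' a)"
        "\<And>s' a. s' \<in> {0..1} \<Longrightarrow> a \<in> A \<Longrightarrow> G (?\<theta> s') x a - G (?\<theta> s) x a = (s' - s) * \<kappa> s' a"
        "\<And>a. a \<in> A \<Longrightarrow> \<kappa> s a = DG (?\<theta> s) x a \<bullet> r"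
      by metis
    \<comment> \<open>Here \<open>G\<close> is frozen at \<open>s\<close> and only the policy moves.
      What remains of \<open>W\<close> is \<open>s' - s\<close> times the mean of the difference
      quotient of \<open>G\<close> under the moving policy, which needs only weak continuity in the
      limit.\<close>
    define I where "I s' = (LINT a|\<pi> (?\<theta> s') x. G (?\<theta> s) x a)" for s'
    have I_deriv: "(I has_real_derivative
        (LINT a|\<pi> (?\<theta> s) x. G (?\<theta> s) x a *\<^sub>R S (?\<theta> s) x a) \<bullet> r) (at s within {0..1})"
      unfolding I_def[abs_def]
      by (rule segment_point_deriv[OF S_grad[OF mem[OF s] x G_slice[OF mem[OF s] x]] seg s])
    have W_split: "W (?\<theta> s') x = I s' + (s' - s) * (LINT a|\<pi> (?\<theta> s') x. \<kappa> s' a)" if s': "s' \<in> {0..1}" for s'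
    proof -
      have "integrable (\<pi> (?\<theta> s') x) (G (?\<theta> s') x)" "integrable (\<pi> (?\<theta> s') x) (G (?\<theta> s) x)"
        by (rule integrable_continuous_on[OF A k[OF s'] G_slice[OF mem x]], use s s' in simp)+
      then have "W (?\<theta> s') x - I s' = (LINT a|\<pi> (?\<theta> s') x. G (?\<theta> s') x a - G (?\<theta> s) x a)"
        unfolding W_def I_def by (rule Bochner_Integration.integral_diff[symmetric])
      also have "\<dots> = (LINT a|\<pi> (?\<theta> s') x. (s' - s) * \<kappa> s' a)"
        using \<kappa>(2)[OF s'] prob_borel_onD(3)[OF k[OF s']]
        by (intro Bochner_Integration.integral_cong) auto
      finally show ?thesis by simp
    qed
    have "continuous_on {0..1} (\<lambda>s'. LINT a|\<pi> (?\<theta> s') x. \<kappa> s' a)"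
      by (rule continuous_on_kernel_integral[OF k_weak k A \<kappa>(1)])
    moreover have "(LINT a|\<pi> (?\<theta> s) x. \<kappa> s a) = (LINT a|\<pi> (?\<theta> s) x. DG (?\<theta> s) x a \<bullet> r)"
      using \<kappa>(3) prob_borel_onD(3)[OF k[OF s]] by (intro Bochner_Integration.integral_cong) auto
    ultimately have "((\<lambda>s'. LINT a|\<pi> (?\<theta> s') x. \<kappa> s' a) \<longlongrightarrow> (LINT a|\<pi> (?\<theta> s) x. DG (?\<theta> s) x a \<bullet> r))
        (at s within {0..1})"
      using s unfolding continuous_on_def by metis
    with I_deriv have lim: "((\<lambda>s'. (I s' - I s) / (s' - s) + (LINT a|\<pi> (?\<theta> s') x. \<kappa> s' a)) \<longlongrightarrow>
        (LINT a|\<pi> (?\<theta> s) x. G (?\<theta> s) x a *\<^sub>R S (?\<theta> s) x a) \<bullet> r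
        + (LINT a|\<pi> (?\<theta> s) x. DG (?\<theta> s) x a \<bullet> r)) (at s within {0..1})"
      unfolding has_field_derivative_iff by (rule tendsto_add)
    show ?thesis
      unfolding has_field_derivative_iff
    proof (rule Lim_transform_within[OF lim zero_less_one])
      fix s' assume s': "s' \<in> {0..1}" "0 < dist s' s"
      then have "s' \<noteq> s" by auto
      then show "(I s' - I s) / (s' - s) + (LINT a|\<pi> (?\<theta> s') x. \<kappa> s' a) = (W (?\<theta> s') x - W (?\<theta> s) x) / (s' - s)"
        using W_split[OF s'(1)] W_split[OF s] by (simp add: field_simps)
    qed
  qed
  have W_grad: "has_dir_gradient \<Theta> (\<lambda>\<theta>. W \<theta> x) \<theta> (LINT a|\<pi> \<theta> x. w \<theta> x a)"
    if \<theta>: "\<theta> \<in> \<Theta>" and x: "x \<in> X" for \<theta> x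
  proof (rule has_dir_gradientI)
    fix r assume seg: "closed_segment \<theta> (\<theta> + r) \<subseteq> \<Theta>"
    have "(LINT a|\<pi> \<theta> x. w \<theta> x a) = (LINT a|\<pi> \<theta> x. G \<theta> x a *\<^sub>R S \<theta> x a) + (LINT a|\<pi> \<theta> x. DG \<theta> x a)"
      unfolding w_def DG_def[symmetric]
      by (rule Bochner_Integration.integral_add[OF S_integrable[OF \<theta> x G_slice[OF \<theta> x]] DG_integrable[OF \<theta> x]])
    then show "((\<lambda>s. W (\<theta> + s *\<^sub>R r) x) has_real_derivative (LINT a|\<pi> \<theta> x. w \<theta> x a) \<bullet> r) (at 0 within {0..1})"
      using W_deriv[OF seg _ x, of 0] DG_integrable[OF \<theta> x] by (simp add: inner_add_left)
  qed
  \<comment> \<open>A representing vector is determined only up to the orthogonal complement of the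
    feasible directions; lying in their span makes it the one that \<open>dir_gradient\<close>
    selects.\<close>
  have w_span: "(LINT a|\<pi> \<theta> x. w \<theta> x a) \<in> span (feasible_directions \<Theta> \<theta>)"
    if \<theta>: "\<theta> \<in> \<Theta>" and x: "x \<in> X" for \<theta> x
  proof (rule integral_in_span[OF w_integrable[OF \<theta> x]])
    fix a assume "a \<in> space (\<pi> \<theta> x)"
    then have a: "a \<in> A" using prob_borel_onD(3)[OF \<pi>(2)[OF \<theta> x]] by simp
    have "dir_differentiable \<Theta> (\<lambda>\<theta>. G \<theta> x a) \<theta>"
      using G_C1 \<theta> x a by (auto simp: C1_on_segments_def)
    then show "w \<theta> x a \<in> span (feasible_directions \<Theta> \<theta>)"
      unfolding w_def by (intro span_add span_scale S_span dir_gradient_props(2) \<theta> x a)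
  qed
  show "dir_gradient \<Theta> (\<lambda>\<theta>. W \<theta> x) \<theta> = (LINT a|\<pi> \<theta> x. w \<theta> x a)" if "\<theta> \<in> \<Theta>" "x \<in> X" for \<theta> x
    by (rule dir_gradient_eqI[OF W_grad[OF that] w_span[OF that]])
  show "C1_on_segments \<Theta> X W"
    unfolding C1_on_segments_def
  proof (intro conjI ballI allI impI)
    show "dir_differentiable \<Theta> (\<lambda>\<theta>. W \<theta> x) \<theta>" if "\<theta> \<in> \<Theta>" "x \<in> X" for \<theta> x
      using W_grad[OF that] by (auto simp: dir_differentiable_def)
    fix \<theta> r assume seg: "closed_segment \<theta> (\<theta> + r) \<subseteq> \<Theta>"
    note mem = segment_point_mem[OF seg]
    let ?\<theta> = "\<lambda>s. \<theta> + s *\<^sub>R r"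
    \<comment> \<open>The score term as a functional of the test function. For fixed
      \<open>\<phi>\<close> it coincides with the continuous field \<open>D\<close> in direction
      \<open>r\<close>, because both are derivatives along the same segment; in
      \<open>\<phi>\<close> it is Lipschitz with constant \<open>C * norm r\<close>.\<close>
    let ?\<Lambda> = "\<lambda>w \<phi>. (LINT a|\<pi> (?\<theta> (fst w)) (snd w). \<phi> a *\<^sub>R S (?\<theta> (fst w)) (snd w) a) \<bullet> r"
    have "continuous_on ({0..1} \<times> X) (\<lambda>w. ?\<Lambda> w (G (?\<theta> (fst w)) (snd w)))"
    proof (rule continuous_on_lipschitz_functional[where \<Lambda>="?\<Lambda>" and B="C * norm r" and Y=A])
      fix \<phi> :: "'a \<Rightarrow> real" assume \<phi>: "continuous_on A \<phi>"
      obtain D where D: "continuous_on (\<Theta> \<times> X) (\<lambda>(\<theta>, x). D \<theta> x)"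
        "\<And>\<theta> x. \<theta> \<in> \<Theta> \<Longrightarrow> x \<in> X \<Longrightarrow> has_dir_gradient \<Theta> (\<lambda>\<theta>. LINT a|\<pi> \<theta> x. \<phi> a) \<theta> (D \<theta> x)"
        using regular[OF \<phi>] by metis
      have "continuous_on ({0..1::real} \<times> X) (\<lambda>w. (?\<theta> (fst w), snd w))"
        by (intro continuous_intros)
      from continuous_on_compose2[OF D(1) this]
      have "continuous_on ({0..1::real} \<times> X) (\<lambda>w. D (?\<theta> (fst w)) (snd w))"
        using mem by (simp add: case_prod_beta' image_subset_iff)
      then have "continuous_on ({0..1::real} \<times> X) (\<lambda>w. D (?\<theta> (fst w)) (snd w) \<bullet> r)"
        by (intro continuous_on_inner continuous_on_const)
      then show "continuous_on ({0..1} \<times> X) (\<lambda>w. ?\<Lambda> w \<phi>)"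
      proof (rule continuous_on_eq)
        fix w assume "w \<in> {0..1::real} \<times> X"
        then have w: "fst w \<in> {0..1}" "snd w \<in> X" by auto
        show "D (?\<theta> (fst w)) (snd w) \<bullet> r = ?\<Lambda> w \<phi>"
          using segment_point_deriv[OF D(2)[OF mem[OF w(1)] w(2)] seg w(1)]
            segment_point_deriv[OF S_grad[OF mem[OF w(1)] w(2) \<phi>] seg w(1)] w(1)
          by (rule real_derivative_unique_unit)
      qed
    next
      fix w and \<phi> \<phi>' :: "'a \<Rightarrow> real" and e :: real
      assume w: "w \<in> {0..1::real} \<times> X" and \<phi>: "continuous_on A \<phi>" "continuous_on A \<phi>'" and "0 < e"
        and close: "\<And>a. a \<in> A \<Longrightarrow> \<bar>\<phi> a - \<phi>' a\<bar> \<le> e"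
      define \<theta>' x where "\<theta>' = ?\<theta> (fst w)" and "x = snd w"
      have \<theta>': "\<theta>' \<in> \<Theta>" and x: "x \<in> X"
        using w mem by (auto simp: \<theta>'_def x_def)
      note \<pi>' = prob_borel_onD[OF \<pi>(2)[OF \<theta>' x]]
      have "?\<Lambda> w \<phi> - ?\<Lambda> w \<phi>' = ((LINT a|\<pi> \<theta>' x. \<phi> a *\<^sub>R S \<theta>' x a) - (LINT a|\<pi> \<theta>' x. \<phi>' a *\<^sub>R S \<theta>' x a)) \<bullet> r"
        by (simp add: \<theta>'_def x_def inner_diff_left)
      also have "\<dots> = (LINT a|\<pi> \<theta>' x. \<phi> a *\<^sub>R S \<theta>' x a - \<phi>' a *\<^sub>R S \<theta>' x a) \<bullet> r"
        using S_integrable[OF \<theta>' x] \<phi> by (subst Bochner_Integration.integral_diff) auto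
      also have "\<dots> = (LINT a|\<pi> \<theta>' x. (\<phi> a - \<phi>' a) * (S \<theta>' x a \<bullet> r))"
        using S_integrable[OF \<theta>' x] \<phi> by (subst integral_inner_left[symmetric]) (auto simp: algebra_simps)
      also have "\<bar>\<dots>\<bar> \<le> e * (C * norm r)"
      proof (rule prob_integral_abs_le[OF \<pi>(2)[OF \<theta>' x]])
        interpret prob_space "\<pi> \<theta>' x" by (rule \<pi>'(1))
        \<comment> \<open>\<open>C\<close> comes without a sign; a probability measure on
          \<open>A\<close> forces a point in \<open>A\<close>, where the norm of the score shows
          \<open>0 \<le> C\<close>.\<close>
        obtain a0 where "a0 \<in> A" using not_empty \<pi>'(3) by auto
        then have "0 \<le> C" using S_bound[OF \<theta>' x, of a0] norm_ge_zero order_trans by blast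
        then show "0 \<le> e * (C * norm r)" using \<open>0 < e\<close> by simp
        fix a assume a: "a \<in> A"
        have "\<bar>S \<theta>' x a \<bullet> r\<bar> \<le> C * norm r"
          using Cauchy_Schwarz_ineq2[of "S \<theta>' x a" r] mult_right_mono[OF S_bound[OF \<theta>' x a] norm_ge_zero[of r]]
          by linarith
        then show "\<bar>(\<phi> a - \<phi>' a) * (S \<theta>' x a \<bullet> r)\<bar> \<le> e * (C * norm r)"
          using mult_mono[OF close[OF a]] \<open>0 < e\<close> by (simp add: abs_mult)
      qed
      finally show "\<bar>?\<Lambda> w \<phi> - ?\<Lambda> w \<phi>'\<bar> \<le> C * norm r * e" by (simp add: mult.commute)
    next
      have "continuous_on (({0..1::real} \<times> X) \<times> A) (\<lambda>w. (?\<theta> (fst (fst w)), snd (fst w), snd w))"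
        by (intro continuous_intros)
      from continuous_on_compose2[OF G_cont this]
      show "continuous_on (({0..1} \<times> X) \<times> A) (\<lambda>(w, a). G (?\<theta> (fst w)) (snd w) a)"
        using mem by (simp add: case_prod_beta' image_subset_iff)
    qed (rule A)
    moreover have "continuous_on ({0..1} \<times> X) (\<lambda>w. LINT a|\<pi> (?\<theta> (fst w)) (snd w). DG (?\<theta> (fst w)) (snd w) a \<bullet> r)"
    proof (rule continuous_on_kernel_integral[OF _ _ A])
      show "weakly_continuous_on ({0..1} \<times> X) A (\<lambda>w. \<pi> (?\<theta> (fst w)) (snd w))"
        using weakly_continuous_on_segment[OF \<pi>(1) seg] by (simp add: case_prod_beta')
      show "\<pi> (?\<theta> (fst w)) (snd w) \<in> space (prob_algebra (borel_on A))" if "w \<in> {0..1} \<times> X" for w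
        using that mem by (intro \<pi>(2)) auto
      have "continuous_on (({0..1::real} \<times> X) \<times> A) (\<lambda>w. (fst (fst w), snd (fst w), snd w))"
        by (intro continuous_intros)
      from continuous_on_compose2[OF C1_on_segmentsD(1)[OF G_C1 seg] this]
      show "continuous_on (({0..1} \<times> X) \<times> A) (\<lambda>(w, a). DG (?\<theta> (fst w)) (snd w) a \<bullet> r)"
        by (simp add: DG_def case_prod_beta' image_subset_iff)
    qed
    ultimately have "continuous_on ({0..1} \<times> X) (\<lambda>w. ?\<Lambda> w (G (?\<theta> (fst w)) (snd w))
        + (LINT a|\<pi> (?\<theta> (fst w)) (snd w). DG (?\<theta> (fst w)) (snd w) a \<bullet> r))"
      by (rule continuous_on_add)
    then show "continuous_on ({0..1} \<times> X) (\<lambda>(s, x). dir_gradient \<Theta> (\<lambda>\<theta>. W \<theta> x) (\<theta> + s *\<^sub>R r) \<bullet> r)"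
    proof (rule continuous_on_eq)
      fix w assume "w \<in> {0..1::real} \<times> X"
      then obtain s x where w: "w = (s, x)" "s \<in> {0..1}" "x \<in> X" by auto
      have "dir_differentiable \<Theta> (\<lambda>\<theta>. W \<theta> x) (?\<theta> s)"
        using W_grad[OF mem[OF w(2)] w(3)] by (auto simp: dir_differentiable_def)
      from segment_point_deriv[OF dir_gradient_props(1)[OF this] seg w(2)]
      have "?\<Lambda> w (G (?\<theta> s) x) + (LINT a|\<pi> (?\<theta> s) x. DG (?\<theta> s) x a \<bullet> r)
          = dir_gradient \<Theta> (\<lambda>\<theta>. W \<theta> x) (?\<theta> s) \<bullet> r"
        using real_derivative_unique_unit[OF W_deriv[OF seg w(2,3)] _ w(2)] by (simp add: w(1))
      then show "?\<Lambda> w (G (?\<theta> (fst w)) (snd w)) + (LINT a|\<pi> (?\<theta> (fst w)) (snd w). DG (?\<theta> (fst w)) (snd w) a \<bullet> r)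
          = (case w of (s, x) \<Rightarrow> dir_gradient \<Theta> (\<lambda>\<theta>. W \<theta> x) (?\<theta> s) \<bullet> r)"
        by (simp add: w(1))
    qed
  qed
qed

section \<open>Duality on Wasserstein balls\<close>

lemma measurable_continuous_on_pair:
  fixes X :: "'x::second_countable_topology set" and Y :: "'y::second_countable_topology set"
  assumes "continuous_on (X \<times> Y) \<psi>" "sets \<gamma> = sets (borel_on X \<Otimes>\<^sub>M borel_on Y)"
  shows "\<psi> \<in> borel_measurable \<gamma>"
  using measurable_compose[OF measurable_pair_borel_on borel_measurable_continuous_on_restrict[OF assms(1)]] assms(2)
  by (simp cong: measurable_cong_sets)

lemma continuous_on_cost [continuous_intros]:
  "continuous_on S h \<Longrightarrow> continuous_on S k \<Longrightarrow> continuous_on S (\<lambda>s. cost q (h s) (k s))"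
  unfolding cost_def by (intro continuous_intros)

lemma cost_nonneg: "0 \<le> cost q x y" by (simp add: cost_def)

lemma cost_commute: "cost q x y = cost q y x" by (simp add: cost_def norm_minus_commute)

lemma cost_self: "1 \<le> q \<Longrightarrow> cost q x x = 0" by (simp add: cost_def)

lemma continuous_on_INF_cost:
  fixes X :: "'x::euclidean_space set"
  assumes X: "compact X" "X \<noteq> {}" and u: "continuous_on X u"
  shows "continuous_on X (\<lambda>x'. INF y\<in>X. u y + l * cost q x' y)"
proof (rule continuous_on_INF_compact[OF _ X])
  have "continuous_on (X \<times> X) (\<lambda>z. u (snd z) + l * cost q (fst z) (snd z))"
    by (intro continuous_intros continuous_on_compose2[OF u]) auto
  then show "continuous_on (X \<times> X) (\<lambda>(x', y). u y + l * cost q x' y)"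
    by (simp add: case_prod_beta')
qed

lemma dual_optimizers_singletonD:
  assumes "dual_optimizers X q \<epsilon> u \<mu> = {l}"
  shows "0 \<le> l" "\<And>k. 0 \<le> k \<Longrightarrow> dual_fun X q \<epsilon> u \<mu> k \<le> dual_fun X q \<epsilon> u \<mu> l"
    and "\<And>k. 0 \<le> k \<Longrightarrow> dual_fun X q \<epsilon> u \<mu> l \<le> dual_fun X q \<epsilon> u \<mu> k \<Longrightarrow> k = l"
proof -
  show *: "0 \<le> l" "\<And>k. 0 \<le> k \<Longrightarrow> dual_fun X q \<epsilon> u \<mu> k \<le> dual_fun X q \<epsilon> u \<mu> l"
    using assms by (auto simp: dual_optimizers_def is_arg_max_linorder)
  fix k assume "0 \<le> k" "dual_fun X q \<epsilon> u \<mu> l \<le> dual_fun X q \<epsilon> u \<mu> k"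
  then have "k \<in> dual_optimizers X q \<epsilon> u \<mu>"
    using *(2) by (auto simp: dual_optimizers_def is_arg_max_linorder intro: order_trans)
  then show "k = l" using assms by simp
qed

lemma inner_optimizers_singletonD:
  assumes "inner_optimizers X q u l x' = {z}"
  shows "z \<in> X" "\<And>y. y \<in> X \<Longrightarrow> u z + l * cost q x' z \<le> u y + l * cost q x' y"
    and "\<And>y. y \<in> X \<Longrightarrow> u y + l * cost q x' y \<le> u z + l * cost q x' z \<Longrightarrow> y = z"
proof -
  show *: "z \<in> X" "\<And>y. y \<in> X \<Longrightarrow> u z + l * cost q x' z \<le> u y + l * cost q x' y"
    using assms by (auto simp: inner_optimizers_def is_arg_min_linorder)
  fix y assume "y \<in> X" "u y + l * cost q x' y \<le> u z + l * cost q x' z"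
  then have "y \<in> inner_optimizers X q u l x'"
    using *(2) by (auto simp: inner_optimizers_def is_arg_min_linorder intro: order_trans)
  then show "y = z" using assms by simp
qed

text \<open>What weak duality uses of a coupling: continuous functions are bounded on the compact
  product, hence integrable, and the marginal conditions are read off on continuous test
  functions.\<close>

lemma couplingsD:
  fixes X :: "'x::euclidean_space set"
  assumes X: "compact X" and \<mu>: "\<mu> \<in> space (prob_algebra (borel_on X))" "\<mu>' \<in> space (prob_algebra (borel_on X))"
    and \<gamma>: "\<gamma> \<in> couplings \<mu>' \<mu>"
  shows "prob_space \<gamma>" "space \<gamma> = X \<times> X" "\<And>\<psi> :: _ \<Rightarrow> real. continuous_on (X \<times> X) \<psi> \<Longrightarrow> integrable \<gamma> \<psi>"
    and "\<And>\<phi> :: _ \<Rightarrow> real. continuous_on X \<phi> \<Longrightarrow> (LINT z|\<gamma>. \<phi> (fst z)) = (LINT x|\<mu>'. \<phi> x)"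
    "\<And>\<phi> :: _ \<Rightarrow> real. continuous_on X \<phi> \<Longrightarrow> (LINT z|\<gamma>. \<phi> (snd z)) = (LINT x|\<mu>. \<phi> x)"
proof -
  note \<mu>' = prob_borel_onD[OF \<mu>(1)] prob_borel_onD[OF \<mu>(2)]
  show prob: "prob_space \<gamma>" using \<gamma> by (simp add: couplings_def)
  then interpret prob_space \<gamma> .
  have sets1: "sets \<gamma> = sets (\<mu>' \<Otimes>\<^sub>M \<mu>)" using \<gamma> by (simp add: couplings_def)
  also have "\<dots> = sets (borel_on X \<Otimes>\<^sub>M borel_on X)"
    using \<mu>' by (intro sets_pair_measure_cong)
  finally have sets2: "sets \<gamma> = sets (borel_on X \<Otimes>\<^sub>M borel_on X)" .
  show space: "space \<gamma> = X \<times> X"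
    using sets_eq_imp_space_eq[OF sets1] \<mu>' by (simp add: space_pair_measure)
  show "integrable \<gamma> \<psi>" if \<psi>: "continuous_on (X \<times> X) \<psi>" for \<psi> :: "_ \<Rightarrow> real"
  proof -
    obtain B where B: "\<And>z. z \<in> X \<times> X \<Longrightarrow> \<bar>\<psi> z\<bar> \<le> B"
      using bdd_image_compact(3)[OF compact_Times[OF X X] \<psi>] by (auto simp: bounded_iff)
    show ?thesis
      by (rule integrable_const_bound[of _ B])
        (use B space measurable_continuous_on_pair[OF \<psi> sets2] in auto)
  qed
  have [measurable]: "fst \<in> \<gamma> \<rightarrow>\<^sub>M \<mu>'" "snd \<in> \<gamma> \<rightarrow>\<^sub>M \<mu>"
    using sets1 by (simp_all cong: measurable_cong_sets)
  have distr: "distr \<gamma> \<mu>' fst = \<mu>'" "distr \<gamma> \<mu> snd = \<mu>"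
    using \<gamma> by (simp_all add: couplings_def)
  show "(LINT z|\<gamma>. \<phi> (fst z)) = (LINT x|\<mu>'. \<phi> x)" if "continuous_on X \<phi>" for \<phi> :: "_ \<Rightarrow> real"
    using integral_distr[of fst \<gamma> \<mu>' \<phi>] measurable_continuous_on_borel_on[OF that \<mu>'(5)] distr by simp
  show "(LINT z|\<gamma>. \<phi> (snd z)) = (LINT x|\<mu>. \<phi> x)" if "continuous_on X \<phi>" for \<phi> :: "_ \<Rightarrow> real"
    using integral_distr[of snd \<gamma> \<mu> \<phi>] measurable_continuous_on_borel_on[OF that \<mu>'(2)] distr by simp
qed

text \<open>The independent coupling keeps the set of couplings nonempty, so that the infimum in
  \<open>wasserstein\<close> is taken over actual values.\<close>

lemma pair_measure_in_couplings:
  assumes "prob_space \<mu>" "prob_space \<mu>'"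
  shows "\<mu> \<Otimes>\<^sub>M \<mu>' \<in> couplings \<mu> \<mu>'"
proof -
  interpret \<mu>: prob_space \<mu> by fact
  interpret \<mu>': prob_space \<mu>' by fact
  have "distr (\<mu> \<Otimes>\<^sub>M \<mu>') \<mu>' snd = \<mu>'"
  proof (rule measure_eqI)
    fix B assume "B \<in> sets (distr (\<mu> \<Otimes>\<^sub>M \<mu>') \<mu>' snd)"
    then have B: "B \<in> sets \<mu>'" by simp
    then have "snd -` B \<inter> space (\<mu> \<Otimes>\<^sub>M \<mu>') = space \<mu> \<times> B"
      by (auto simp: space_pair_measure dest: sets.sets_into_space)
    with B show "emeasure (distr (\<mu> \<Otimes>\<^sub>M \<mu>') \<mu>' snd) B = emeasure \<mu>' B"
      by (simp add: emeasure_distr \<mu>'.emeasure_pair_measure_Times \<mu>.emeasure_space_1)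
  qed simp
  then show ?thesis
    using prob_space_pair[OF assms] \<mu>'.distr_pair_fst by (auto simp: couplings_def)
qed

lemma bdd_below_coupling_costs:
  "bdd_below ((\<lambda>\<gamma>. LINT (x, y)|\<gamma>. cost q x y) ` \<Gamma>)"
  by (rule bdd_belowI[of _ 0]) (auto intro!: Bochner_Integration.integral_nonneg simp: cost_nonneg split_beta)

text \<open>Under a coupling of \<open>P\<close> and \<open>\<mu>\<close>, the inner infimum at the
  second coordinate is at most \<open>u\<close> at the first plus \<open>l\<close> times their cost.
  Integrating and then taking the infimum over couplings suffices, so no optimal coupling has to
  exist.\<close>

lemma weak_duality:
  fixes X :: "'x::euclidean_space set"
  assumes X: "compact X" "X \<noteq> {}" and \<mu>: "\<mu> \<in> space (prob_algebra (borel_on X))"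
    and P: "P \<in> wasserstein_ball X q \<epsilon> \<mu>" and u: "continuous_on X u"
    and q: "1 \<le> q" and l: "0 \<le> l"
  shows "dual_fun X q \<epsilon> u \<mu> l \<le> (LINT y|P. u y)"
proof -
  have P': "P \<in> space (prob_algebra (borel_on X))" and dist: "wasserstein q P \<mu> \<le> \<epsilon>"
    using P by (auto simp: wasserstein_ball_def)
  let ?c = "\<lambda>\<gamma>. LINT (x, y)|\<gamma>. cost q x y"
  define m where "m x' = (INF y\<in>X. u y + l * cost q x' y)" for x'
  have m_cont: "continuous_on X m"
    unfolding m_def by (rule continuous_on_INF_cost[OF X u])
  have m_le: "m x' \<le> u y + l * cost q x' y" if "x' \<in> X" "y \<in> X" for x' y
    unfolding m_def using that u X
    by (intro cINF_lower bdd_image_compact(1)) (auto intro!: continuous_intros)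
  have key: "(LINT x|\<mu>. m x) - (LINT y|P. u y) \<le> l * ?c \<gamma>" if \<gamma>: "\<gamma> \<in> couplings P \<mu>" for \<gamma>
  proof -
    note c = couplingsD[OF X(1) \<mu> P' \<gamma>]
    interpret prob_space \<gamma> by (rule c)
    have int: "integrable \<gamma> (\<lambda>z. u (fst z))" "integrable \<gamma> (\<lambda>z. l * cost q (fst z) (snd z))" "integrable \<gamma> (\<lambda>z. m (snd z))"
    proof -
      show "integrable \<gamma> (\<lambda>z. u (fst z))" "integrable \<gamma> (\<lambda>z. m (snd z))"
        by (rule c(3), rule continuous_on_compose2[OF u] continuous_on_compose2[OF m_cont], auto intro!: continuous_intros)+
      show "integrable \<gamma> (\<lambda>z. l * cost q (fst z) (snd z))"
        by (rule c(3)) (intro continuous_intros)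
    qed
    have "(LINT x|\<mu>. m x) = (LINT z|\<gamma>. m (snd z))"
      by (rule c(5)[OF m_cont, symmetric])
    also have "\<dots> \<le> (LINT z|\<gamma>. u (fst z) + l * cost q (fst z) (snd z))"
    proof (rule integral_mono[OF int(3) Bochner_Integration.integrable_add[OF int(1,2)]])
      fix z assume "z \<in> space \<gamma>"
      then have "z \<in> X \<times> X" using c(2) by simp
      then show "m (snd z) \<le> u (fst z) + l * cost q (fst z) (snd z)"
        using m_le[of "snd z" "fst z"] cost_commute[of q "fst z" "snd z"] by (simp add: mem_Times_iff)
    qed
    also have "\<dots> = (LINT y|P. u y) + l * ?c \<gamma>"
      using int c(4)[OF u] by (simp add: case_prod_beta')
    finally show ?thesis by simp
  qed
  have ne: "couplings P \<mu> \<noteq> {}"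
    using pair_measure_in_couplings[OF prob_borel_onD(1)[OF P'] prob_borel_onD(1)[OF \<mu>]] by auto
  let ?I = "INF \<gamma>\<in>couplings P \<mu>. ?c \<gamma>"
  have "0 \<le> ?I"
    by (rule cINF_greatest[OF ne]) (auto intro!: Bochner_Integration.integral_nonneg simp: cost_nonneg split_beta)
  \<comment> \<open>The radius bounds the \<open>q\<close>-th root of the optimal cost;
    nonnegativity of the infimum and \<open>1 \<le> q\<close> allow the root to be undone.\<close>
  then have "?I = root q ?I ^ q"
    using q by simp
  also have "\<dots> \<le> \<epsilon> ^ q"
    using dist \<open>0 \<le> ?I\<close> unfolding wasserstein_def by (intro power_mono real_root_ge_zero)
  finally have I: "?I \<le> \<epsilon> ^ q" .
  have "(LINT x|\<mu>. m x) - (LINT y|P. u y) \<le> l * \<epsilon> ^ q"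
  \<comment> \<open>The infimum over couplings is reached after dividing by \<open>l\<close>, so the
    zero multiplier is separate; there any single coupling gives the claim.\<close>
  proof (cases "l = 0")
    case True
    with key ne show ?thesis by auto
  next
    case False
    then have "0 < l" using l by simp
    then have "((LINT x|\<mu>. m x) - (LINT y|P. u y)) / l \<le> ?I"
      using key by (intro cINF_greatest[OF ne]) (simp add: divide_simps mult.commute)
    also note I
    finally show ?thesis using \<open>0 < l\<close> by (simp add: divide_simps mult.commute)
  qed
  then show ?thesis
    unfolding dual_fun_def m_def[symmetric] by (simp add: mult.commute)
qed

lemma dual_value_le_integral:
  fixes X :: "'x::euclidean_space set"
  assumes "compact X" "X \<noteq> {}" "\<mu> \<in> space (prob_algebra (borel_on X))"
    "P \<in> wasserstein_ball X q \<epsilon> \<mu>" "continuous_on X u" "1 \<le> q"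
  shows "dual_value X q \<epsilon> u \<mu> \<le> (LINT y|P. u y)"
  unfolding dual_value_def using weak_duality[OF assms] by (intro cSUP_least) auto

text \<open>The dual function is differentiated at its maximizer \<open>l\<close> within the
  nonnegative reals. The quotients of the inner infimum lie between costs of minimizers, converge by
  uniqueness at \<open>l\<close>, and are bounded by the maximal cost on the compact product. The
  derivative is the transport cost \<open>\<kappa>\<close> of the map \<open>\<eta>\<close> minus
  \<open>\<epsilon> ^ q\<close>, and its sign conditions at a maximizer are feasibility and
  complementary slackness.\<close>

lemma
  fixes X :: "'x::euclidean_space set"
  assumes X: "compact X" "X \<noteq> {}" and \<mu>: "\<mu> \<in> space (prob_algebra (borel_on X))"
    and q: "1 \<le> q" and \<epsilon>: "0 < \<epsilon>" and u: "continuous_on X u"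
    and l: "dual_optimizers X q \<epsilon> u \<mu> = {l}"
    and \<eta>: "\<And>x'. x' \<in> X \<Longrightarrow> inner_optimizers X q u l x' = {\<eta> x'}" and \<eta>_cont: "continuous_on X \<eta>"
  shows worst_case_in_ball: "distr \<mu> (borel_on X) \<eta> \<in> wasserstein_ball X q \<epsilon> \<mu>"
    and worst_case_attains: "(LINT y|distr \<mu> (borel_on X) \<eta>. u y) = dual_value X q \<epsilon> u \<mu>"
proof -
  note \<mu>' = prob_borel_onD[OF \<mu>]
  interpret prob_space \<mu> by (rule \<mu>')
  note l_max = dual_optimizers_singletonD(1,2)[OF l]
  note \<eta>_min = inner_optimizers_singletonD(1,2)[OF \<eta>] and \<eta>_unique = inner_optimizers_singletonD(3)[OF \<eta>]
  have obj_cont: "continuous_on X (\<lambda>y. u y + k * cost q x' y)" for k x'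
    by (intro continuous_intros u)
  define m where "m k x' = (INF y\<in>X. u y + k * cost q x' y)" for k x'
  have m_le: "m k x' \<le> u y + k * cost q x' y" if "y \<in> X" for k x' y
    unfolding m_def by (rule cINF_lower[OF bdd_image_compact(1)[OF X(1) obj_cont] that])
  have "\<exists>y\<in>X. \<forall>y'\<in>X. u y + k * cost q x' y \<le> u y' + k * cost q x' y'" for k x'
    using continuous_attains_inf[OF X obj_cont] by blast
  \<comment> \<open>Minimizers are chosen arbitrarily for all multipliers. \<open>Y\<close> is used
    only pointwise; what gets integrated is \<open>m\<close>, which is continuous.\<close>
  then obtain Y where Y: "\<And>k x'. Y k x' \<in> X"
    "\<And>k x' y'. y' \<in> X \<Longrightarrow> u (Y k x') + k * cost q x' (Y k x') \<le> u y' + k * cost q x' y'" by metis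
  have m_Y: "m k x' = u (Y k x') + k * cost q x' (Y k x')" for k x'
    by (rule antisym[OF m_le[OF Y(1)]]) (unfold m_def, rule cINF_greatest[OF X(2)], rule Y(2))
  have m_\<eta>: "m l x' = u (\<eta> x') + l * cost q x' (\<eta> x')" if "x' \<in> X" for x'
    by (rule antisym[OF m_le[OF \<eta>_min(1)[OF that]]]) (unfold m_def, rule cINF_greatest[OF X(2)], rule \<eta>_min(2)[OF that])
  have m_cont: "continuous_on X (m k)" for k
    unfolding m_def by (rule continuous_on_INF_cost[OF X u])
  note integrable = integrable_continuous_on[OF X(1) \<mu>]
  define cs where "cs x' = cost q x' (\<eta> x')" for x'
  have cs_cont: "continuous_on X cs"
    unfolding cs_def by (intro continuous_intros \<eta>_cont)
  let ?F = "dual_fun X q \<epsilon> u \<mu>"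
  define \<kappa> where "\<kappa> = (LINT x'|\<mu>. cs x')"
  have F: "?F k = (LINT x'|\<mu>. m k x') - \<epsilon> ^ q * k" for k
    by (simp add: dual_fun_def m_def)
  have "continuous_on (X \<times> X) (\<lambda>z. cost q (fst z) (snd z))"
    by (intro continuous_intros)
  then obtain B where B: "\<And>z. z \<in> X \<times> X \<Longrightarrow> \<bar>cost q (fst z) (snd z)\<bar> \<le> B"
    using bdd_image_compact(3)[OF compact_Times[OF X(1) X(1)], of "\<lambda>z. cost q (fst z) (snd z)"]
    by (fastforce simp: bounded_iff)
  have F_deriv: "(?F has_real_derivative \<kappa> - \<epsilon> ^ q) (at l within {0..})"
    unfolding has_field_derivative_iff tendsto_at_iff_sequentially comp_def
  proof (intro allI impI)
    fix k assume k: "\<forall>n. k n \<in> {0..} - {l}" and k_lim: "k \<longlonglongrightarrow> l"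
    have k': "0 \<le> k n" "k n \<noteq> l" for n using k by auto
    have k_filter: "filterlim k (at l within {0..}) sequentially"
      using k k_lim by (auto simp: filterlim_at)
    define Q where "Q n x' = (m (k n) x' - m l x') / (k n - l)" for n x'
    \<comment> \<open>The minimizer for either multiplier is a competitor for the other. Dividing by
      \<open>k n - l\<close>, of unknown sign, leaves the quotient between the two transport
      costs.\<close>
    have Q_between: "min (cost q x' (Y (k n) x')) (cs x') \<le> Q n x' \<and> Q n x' \<le> max (cost q x' (Y (k n) x')) (cs x')"
      if x': "x' \<in> X" for n x'
    proof -
      have "m (k n) x' - m l x' \<le> (k n - l) * cs x'"
        using m_le[OF \<eta>_min(1)[OF x'], of "k n" x'] m_\<eta>[OF x'] by (simp add: cs_def algebra_simps)
      moreover have "(k n - l) * cost q x' (Y (k n) x') \<le> m (k n) x' - m l x'"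
        using m_le[OF Y(1), of l x' "k n" x'] m_Y[of "k n" x'] by (simp add: algebra_simps)
      ultimately show ?thesis
        unfolding Q_def using k'(2)[of n]
        by (cases "l < k n") (auto simp: field_simps min_le_iff_disj le_max_iff_disj)
    qed
    have Q_lim: "(\<lambda>n. Q n x') \<longlonglongrightarrow> cs x'" if x': "x' \<in> X" for x'
    proof -
      have "continuous_on ({0..} \<times> X) (\<lambda>z. u (snd z) + fst z * cost q x' (snd z))"
        by (intro continuous_intros continuous_on_compose2[OF u]) auto
      then have "continuous_on ({0..} \<times> X) (\<lambda>(k, y). u y + k * cost q x' y)"
        by (simp add: case_prod_beta')
      then have "((\<lambda>k. Y k x') \<longlongrightarrow> \<eta> x') (at l within {0..})"
        by (rule tendsto_unique_minimizer[OF _ X(1)])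
          (use l_max(1) x' \<eta>_min(1) \<eta>_unique Y in auto)
      then have "(\<lambda>n. Y (k n) x') \<longlonglongrightarrow> \<eta> x'"
        using k_filter by (rule filterlim_compose)
      then have Y_lim: "(\<lambda>n. cost q x' (Y (k n) x')) \<longlonglongrightarrow> cs x'"
        unfolding cs_def cost_def by (intro tendsto_intros)
      show ?thesis
      proof (rule tendsto_sandwich)
        show "\<forall>\<^sub>F n in sequentially. min (cost q x' (Y (k n) x')) (cs x') \<le> Q n x'"
          "\<forall>\<^sub>F n in sequentially. Q n x' \<le> max (cost q x' (Y (k n) x')) (cs x')"
          using Q_between[OF x'] by auto
        show "(\<lambda>n. min (cost q x' (Y (k n) x')) (cs x')) \<longlonglongrightarrow> cs x'"
          "(\<lambda>n. max (cost q x' (Y (k n) x')) (cs x')) \<longlonglongrightarrow> cs x'"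
          using tendsto_min[OF Y_lim tendsto_const[of "cs x'"]] tendsto_max[OF Y_lim tendsto_const[of "cs x'"]] by simp_all
      qed
    qed
    have "(\<lambda>n. LINT x'|\<mu>. Q n x') \<longlonglongrightarrow> \<kappa>"
      unfolding \<kappa>_def
    proof (rule integral_dominated_convergence[where w="\<lambda>_. B"])
      show "cs \<in> borel_measurable \<mu>"
        by (rule measurable_continuous_on_borel_on[OF cs_cont \<mu>'(2)])
      show "Q n \<in> borel_measurable \<mu>" for n
        unfolding Q_def using k'(2)
        by (intro measurable_continuous_on_borel_on[OF _ \<mu>'(2)] continuous_intros m_cont) auto
      show "AE x' in \<mu>. (\<lambda>n. Q n x') \<longlonglongrightarrow> cs x'"
        using Q_lim \<mu>'(3) by auto
      show "AE x' in \<mu>. norm (Q n x') \<le> B" for n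
      proof (rule AE_I2)
        fix x' assume "x' \<in> space \<mu>"
        then have x': "x' \<in> X" using \<mu>'(3) by simp
        have "0 \<le> cost q x' (Y (k n) x')" "cost q x' (Y (k n) x') \<le> B" "0 \<le> cs x'" "cs x' \<le> B"
          using B[of "(x', Y (k n) x')"] B[of "(x', \<eta> x')"] x' Y(1) \<eta>_min(1) by (auto simp: cs_def cost_nonneg)
        with Q_between[OF x', of n] show "norm (Q n x') \<le> B" by auto
      qed
    qed simp
    then have "(\<lambda>n. (LINT x'|\<mu>. Q n x') - \<epsilon> ^ q) \<longlonglongrightarrow> \<kappa> - \<epsilon> ^ q"
      by (intro tendsto_intros)
    moreover have "(LINT x'|\<mu>. Q n x') - \<epsilon> ^ q = (?F (k n) - ?F l) / (k n - l)" for n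
    proof -
      have "(LINT x'|\<mu>. Q n x') = ((LINT x'|\<mu>. m (k n) x') - (LINT x'|\<mu>. m l x')) / (k n - l)"
        unfolding Q_def integral_divide_zero
        by (subst Bochner_Integration.integral_diff[OF integrable[OF m_cont] integrable[OF m_cont]]) simp
      then show ?thesis
        unfolding F using k'(2)[of n] by (simp add: field_simps)
    qed
    ultimately show "(\<lambda>n. (?F (k n) - ?F l) / (k n - l)) \<longlonglongrightarrow> \<kappa> - \<epsilon> ^ q"
      by (simp only:)
  qed
  \<comment> \<open>Right derivative at a maximum, restricted to \<open>{l..l + 1}\<close>; the
    length 1 is arbitrary.\<close>
  have \<kappa>_le: "\<kappa> \<le> \<epsilon> ^ q"
  proof -
    have "((\<lambda>k. (?F k - ?F l) / (k - l)) \<longlongrightarrow> \<kappa> - \<epsilon> ^ q) (at l within {l..l + 1})"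
      by (rule tendsto_within_subset[OF F_deriv[unfolded has_field_derivative_iff]]) (use l_max(1) in auto)
    moreover have "\<forall>\<^sub>F k in at l within {l..l + 1}. (?F k - ?F l) / (k - l) \<le> 0"
      unfolding eventually_at_filter using l_max
      by (intro always_eventually allI impI divide_nonpos_pos) auto
    moreover have "at l within {l..l + 1} \<noteq> bot"
      by (simp add: trivial_limit_within islimpt_Icc)
    ultimately have "\<kappa> - \<epsilon> ^ q \<le> 0"
      by (rule tendsto_upperbound)
    then show ?thesis by simp
  qed
  \<comment> \<open>Complementary slackness. Left increments are available only for
    \<open>l > 0\<close>, where they give the reverse inequality; for \<open>l = 0\<close> both
    sides vanish.\<close>
  have slack: "l * \<kappa> = l * \<epsilon> ^ q"
  proof (cases "l = 0")
    case False
    have "((\<lambda>k. (?F k - ?F l) / (k - l)) \<longlongrightarrow> \<kappa> - \<epsilon> ^ q) (at l within {0..l})"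
      by (rule tendsto_within_subset[OF F_deriv[unfolded has_field_derivative_iff]]) auto
    moreover have "\<forall>\<^sub>F k in at l within {0..l}. 0 \<le> (?F k - ?F l) / (k - l)"
      unfolding eventually_at_filter using l_max
      by (intro always_eventually allI impI divide_nonpos_nonpos) auto
    moreover have "at l within {0..l} \<noteq> bot"
      using l_max(1) False by (simp add: trivial_limit_within islimpt_Icc)
    ultimately have "0 \<le> \<kappa> - \<epsilon> ^ q"
      by (rule tendsto_lowerbound)
    with \<kappa>_le show ?thesis by simp
  qed simp
  let ?K = "distr \<mu> (borel_on X) \<eta>"
  have \<eta>_meas [measurable]: "\<eta> \<in> \<mu> \<rightarrow>\<^sub>M borel_on X"
    by (rule measurable_restrict_space2)
      (use \<eta>_min(1) \<mu>'(3) measurable_continuous_on_borel_on[OF \<eta>_cont \<mu>'(2)] in auto)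
  have id_meas [measurable]: "(\<lambda>x. x) \<in> \<mu> \<rightarrow>\<^sub>M borel_on X" "(\<lambda>x. x) \<in> borel_on X \<rightarrow>\<^sub>M \<mu>"
    using \<mu>'(2) by (auto cong: measurable_cong_sets)
  have K: "?K \<in> space (prob_algebra (borel_on X))"
    by (simp add: space_prob_algebra prob_space_distr)
  have K_integral: "(LINT y|?K. \<phi> y) = (LINT x'|\<mu>. \<phi> (\<eta> x'))" if "continuous_on X \<phi>" for \<phi> :: "'x \<Rightarrow> real"
    by (rule integral_distr[OF \<eta>_meas]) (use borel_measurable_continuous_on_restrict[OF that] in simp)
  \<comment> \<open>The coupling carried by the graph of the transport map \<open>\<eta>\<close>,
    with the transported point first to match the order in
    \<open>wasserstein q ?K \<mu>\<close>.\<close>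
  let ?\<gamma> = "distr \<mu> (borel_on X \<Otimes>\<^sub>M borel_on X) (\<lambda>x'. (\<eta> x', x'))"
  have pair_meas [measurable]: "(\<lambda>x'. (\<eta> x', x')) \<in> \<mu> \<rightarrow>\<^sub>M borel_on X \<Otimes>\<^sub>M borel_on X"
    by measurable
  have \<gamma>: "?\<gamma> \<in> couplings ?K \<mu>"
  proof -
    have "sets ?\<gamma> = sets (?K \<Otimes>\<^sub>M \<mu>)"
      using \<mu>'(2) by (simp cong: sets_pair_measure_cong)
    moreover have "distr ?\<gamma> ?K fst = ?K"
    proof -
      have "distr ?\<gamma> ?K fst = distr ?\<gamma> (borel_on X) fst"
        by (rule distr_cong) auto
      also have "\<dots> = ?K"
        by (subst distr_distr) (auto simp: comp_def)
      finally show ?thesis .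
    qed
    moreover have "distr ?\<gamma> \<mu> snd = \<mu>"
    proof -
      have "distr ?\<gamma> \<mu> snd = distr ?\<gamma> (borel_on X) snd"
        using \<mu>'(2) by (intro distr_cong) auto
      also have "\<dots> = distr \<mu> (borel_on X) (\<lambda>x. x)"
        by (subst distr_distr) (auto simp: comp_def)
      also have "\<dots> = distr \<mu> \<mu> (\<lambda>x. x)"
        using \<mu>'(2) by (intro distr_cong) auto
      finally show ?thesis by (simp add: distr_id)
    qed
    ultimately show ?thesis
      using prob_space_distr[OF pair_meas] by (simp add: couplings_def)
  qed
  have "(LINT (x, y)|?\<gamma>. cost q x y) = \<kappa>"
  proof -
    have "(\<lambda>z. cost q (fst z) (snd z)) \<in> borel_measurable (borel_on X \<Otimes>\<^sub>M borel_on X)"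
      by (rule measurable_continuous_on_pair[of X X]) (auto intro!: continuous_intros)
    then have "(LINT z|?\<gamma>. cost q (fst z) (snd z)) = (LINT x'|\<mu>. cost q (\<eta> x') x')"
      by (subst integral_distr[OF pair_meas]) auto
    then show ?thesis by (simp add: case_prod_beta' \<kappa>_def cs_def cost_commute[of q _ "\<eta> _"])
  qed
  then have "(INF \<gamma>\<in>couplings ?K \<mu>. LINT (x, y)|\<gamma>. cost q x y) \<le> \<epsilon> ^ q"
    using cINF_lower[OF bdd_below_coupling_costs \<gamma>, of q] \<kappa>_le by simp
  then have "wasserstein q ?K \<mu> \<le> root q (\<epsilon> ^ q)"
    unfolding wasserstein_def using q by (intro real_root_le_mono) auto
  then show "?K \<in> wasserstein_ball X q \<epsilon> \<mu>"
    using K q \<epsilon> by (simp add: wasserstein_ball_def real_root_power_cancel)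
  have "(LINT y|?K. u y) = (LINT x'|\<mu>. m l x' - l * cs x')"
    unfolding K_integral[OF u] using m_\<eta> \<mu>'(3)
    by (intro Bochner_Integration.integral_cong) (auto simp: cs_def)
  also have "\<dots> = (LINT x'|\<mu>. m l x') - l * \<kappa>"
    unfolding \<kappa>_def using integrable[OF m_cont] integrable[OF cs_cont] by simp
  also have "\<dots> = ?F l"
    unfolding F slack by simp
  also have "\<dots> = dual_value X q \<epsilon> u \<mu>"
    unfolding dual_value_def using l_max by (intro cSup_eq_maximum[symmetric]) auto
  finally show "(LINT y|?K. u y) = dual_value X q \<epsilon> u \<mu>" .
qed

text \<open>The order of the continuity arguments is forced. The multiplier ranges over an unbounded
  half-line, so it is first confined to a compact interval uniformly in \<open>s\<close>; then its
  uniqueness makes \<open>l\<close> continuous; only then is the inner objective at the optimal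
  multiplier jointly continuous, which makes \<open>\<eta>\<close> continuous in \<open>s\<close>
  and \<open>x'\<close> together. Weak continuity passes to the push-forward because a test function
  composed with \<open>\<eta>\<close> is a jointly continuous integrand.\<close>

lemma
  fixes X :: "'x::euclidean_space set" and S :: "'s::topological_space set"
    and u :: "'s \<Rightarrow> 'x \<Rightarrow> real" and \<eta> :: "'s \<Rightarrow> 'x \<Rightarrow> 'x"
  assumes X: "compact X" "X \<noteq> {}" and S: "compact S" and q: "1 \<le> q" and \<epsilon>: "0 < \<epsilon>"
    and u: "continuous_on (S \<times> X) (\<lambda>(s, y). u s y)"
    and \<mu>: "weakly_continuous_on S X \<mu>" "\<And>s. s \<in> S \<Longrightarrow> \<mu> s \<in> space (prob_algebra (borel_on X))"
    and l: "\<And>s. s \<in> S \<Longrightarrow> dual_optimizers X q \<epsilon> (u s) (\<mu> s) = {l s}"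
    and \<eta>: "\<And>s x'. s \<in> S \<Longrightarrow> x' \<in> X \<Longrightarrow> inner_optimizers X q (u s) (l s) x' = {\<eta> s x'}"
  defines "K \<equiv> \<lambda>s. distr (\<mu> s) (borel_on X) (\<eta> s)"
  shows worst_case_kernel_in_ball: "\<And>s. s \<in> S \<Longrightarrow> K s \<in> wasserstein_ball X q \<epsilon> (\<mu> s)"
    and worst_case_kernel_attains: "\<And>s. s \<in> S \<Longrightarrow> (LINT y|K s. u s y) = dual_value X q \<epsilon> (u s) (\<mu> s)"
    and worst_case_kernel_weakly_continuous: "weakly_continuous_on S X K"
    and continuous_on_dual_value: "continuous_on S (\<lambda>s. dual_value X q \<epsilon> (u s) (\<mu> s))"
proof -
  let ?F = "\<lambda>s. dual_fun X q \<epsilon> (u s) (\<mu> s)"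
  define m where "m s k x' = (INF y\<in>X. u s y + k * cost q x' y)" for s k x'
  have u_slice: "continuous_on X (u s)" if "s \<in> S" for s
    by (rule continuous_on_slice(1)[OF u that])
  have m_cont: "continuous_on ((S \<times> UNIV) \<times> X) (\<lambda>(w, x'). m (fst w) (snd w) x')"
  proof -
    have "continuous_on (((S \<times> UNIV) \<times> X) \<times> X) (\<lambda>w. (fst (fst (fst w)), snd w))"
      by (intro continuous_intros)
    from continuous_on_compose2[OF u this]
    have "continuous_on (((S \<times> UNIV) \<times> X) \<times> X) (\<lambda>w. u (fst (fst (fst w))) (snd w))"
      by (simp add: case_prod_beta' image_subset_iff)
    then have "continuous_on (((S \<times> UNIV) \<times> X) \<times> X)
        (\<lambda>w. u (fst (fst (fst w))) (snd w) + snd (fst (fst w)) * cost q (snd (fst w)) (snd w))"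
      by (intro continuous_on_add continuous_on_mult continuous_on_cost continuous_on_fst continuous_on_snd continuous_on_id)
    then have "continuous_on ((S \<times> UNIV) \<times> X)
        (\<lambda>w. INF y\<in>X. u (fst (fst w)) y + snd (fst w) * cost q (snd w) y)"
      by (intro continuous_on_INF_compact[OF _ X]) (simp add: case_prod_beta')
    then show ?thesis by (simp add: m_def case_prod_beta')
  qed
  have F_cont: "continuous_on (S \<times> R) (\<lambda>(s, k). ?F s k)" for R
  proof -
    have "weakly_continuous_on (S \<times> R) X (\<lambda>w. \<mu> (fst w))"
      by (rule weakly_continuous_on_compose[OF \<mu>(1)]) (auto intro!: continuous_intros)
    then have "continuous_on (S \<times> R) (\<lambda>w. LINT x'|\<mu> (fst w). m (fst w) (snd w) x')"
      using \<mu>(2) continuous_on_subset[OF m_cont, of "(S \<times> R) \<times> X"]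
      by (intro continuous_on_kernel_integral[OF _ _ X(1)]) auto
    then have "continuous_on (S \<times> R) (\<lambda>w. (LINT x'|\<mu> (fst w). m (fst w) (snd w) x') - \<epsilon> ^ q * snd w)"
      by (intro continuous_intros)
    then show ?thesis
      by (simp add: dual_fun_def m_def case_prod_beta')
  qed
  note l_max = dual_optimizers_singletonD(1,2)[OF l] and l_unique = dual_optimizers_singletonD(3)[OF l]
  obtain M where M: "\<And>s y. s \<in> S \<Longrightarrow> y \<in> X \<Longrightarrow> \<bar>u s y\<bar> \<le> M"
    using bdd_image_compact(3)[OF compact_Times[OF S X(1)] u] by (auto simp: bounded_iff)
  \<comment> \<open>From \<open>- M \<le> ?F s 0\<close> and
    \<open>?F s k \<le> M - \<epsilon> ^ q * k\<close>: beyond this bound a multiplier does worse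
    than 0.\<close>
  define L where "L = 2 * M / \<epsilon> ^ q"
  have l_bound: "l s \<in> {0..L}" if s: "s \<in> S" for s
  proof -
    note int = integrable_continuous_on[OF X(1) \<mu>(2)[OF s]]
    interpret prob_space "\<mu> s" using prob_borel_onD \<mu>(2)[OF s] by blast
    note space = prob_borel_onD(3)[OF \<mu>(2)[OF s]]
    have bdd: "bdd_below ((\<lambda>y. u s y + k * cost q x' y) ` X)" for k x'
      by (rule bdd_image_compact(1)[OF X(1)]) (intro continuous_intros u_slice s)
    have m_slice: "continuous_on X (m s k)" for k
      using continuous_on_slice(1)[OF m_cont, of "(s, k)"] s by simp
    have "- M \<le> m s 0 x'" for x'
      unfolding m_def using M[OF s] by (intro cINF_greatest[OF X(2)]) (auto simp: abs_le_iff minus_le_iff)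
    then have "(LINT x'|\<mu> s. - M) \<le> (LINT x'|\<mu> s. m s 0 x')"
      by (intro integral_mono int m_slice) auto
    then have "- M \<le> ?F s 0"
      by (simp add: dual_fun_def m_def prob_space)
    also have "\<dots> \<le> ?F s (l s)" by (rule l_max(2)[OF s]) simp
    also have "\<dots> \<le> M - \<epsilon> ^ q * l s"
    proof -
      \<comment> \<open>The competitor is \<open>x'\<close> itself, which costs nothing to reach
        because \<open>1 \<le> q\<close>.\<close>
      have "m s (l s) x' \<le> M" if "x' \<in> X" for x'
        using cINF_lower[OF bdd that, of "l s" x'] M[OF s that] cost_self[OF q, of x'] by (auto simp: m_def)
      then have "(LINT x'|\<mu> s. m s (l s) x') \<le> (LINT x'|\<mu> s. M)"
        using space by (intro integral_mono int m_slice) auto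
      then show ?thesis by (simp add: dual_fun_def m_def prob_space)
    qed
    finally have "l s \<le> L"
      using \<epsilon> by (simp add: L_def field_simps)
    then show ?thesis using l_max(1)[OF s] by simp
  qed
  have l_cont: "continuous_on S l"
  proof (rule continuous_on_unique_minimizer[where Y="{0..L}" and f="\<lambda>s k. - ?F s k"])
    show "continuous_on (S \<times> {0..L}) (\<lambda>(s, k). - ?F s k)"
      using continuous_on_minus[OF F_cont[of "{0..L}"]] by (simp add: case_prod_beta')
  qed (use l_bound l_max l_unique in auto)
  note \<eta>_min = inner_optimizers_singletonD(1,2)[OF \<eta>] and \<eta>_unique = inner_optimizers_singletonD(3)[OF \<eta>]
  have \<eta>_cont: "continuous_on (S \<times> X) (\<lambda>w. \<eta> (fst w) (snd w))"
  proof (rule continuous_on_unique_minimizer[where Y=X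
        and f="\<lambda>w y. u (fst w) y + l (fst w) * cost q (snd w) y"])
    have "continuous_on ((S \<times> X) \<times> X) (\<lambda>w. (fst (fst w), snd w))"
      by (intro continuous_intros)
    from continuous_on_compose2[OF u this]
    have "continuous_on ((S \<times> X) \<times> X) (\<lambda>w. u (fst (fst w)) (snd w))"
      by (simp add: case_prod_beta' image_subset_iff)
    moreover have "continuous_on ((S \<times> X) \<times> X) (\<lambda>w. l (fst (fst w)))"
      by (rule continuous_on_compose2[OF l_cont]) (auto intro!: continuous_intros)
    ultimately have "continuous_on ((S \<times> X) \<times> X)
        (\<lambda>w. u (fst (fst w)) (snd w) + l (fst (fst w)) * cost q (snd (fst w)) (snd w))"
      by (intro continuous_on_add continuous_on_mult continuous_on_cost continuous_on_fst continuous_on_snd continuous_on_id)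
    then show "continuous_on ((S \<times> X) \<times> X) (\<lambda>(w, y). u (fst w) y + l (fst w) * cost q (snd w) y)"
      by (simp add: case_prod_beta')
  qed (use X(1) \<eta>_min \<eta>_unique in auto)
  then have \<eta>_slice: "continuous_on X (\<eta> s)" if "s \<in> S" for s
    using continuous_on_slice(1)[of S X \<eta> s] that by (simp add: case_prod_beta')
  show "K s \<in> wasserstein_ball X q \<epsilon> (\<mu> s)" if "s \<in> S" for s
    unfolding K_def
    by (rule worst_case_in_ball[OF X \<mu>(2) q \<epsilon> u_slice l \<eta> \<eta>_slice]) (use that in auto)
  show attains: "(LINT y|K s. u s y) = dual_value X q \<epsilon> (u s) (\<mu> s)" if "s \<in> S" for s
    unfolding K_def
    by (rule worst_case_attains[OF X \<mu>(2) q \<epsilon> u_slice l \<eta> \<eta>_slice]) (use that in auto)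
  have K_integral: "(LINT y|K s. \<phi> y) = (LINT x'|\<mu> s. \<phi> (\<eta> s x'))"
    if s: "s \<in> S" and \<phi>: "continuous_on X \<phi>" for s and \<phi> :: "'x \<Rightarrow> real"
  proof -
    note \<mu>' = prob_borel_onD[OF \<mu>(2)[OF s]]
    have "\<eta> s \<in> \<mu> s \<rightarrow>\<^sub>M borel_on X"
      by (rule measurable_restrict_space2)
        (use \<eta>_min(1)[OF s] \<mu>'(3) measurable_continuous_on_borel_on[OF \<eta>_slice[OF s] \<mu>'(2)] in auto)
    then show ?thesis
      unfolding K_def by (rule integral_distr[OF _ borel_measurable_continuous_on_restrict[OF \<phi>]])
  qed
  show "weakly_continuous_on S X K"
    unfolding weakly_continuous_on_def
  proof (intro allI impI)
    fix \<phi> :: "'x \<Rightarrow> real" assume "continuous_on X \<phi> \<and> bounded (\<phi> ` X)"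
    then have \<phi>: "continuous_on X \<phi>" by simp
    have "continuous_on (S \<times> X) (\<lambda>w. \<phi> (\<eta> (fst w) (snd w)))"
      by (rule continuous_on_compose2[OF \<phi> \<eta>_cont]) (use \<eta>_min(1) in auto)
    then have "continuous_on S (\<lambda>s. LINT x'|\<mu> s. \<phi> (\<eta> s x'))"
      by (intro continuous_on_kernel_integral[OF \<mu> X(1)]) (simp_all only: case_prod_beta')
    then show "continuous_on S (\<lambda>s. LINT y|K s. \<phi> y)"
      by (rule continuous_on_eq) (simp add: K_integral \<phi>)
  qed
  have "continuous_on (S \<times> X) (\<lambda>w. u (fst w) (\<eta> (fst w) (snd w)))"
  proof -
    have "continuous_on (S \<times> X) (\<lambda>w. (fst w, \<eta> (fst w) (snd w)))"
      by (intro continuous_on_Pair \<eta>_cont continuous_on_fst continuous_on_id)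
    from continuous_on_compose2[OF u this] show ?thesis
      using \<eta>_min(1) by (simp add: case_prod_beta' image_subset_iff)
  qed
  then have "continuous_on S (\<lambda>s. LINT x'|\<mu> s. u s (\<eta> s x'))"
    by (intro continuous_on_kernel_integral[OF \<mu> X(1)]) (simp_all only: case_prod_beta')
  then show "continuous_on S (\<lambda>s. dual_value X q \<epsilon> (u s) (\<mu> s))"
    by (rule continuous_on_eq) (simp add: attains[symmetric] K_integral u_slice)
qed

section \<open>Dynamic programming\<close>

lemma integral_bind_prob:
  fixes f :: "'b \<Rightarrow> real"
  assumes "M \<in> space (prob_algebra M')" "N \<in> M' \<rightarrow>\<^sub>M prob_algebra K" "f \<in> borel_measurable K"
    "\<And>x. x \<in> space K \<Longrightarrow> \<bar>f x\<bar> \<le> B"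
  shows "(LINT y|(M \<bind> N). f y) = (LINT x|M. LINT y|N x. f y)"
proof (rule integral_bind[where K=K and B=B and B'=1])
  have M: "sets M = sets M'" "prob_space M"
    using assms(1) by (auto simp: space_prob_algebra)
  then show "finite_measure M" by (simp add: prob_space.finite_measure)
  show "N \<in> M \<rightarrow>\<^sub>M subprob_algebra K"
    using measurable_prob_algebraD[OF assms(2)] M by (simp cong: measurable_cong_sets)
  have "space M = space M'" using M(1) by (rule sets_eq_imp_space_eq)
  then show "AE x in M. emeasure (N x) (space (N x)) \<le> ennreal 1"
    using measurable_space[OF assms(2)]
    by (intro AE_I2) (auto simp: space_prob_algebra prob_space.emeasure_space_1)
qed (use assms in auto)

text \<open>Pushing \<open>L x\<close> forward under the map sending \<open>y\<close> to
  \<open>(x, y)\<close> moves the parameter from the integrand into the measure; the integrand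
  becomes one fixed function on the product, for which measurability of the integral in the measure
  applies.\<close>

lemma measurable_kernel_integral:
  fixes f :: "'a \<Rightarrow> 'b \<Rightarrow> real"
  assumes L: "L \<in> M \<rightarrow>\<^sub>M prob_algebra N" and f: "(\<lambda>(x, y). f x y) \<in> borel_measurable (M \<Otimes>\<^sub>M N)"
  shows "(\<lambda>x. LINT y|L x. f x y) \<in> borel_measurable M"
proof -
  have "(\<lambda>x. distr (L x) (M \<Otimes>\<^sub>M N) (Pair x)) \<in> M \<rightarrow>\<^sub>M prob_algebra (M \<Otimes>\<^sub>M N)"
    by (rule measurable_distr_prob_space2[OF L]) simp
  from measurable_compose[OF measurable_prob_algebraD[OF this] integral_measurable_subprob_algebra[OF f]]
  have "(\<lambda>x. LINT z|distr (L x) (M \<Otimes>\<^sub>M N) (Pair x). (case z of (x, y) \<Rightarrow> f x y)) \<in> borel_measurable M" .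
  then show ?thesis
  proof (rule measurable_cong[THEN iffD1, rotated])
    fix x assume x: "x \<in> space M"
    have "sets (L x) = sets N"
      using measurable_space[OF L x] by (simp add: space_prob_algebra)
    then have "Pair x \<in> L x \<rightarrow>\<^sub>M M \<Otimes>\<^sub>M N"
      using measurable_Pair1'[OF x, of N] by (simp cong: measurable_cong_sets)
    then show "(LINT z|distr (L x) (M \<Otimes>\<^sub>M N) (Pair x). (case z of (x, y) \<Rightarrow> f x y)) = (LINT y|L x. f x y)"
      by (subst integral_distr[OF _ f]) auto
  qed
qed

lemma space_path_spaceD:
  assumes "\<omega> \<in> space (path_space X A t n)"
  shows "\<And>l. t \<le> l \<Longrightarrow> l \<le> t + n \<Longrightarrow> fst \<omega> l \<in> X" "\<And>l. t \<le> l \<Longrightarrow> l < t + n \<Longrightarrow> snd \<omega> l \<in> A"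
  using assms by (auto simp: path_space_def space_pair_measure space_PiM PiE_iff space_restrict_space)

lemma measurable_path_state:
  assumes "t \<le> l" "l \<le> t + n"
  shows "(\<lambda>\<omega>. fst \<omega> l) \<in> path_space X A t n \<rightarrow>\<^sub>M borel_on X"
  unfolding path_space_def
  by (rule measurable_compose[OF measurable_fst measurable_component_singleton]) (use assms in auto)

lemma measurable_path_action:
  assumes "t \<le> l" "l < t + n"
  shows "(\<lambda>\<omega>. snd \<omega> l) \<in> path_space X A t n \<rightarrow>\<^sub>M borel_on A"
  unfolding path_space_def
  by (rule measurable_compose[OF measurable_snd measurable_component_singleton]) (use assms in auto)

text \<open>The one-step extension nests three kernels (action, next state, Dirac mass at the
  extended path). They are shown to be probability kernels from the inside out, and the integral is
  then unfolded from the outside in; boundedness of \<open>\<psi>\<close> justifies each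
  exchange.\<close>

lemma
  fixes X :: "'x::euclidean_space set" and A :: "'a::euclidean_space set"
  assumes \<pi>: "\<pi> (t + n) \<in> borel_on X \<rightarrow>\<^sub>M prob_algebra (borel_on A)"
    and P: "markov_kernel X A (P (t + n))"
    and law: "path_law X A \<pi> P t x n \<in> space (prob_algebra (path_space X A t n))"
  shows path_law_Suc_prob: "path_law X A \<pi> P t x (Suc n) \<in> space (prob_algebra (path_space X A t (Suc n)))"
    and path_law_Suc_integral: "\<And>\<psi> B. \<psi> \<in> borel_measurable (path_space X A t (Suc n)) \<Longrightarrow>
      (\<And>\<omega>. \<omega> \<in> space (path_space X A t (Suc n)) \<Longrightarrow> \<bar>\<psi> \<omega>\<bar> \<le> (B :: real)) \<Longrightarrow>
      (LINT \<omega>|path_law X A \<pi> P t x (Suc n). \<psi> \<omega>) =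
      (LINT \<omega>|path_law X A \<pi> P t x n. LINT a|\<pi> (t + n) (fst \<omega> (t + n)). LINT y|P (t + n) (fst \<omega> (t + n)) a.
        \<psi> ((fst \<omega>)(t + Suc n := y), (snd \<omega>)(t + n := a)))"
proof -
  let ?M = "path_space X A t n" and ?N = "path_space X A t (Suc n)"
  \<comment> \<open>The index shift matters: this step adds the action at time \<open>t + n\<close>
    but the state at \<open>t + Suc n\<close>. Both kernels are evaluated at the state of time
    \<open>t + n\<close>, which is already on the path.\<close>
  let ?upd = "\<lambda>\<omega> a y. ((fst \<omega>)(t + Suc n := y), (snd \<omega>)(t + n := a))"
  let ?\<kappa>2 = "\<lambda>\<omega> a. P (t + n) (fst \<omega> (t + n)) a \<bind> (\<lambda>y. return ?N (?upd \<omega> a y))"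
  let ?\<kappa>1 = "\<lambda>\<omega>. \<pi> (t + n) (fst \<omega> (t + n)) \<bind> ?\<kappa>2 \<omega>"
  have state [measurable]: "(\<lambda>\<omega>. fst \<omega> (t + n)) \<in> ?M \<rightarrow>\<^sub>M borel_on X"
    by (rule measurable_path_state) auto
  have upd: "(\<lambda>w. ?upd (fst (fst w)) (snd (fst w)) (snd w)) \<in> (?M \<Otimes>\<^sub>M borel_on A) \<Otimes>\<^sub>M borel_on X \<rightarrow>\<^sub>M ?N"
  proof -
    have [measurable]: "(\<lambda>w. fst (fst (fst w))) \<in> (?M \<Otimes>\<^sub>M borel_on A) \<Otimes>\<^sub>M borel_on X \<rightarrow>\<^sub>M (\<Pi>\<^sub>M i\<in>{t..t + n}. borel_on X)"
      "(\<lambda>w. snd (fst (fst w))) \<in> (?M \<Otimes>\<^sub>M borel_on A) \<Otimes>\<^sub>M borel_on X \<rightarrow>\<^sub>M (\<Pi>\<^sub>M i\<in>{t..<t + n}. borel_on A)"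
      unfolding path_space_def by measurable
    have "(\<lambda>w. (fst (fst (fst w)))(t + Suc n := snd w)) \<in> (?M \<Otimes>\<^sub>M borel_on A) \<Otimes>\<^sub>M borel_on X
        \<rightarrow>\<^sub>M (\<Pi>\<^sub>M i\<in>{t..t + Suc n}. borel_on X)"
      by (rule measurable_fun_upd[where J="{t..t + n}"]) auto
    moreover have "(\<lambda>w. (snd (fst (fst w)))(t + n := snd (fst w))) \<in> (?M \<Otimes>\<^sub>M borel_on A) \<Otimes>\<^sub>M borel_on X
        \<rightarrow>\<^sub>M (\<Pi>\<^sub>M i\<in>{t..<t + Suc n}. borel_on A)"
      by (rule measurable_fun_upd[where J="{t..<t + n}"]) auto
    ultimately show ?thesis
      unfolding path_space_def[of X A t "Suc n"] by (rule measurable_Pair)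
  qed
  have k3: "(\<lambda>w. return ?N (?upd (fst (fst w)) (snd (fst w)) (snd w)))
      \<in> (?M \<Otimes>\<^sub>M borel_on A) \<Otimes>\<^sub>M borel_on X \<rightarrow>\<^sub>M prob_algebra ?N"
    by (rule measurable_compose[OF upd measurable_return_prob_space])
  have P_meas: "(\<lambda>w. P (t + n) (fst (fst w) (t + n)) (snd w)) \<in> ?M \<Otimes>\<^sub>M borel_on A \<rightarrow>\<^sub>M prob_algebra (borel_on X)"
  proof -
    have "(\<lambda>w. (fst (fst w) (t + n), snd w)) \<in> ?M \<Otimes>\<^sub>M borel_on A \<rightarrow>\<^sub>M borel_on X \<Otimes>\<^sub>M borel_on A"
      by measurable
    from measurable_compose[OF this P[unfolded markov_kernel_def]] show ?thesis by simp
  qed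
  have k2: "(\<lambda>w. ?\<kappa>2 (fst w) (snd w)) \<in> ?M \<Otimes>\<^sub>M borel_on A \<rightarrow>\<^sub>M prob_algebra ?N"
    by (rule measurable_bind_prob_space2[OF P_meas]) (use k3 in \<open>simp add: case_prod_beta'\<close>)
  have \<pi>_meas: "(\<lambda>\<omega>. \<pi> (t + n) (fst \<omega> (t + n))) \<in> ?M \<rightarrow>\<^sub>M prob_algebra (borel_on A)"
    by (rule measurable_compose[OF state \<pi>])
  have k1: "?\<kappa>1 \<in> ?M \<rightarrow>\<^sub>M prob_algebra ?N"
    by (rule measurable_bind_prob_space2[OF \<pi>_meas]) (use k2 in \<open>simp add: case_prod_beta'\<close>)
  have law_Suc: "path_law X A \<pi> P t x (Suc n) = path_law X A \<pi> P t x n \<bind> ?\<kappa>1"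
    by (simp add: case_prod_beta')
  show "path_law X A \<pi> P t x (Suc n) \<in> space (prob_algebra ?N)"
    unfolding law_Suc using prob_space_bind'[OF law k1] sets_bind'[OF law k1] by (simp add: space_prob_algebra)
  fix \<psi> :: "(nat \<Rightarrow> 'x) \<times> (nat \<Rightarrow> 'a) \<Rightarrow> real" and B
  assume \<psi>: "\<psi> \<in> borel_measurable ?N" "\<And>\<omega>. \<omega> \<in> space ?N \<Longrightarrow> \<bar>\<psi> \<omega>\<bar> \<le> B"
  have "(LINT \<omega>|path_law X A \<pi> P t x (Suc n). \<psi> \<omega>) = (LINT \<omega>|path_law X A \<pi> P t x n. LINT \<omega>'|?\<kappa>1 \<omega>. \<psi> \<omega>')"
    unfolding law_Suc by (rule integral_bind_prob[OF law k1 \<psi>])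
  also have "\<dots> = (LINT \<omega>|path_law X A \<pi> P t x n. LINT a|\<pi> (t + n) (fst \<omega> (t + n)).
      LINT y|P (t + n) (fst \<omega> (t + n)) a. \<psi> (?upd \<omega> a y))"
  proof (rule Bochner_Integration.integral_cong)
    fix \<omega> assume "\<omega> \<in> space (path_law X A \<pi> P t x n)"
    then have \<omega>: "\<omega> \<in> space ?M"
      using law sets_eq_imp_space_eq[of "path_law X A \<pi> P t x n" ?M] by (simp add: space_prob_algebra)
    have pk: "\<pi> (t + n) (fst \<omega> (t + n)) \<in> space (prob_algebra (borel_on A))"
      by (rule measurable_space[OF \<pi>_meas \<omega>])
    have k2': "?\<kappa>2 \<omega> \<in> borel_on A \<rightarrow>\<^sub>M prob_algebra ?N"
      using measurable_compose[OF measurable_Pair1'[OF \<omega>] k2] by simp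
    have "(LINT \<omega>'|?\<kappa>1 \<omega>. \<psi> \<omega>') = (LINT a|\<pi> (t + n) (fst \<omega> (t + n)). LINT \<omega>'|?\<kappa>2 \<omega> a. \<psi> \<omega>')"
      by (rule integral_bind_prob[OF pk k2' \<psi>])
    also have "\<dots> = (LINT a|\<pi> (t + n) (fst \<omega> (t + n)). LINT y|P (t + n) (fst \<omega> (t + n)) a. \<psi> (?upd \<omega> a y))"
    proof (rule Bochner_Integration.integral_cong)
      fix a assume "a \<in> space (\<pi> (t + n) (fst \<omega> (t + n)))"
      then have wa: "(\<omega>, a) \<in> space (?M \<Otimes>\<^sub>M borel_on A)"
        using \<omega> prob_borel_onD(3)[OF pk] by (simp add: space_pair_measure space_restrict_space)
      have Pk: "P (t + n) (fst \<omega> (t + n)) a \<in> space (prob_algebra (borel_on X))"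
        using measurable_space[OF P_meas wa] by simp
      have upd': "(\<lambda>y. ?upd \<omega> a y) \<in> borel_on X \<rightarrow>\<^sub>M ?N"
        using measurable_compose[OF measurable_Pair1'[OF wa] upd] by simp
      have k3': "(\<lambda>y. return ?N (?upd \<omega> a y)) \<in> borel_on X \<rightarrow>\<^sub>M prob_algebra ?N"
        by (rule measurable_compose[OF upd' measurable_return_prob_space])
      have "(LINT \<omega>'|?\<kappa>2 \<omega> a. \<psi> \<omega>') = (LINT y|P (t + n) (fst \<omega> (t + n)) a. LINT \<omega>'|return ?N (?upd \<omega> a y). \<psi> \<omega>')"
        by (rule integral_bind_prob[OF Pk k3' \<psi>])
      also have "\<dots> = (LINT y|P (t + n) (fst \<omega> (t + n)) a. \<psi> (?upd \<omega> a y))"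
      proof (rule Bochner_Integration.integral_cong)
        fix y assume "y \<in> space (P (t + n) (fst \<omega> (t + n)) a)"
        then have "y \<in> space (borel_on X)"
          using prob_borel_onD(3)[OF Pk] by (simp add: space_restrict_space)
        then show "(LINT \<omega>'|return ?N (?upd \<omega> a y). \<psi> \<omega>') = \<psi> (?upd \<omega> a y)"
          by (rule integral_return[OF measurable_space[OF upd'] \<psi>(1)])
      qed simp
      finally show "(LINT \<omega>'|?\<kappa>2 \<omega> a. \<psi> \<omega>') = (LINT y|P (t + n) (fst \<omega> (t + n)) a. \<psi> (?upd \<omega> a y))" .
    qed simp
    finally show "(LINT \<omega>'|?\<kappa>1 \<omega>. \<psi> \<omega>') = (LINT a|\<pi> (t + n) (fst \<omega> (t + n)).
        LINT y|P (t + n) (fst \<omega> (t + n)) a. \<psi> (?upd \<omega> a y))" .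
  qed simp
  finally show "(LINT \<omega>|path_law X A \<pi> P t x (Suc n). \<psi> \<omega>) =
      (LINT \<omega>|path_law X A \<pi> P t x n. LINT a|\<pi> (t + n) (fst \<omega> (t + n)). LINT y|P (t + n) (fst \<omega> (t + n)) a.
        \<psi> (?upd \<omega> a y))" .
qed

lemma path_law_0:
  fixes X :: "'x::euclidean_space set" and A :: "'a::euclidean_space set"
  assumes x: "x \<in> X"
  shows "path_law X A \<pi> P t x 0 \<in> space (prob_algebra (path_space X A t 0))"
    and "\<And>\<psi>. \<psi> \<in> borel_measurable (path_space X A t 0) \<Longrightarrow>
      (LINT \<omega>|path_law X A \<pi> P t x 0. \<psi> \<omega>) = (\<psi> (\<lambda>i\<in>{t}. x, \<lambda>i. undefined) :: real)"
proof -
  have "(\<lambda>i\<in>{t}. x, \<lambda>i. undefined) \<in> space (path_space X A t 0)"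
    using x by (auto simp: path_space_def space_pair_measure space_PiM space_restrict_space)
  then show "path_law X A \<pi> P t x 0 \<in> space (prob_algebra (path_space X A t 0))"
    "\<And>\<psi>. \<psi> \<in> borel_measurable (path_space X A t 0) \<Longrightarrow>
      (LINT \<omega>|path_law X A \<pi> P t x 0. \<psi> \<omega>) = (\<psi> (\<lambda>i\<in>{t}. x, \<lambda>i. undefined) :: real)"
    by (simp_all add: space_prob_algebra prob_space_return integral_return)
qed

lemma path_law_prob:
  fixes X :: "'x::euclidean_space set" and A :: "'a::euclidean_space set"
  assumes "x \<in> X" "\<And>l. t \<le> l \<Longrightarrow> l < t + n \<Longrightarrow> \<pi> l \<in> borel_on X \<rightarrow>\<^sub>M prob_algebra (borel_on A)"
    and "\<And>l. t \<le> l \<Longrightarrow> l < t + n \<Longrightarrow> markov_kernel X A (P l)"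
  shows "path_law X A \<pi> P t x n \<in> space (prob_algebra (path_space X A t n))"
  using assms(2,3)
proof (induction n)
  case 0
  show ?case by (rule path_law_0(1)[OF assms(1)])
next
  case (Suc n)
  then show ?case by (intro path_law_Suc_prob) auto
qed

text \<open>\<open>W\<close> is an arbitrary continuous family, unrelated to balls or duality, so
  one argument gives the lower bound for every admissible kernel and equality for the worst-case
  one. A general \<open>P\<close> is merely Borel; the one-step reward \<open>r\<close> is then only
  measurable and bounded, which accounts for the separate measurability and bound facts.\<close>

lemma
  fixes X :: "'x::euclidean_space set" and A :: "'a::euclidean_space set"
    and f :: "nat \<Rightarrow> 'x \<Rightarrow> 'a \<Rightarrow> 'x \<Rightarrow> real" and W :: "nat \<Rightarrow> 'x \<Rightarrow> real"
  assumes X: "compact X" and A: "compact A" and x: "x \<in> X" and "t \<le> T"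
    and f: "\<And>l. l < T \<Longrightarrow> continuous_on (X \<times> A \<times> X) (\<lambda>(x, a, y). f l x a y)"
    and W: "\<And>l. t \<le> l \<Longrightarrow> l \<le> T \<Longrightarrow> continuous_on X (W l)"
    and \<pi>: "\<And>l. t \<le> l \<Longrightarrow> l < T \<Longrightarrow> \<pi> l \<in> borel_on X \<rightarrow>\<^sub>M prob_algebra (borel_on A)"
    and P: "\<And>l. t \<le> l \<Longrightarrow> l < T \<Longrightarrow> markov_kernel X A (P l)"
  defines "r \<equiv> \<lambda>l x a. LINT y|P l x a. f l x a y + W (Suc l) y"
    and "J \<equiv> LINT \<omega>|path_law X A \<pi> P t x (T - t).
      (\<Sum>l = t..<T. f l (fst \<omega> l) (snd \<omega> l) (fst \<omega> (Suc l))) + W T (fst \<omega> T)"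
  shows one_step_integrable: "\<And>l x. t \<le> l \<Longrightarrow> l < T \<Longrightarrow> x \<in> X \<Longrightarrow> integrable (\<pi> l x) (r l x)"
    and verification_le: "(\<And>l x. t \<le> l \<Longrightarrow> l < T \<Longrightarrow> x \<in> X \<Longrightarrow> W l x \<le> (LINT a|\<pi> l x. r l x a)) \<Longrightarrow> W t x \<le> J"
    and verification_eq: "(\<And>l x. t \<le> l \<Longrightarrow> l < T \<Longrightarrow> x \<in> X \<Longrightarrow> W l x = (LINT a|\<pi> l x. r l x a)) \<Longrightarrow> W t x = J"
proof -
  let ?L = "path_law X A \<pi> P t x" and ?M = "path_space X A t"
  have P_space: "P l x a \<in> space (prob_algebra (borel_on X))" if "t \<le> l" "l < T" "x \<in> X" "a \<in> A" for l x a
    using measurable_space[OF P[OF that(1,2), unfolded markov_kernel_def], of "(x, a)"] that(3,4)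
    by (simp add: space_pair_measure space_restrict_space)
  have \<pi>_space: "\<pi> l x \<in> space (prob_algebra (borel_on A))" if "t \<le> l" "l < T" "x \<in> X" for l x
    using measurable_space[OF \<pi>[OF that(1,2)], of x] that(3) by (simp add: space_restrict_space)
  have u_cont: "continuous_on (X \<times> A \<times> X) (\<lambda>(x, a, y). f l x a y + W (Suc l) y)" if "t \<le> l" "l < T" for l
  proof -
    have "continuous_on (X \<times> A \<times> X) (\<lambda>w. W (Suc l) (snd (snd w)))"
      by (rule continuous_on_compose2[OF W[of "Suc l"]]) (use that in \<open>auto intro!: continuous_intros\<close>)
    from continuous_on_add[OF f[OF that(2)] this] show ?thesis by (simp add: case_prod_beta')
  qed
  have u_slice: "continuous_on X (\<lambda>y. f l x a y + W (Suc l) y)" if "t \<le> l" "l < T" "x \<in> X" "a \<in> A" for l x a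
  proof -
    have "continuous_on X (\<lambda>y. (x, a, y))" by (intro continuous_intros)
    from continuous_on_compose2[OF u_cont[OF that(1,2)] this] that show ?thesis by auto
  qed
  have r_bound: "\<exists>B\<ge>0. \<forall>x\<in>X. \<forall>a\<in>A. \<forall>y\<in>X. \<bar>f l x a y + W (Suc l) y\<bar> \<le> B" if l: "t \<le> l" "l < T" for l
  proof -
    obtain B where B: "\<And>w. w \<in> X \<times> A \<times> X \<Longrightarrow> \<bar>(\<lambda>(x, a, y). f l x a y + W (Suc l) y) w\<bar> \<le> B"
      using bdd_image_compact(3)[OF compact_Times[OF X compact_Times[OF A X]] u_cont[OF l]]
      unfolding bounded_iff by auto
    then show ?thesis
      by (intro exI[of _ "\<bar>B\<bar>"]) (force intro: order_trans[OF _ abs_ge_self])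
  qed
  have r_meas: "r l x \<in> borel_measurable (borel_on A)" if l: "t \<le> l" "l < T" and x: "x \<in> X" for l x
  proof -
    have "(\<lambda>a. (x, a)) \<in> borel_on A \<rightarrow>\<^sub>M borel_on X \<Otimes>\<^sub>M borel_on A"
      using x by (intro measurable_Pair1') (simp add: space_restrict_space)
    from measurable_compose[OF this P[OF l, unfolded markov_kernel_def]]
    have "P l x \<in> borel_on A \<rightarrow>\<^sub>M prob_algebra (borel_on X)" by simp
    moreover have "(\<lambda>(a, y). f l x a y + W (Suc l) y) \<in> borel_measurable (borel_on A \<Otimes>\<^sub>M borel_on X)"
    proof (rule measurable_continuous_on_pair[OF _ refl])
      have "continuous_on (A \<times> X) (\<lambda>w. (x, fst w, snd w))" by (intro continuous_intros)
      from continuous_on_compose2[OF u_cont[OF l] this] x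
      show "continuous_on (A \<times> X) (\<lambda>(a, y). f l x a y + W (Suc l) y)"
        by (simp add: case_prod_beta' image_subset_iff)
    qed
    ultimately show ?thesis
      unfolding r_def by (rule measurable_kernel_integral)
  qed
  show r_int: "integrable (\<pi> l x) (r l x)" if l: "t \<le> l" "l < T" and x: "x \<in> X" for l x
  proof -
    note \<pi>' = prob_borel_onD[OF \<pi>_space[OF l x]]
    interpret prob_space "\<pi> l x" by (rule \<pi>')
    obtain B where B: "0 \<le> B" "\<forall>x\<in>X. \<forall>a\<in>A. \<forall>y\<in>X. \<bar>f l x a y + W (Suc l) y\<bar> \<le> B"
      using r_bound[OF l] by blast
    have "\<bar>r l x a\<bar> \<le> B" if "a \<in> A" for a
      unfolding r_def by (rule prob_integral_abs_le[OF P_space[OF l x that]]) (use B x that in auto)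
    then show ?thesis
      using r_meas[OF l x] \<pi>' by (intro integrable_const_bound[of _ B]) (auto cong: measurable_cong_sets)
  qed
  \<comment> \<open>With \<open>S\<close> for rewards already collected and \<open>W\<close>
    standing in for those to come, \<open>E\<close> interpolates between the two sides of the claim:
    \<open>E 0\<close> is \<open>W t x\<close> and \<open>E (T - t)\<close> is
    \<open>J\<close>.\<close>
  define S where "S n \<omega> = (\<Sum>l = t..<t + n. f l (fst \<omega> l) (snd \<omega> l) (fst \<omega> (Suc l)))"
    for n and \<omega> :: "(nat \<Rightarrow> 'x) \<times> (nat \<Rightarrow> 'a)"
  define H where "H n \<omega> = S n \<omega> + W (t + n) (fst \<omega> (t + n))" for n and \<omega> :: "(nat \<Rightarrow> 'x) \<times> (nat \<Rightarrow> 'a)"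
  define E where "E n = (LINT \<omega>|?L n. H n \<omega>)" for n
  have S_meas: "S n \<in> borel_measurable (?M n)" if n: "t + n \<le> T" for n
    unfolding S_def
  proof (rule borel_measurable_sum)
    fix l assume l: "l \<in> {t..<t + n}"
    have [measurable]: "(\<lambda>\<omega>. fst \<omega> l) \<in> ?M n \<rightarrow>\<^sub>M borel_on X"
      "(\<lambda>\<omega>. fst \<omega> (Suc l)) \<in> ?M n \<rightarrow>\<^sub>M borel_on X"
      "(\<lambda>\<omega>. snd \<omega> l) \<in> ?M n \<rightarrow>\<^sub>M borel_on A"
      using l by (auto intro: measurable_path_state measurable_path_action)
    have "(\<lambda>w. w) \<in> borel_on X \<Otimes>\<^sub>M borel_on A \<Otimes>\<^sub>M borel_on X \<rightarrow>\<^sub>M borel_on (X \<times> A \<times> X)"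
    proof -
      have "(\<lambda>w. (fst w, snd w)) \<in> borel_on X \<Otimes>\<^sub>M borel_on A \<Otimes>\<^sub>M borel_on X \<rightarrow>\<^sub>M borel_on X \<Otimes>\<^sub>M borel_on (A \<times> X)"
        using measurable_compose[OF measurable_snd measurable_pair_borel_on[of A X]] by measurable
      from measurable_compose[OF this measurable_pair_borel_on[of X "A \<times> X"]] show ?thesis by simp
    qed
    from measurable_compose[OF this borel_measurable_continuous_on_restrict[OF f[of l]]]
    have f_meas: "(\<lambda>(x, a, y). f l x a y) \<in> borel_measurable (borel_on X \<Otimes>\<^sub>M borel_on A \<Otimes>\<^sub>M borel_on X)"
      using l n by simp
    have path_meas: "(\<lambda>\<omega>. (fst \<omega> l, snd \<omega> l, fst \<omega> (Suc l))) \<in> ?M n \<rightarrow>\<^sub>M borel_on X \<Otimes>\<^sub>M borel_on A \<Otimes>\<^sub>M borel_on X"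
      by measurable
    show "(\<lambda>\<omega>. f l (fst \<omega> l) (snd \<omega> l) (fst \<omega> (Suc l))) \<in> borel_measurable (?M n)"
      using measurable_compose[OF path_meas f_meas] by simp
  qed
  have H_meas: "H n \<in> borel_measurable (?M n)" if n: "t + n \<le> T" for n
  proof -
    have "(\<lambda>\<omega>. W (t + n) (fst \<omega> (t + n))) \<in> borel_measurable (?M n)"
      by (rule measurable_compose[OF measurable_path_state borel_measurable_continuous_on_restrict[OF W]])
        (use n in auto)
    then show ?thesis
      unfolding H_def using S_meas[OF n] by (intro borel_measurable_add)
  qed
  have S_bound: "\<exists>B\<ge>0. \<forall>\<omega>\<in>space (?M n). \<bar>S n \<omega>\<bar> \<le> B" if n: "t + n \<le> T" for n
  proof -
    have "\<exists>B. \<forall>x\<in>X. \<forall>a\<in>A. \<forall>y\<in>X. \<bar>f l x a y\<bar> \<le> B" if "l < T" for l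
      using bdd_image_compact(3)[OF compact_Times[OF X compact_Times[OF A X]] f[OF that]]
      unfolding bounded_iff by fastforce
    then obtain B where B: "\<And>l x a y. l < T \<Longrightarrow> x \<in> X \<Longrightarrow> a \<in> A \<Longrightarrow> y \<in> X \<Longrightarrow> \<bar>f l x a y\<bar> \<le> B l"
      by metis
    have "\<bar>S n \<omega>\<bar> \<le> (\<Sum>l = t..<t + n. \<bar>B l\<bar>)" if "\<omega> \<in> space (?M n)" for \<omega>
      unfolding S_def
    proof (rule order_trans[OF sum_abs sum_mono])
      fix l assume "l \<in> {t..<t + n}"
      then have "\<bar>f l (fst \<omega> l) (snd \<omega> l) (fst \<omega> (Suc l))\<bar> \<le> B l"
        using space_path_spaceD[OF that] n by (intro B) auto
      then show "\<bar>f l (fst \<omega> l) (snd \<omega> l) (fst \<omega> (Suc l))\<bar> \<le> \<bar>B l\<bar>" by linarith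
    qed
    then show ?thesis by (intro exI[of _ "\<Sum>l = t..<t + n. \<bar>B l\<bar>"]) (auto intro: sum_nonneg)
  qed
  have W_bound: "\<exists>B\<ge>0. \<forall>x\<in>X. \<bar>W l x\<bar> \<le> B" if l: "t \<le> l" "l \<le> T" for l
  proof -
    obtain B where B: "\<And>x. x \<in> X \<Longrightarrow> \<bar>W l x\<bar> \<le> B"
      using bdd_image_compact(3)[OF X W[OF l]] by (auto simp: bounded_iff)
    then show ?thesis
      by (intro exI[of _ "\<bar>B\<bar>"]) (force intro: order_trans[OF _ abs_ge_self])
  qed
  have H_bound: "\<exists>B. \<forall>\<omega>\<in>space (?M n). \<bar>H n \<omega>\<bar> \<le> B" if n: "t + n \<le> T" for n
  proof -
    obtain B C where B: "\<forall>\<omega>\<in>space (?M n). \<bar>S n \<omega>\<bar> \<le> B" and C: "\<forall>x\<in>X. \<bar>W (t + n) x\<bar> \<le> C"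
      using S_bound[OF n] W_bound[of "t + n"] n by auto
    have "\<bar>H n \<omega>\<bar> \<le> B + C" if "\<omega> \<in> space (?M n)" for \<omega>
    proof -
      have "\<bar>W (t + n) (fst \<omega> (t + n))\<bar> \<le> C" using C space_path_spaceD(1)[OF that, of "t + n"] by simp
      then show ?thesis unfolding H_def using B that by (intro order_trans[OF abs_triangle_ineq add_mono]) auto
    qed
    then show ?thesis by blast
  qed
  have law: "?L n \<in> space (prob_algebra (?M n))" if "t + n \<le> T" for n
    using that by (intro path_law_prob x \<pi> P) auto
  have law_space: "space (?L n) = space (?M n)" if "t + n \<le> T" for n
    using law[OF that] by (auto simp: space_prob_algebra dest: sets_eq_imp_space_eq)
  have bounded_integrable: "integrable (?L n) h"
    if n: "t + n \<le> T" and h: "h \<in> borel_measurable (?M n)"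
      "\<And>\<omega>. \<omega> \<in> space (?M n) \<Longrightarrow> \<bar>h \<omega>\<bar> \<le> B"
    for n B and h :: "(nat \<Rightarrow> 'x) \<times> (nat \<Rightarrow> 'a) \<Rightarrow> real"
  proof -
    have law': "prob_space (?L n)" "sets (?L n) = sets (?M n)"
      using law[OF n] by (auto simp: space_prob_algebra)
    interpret prob_space "?L n" by (rule law')
    show ?thesis
      using h law'(2) law_space[OF n]
      by (intro integrable_const_bound[of _ B]) (auto cong: measurable_cong_sets)
  qed
  define R where "R l x = (LINT a|\<pi> l x. r l x a)" for l x
  have R_meas: "R l \<in> borel_measurable (borel_on X)" if l: "t \<le> l" "l < T" for l
    unfolding R_def
  proof (rule measurable_kernel_integral[OF \<pi>[OF l]])
    have "(\<lambda>(w, y). f l (fst w) (snd w) y + W (Suc l) y)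
        \<in> borel_measurable ((borel_on X \<Otimes>\<^sub>M borel_on A) \<Otimes>\<^sub>M borel_on X)"
    proof -
      have "continuous_on ((X \<times> A) \<times> X) (\<lambda>w. (fst (fst w), snd (fst w), snd w))" by (intro continuous_intros)
      from continuous_on_compose2[OF u_cont[OF l] this]
      have c: "continuous_on ((X \<times> A) \<times> X) (\<lambda>(w, y). f l (fst w) (snd w) y + W (Suc l) y)"
        by (simp add: case_prod_beta' image_subset_iff)
      have "(\<lambda>w. (fst w, snd w)) \<in> (borel_on X \<Otimes>\<^sub>M borel_on A) \<Otimes>\<^sub>M borel_on X \<rightarrow>\<^sub>M borel_on (X \<times> A) \<Otimes>\<^sub>M borel_on X"
        using measurable_compose[OF measurable_fst measurable_pair_borel_on[of X A]] by measurable
      from measurable_compose[OF this measurable_continuous_on_pair[OF c refl]] show ?thesis by simp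
    qed
    moreover have "(\<lambda>w. P l (fst w) (snd w)) \<in> borel_on X \<Otimes>\<^sub>M borel_on A \<rightarrow>\<^sub>M prob_algebra (borel_on X)"
      using P[OF l] by (simp add: markov_kernel_def case_prod_beta')
    ultimately show "(\<lambda>(x, a). r l x a) \<in> borel_measurable (borel_on X \<Otimes>\<^sub>M borel_on A)"
      using measurable_kernel_integral[of "\<lambda>w. P l (fst w) (snd w)" "borel_on X \<Otimes>\<^sub>M borel_on A" "borel_on X"
          "\<lambda>w y. f l (fst w) (snd w) y + W (Suc l) y"]
      by (simp add: r_def case_prod_beta')
  qed
  have R_bound: "\<exists>B. \<forall>x\<in>X. \<bar>R l x\<bar> \<le> B" if l: "t \<le> l" "l < T" for l
  proof -
    obtain B where B: "0 \<le> B" "\<forall>x\<in>X. \<forall>a\<in>A. \<forall>y\<in>X. \<bar>f l x a y + W (Suc l) y\<bar> \<le> B"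
      using r_bound[OF l] by blast
    have "\<bar>R l x\<bar> \<le> B" if x: "x \<in> X" for x
      unfolding R_def
    proof (rule prob_integral_abs_le[OF \<pi>_space[OF l x] _ B(1)])
      show "\<bar>r l x a\<bar> \<le> B" if "a \<in> A" for a
        unfolding r_def by (rule prob_integral_abs_le[OF P_space[OF l x that]]) (use B x that in auto)
    qed
    then show ?thesis by blast
  qed
  \<comment> \<open>Integrating out the last action and state leaves the path law of length
    \<open>n\<close>. As \<open>E n\<close> and \<open>E (Suc n)\<close> are now integrals over the
    same law, comparing them reduces to comparing \<open>W\<close> and \<open>R\<close> at the state
    of time \<open>t + n\<close>.\<close>
  have step: "E (Suc n) = (LINT \<omega>|?L n. S n \<omega> + R (t + n) (fst \<omega> (t + n)))"
    and SR_int: "integrable (?L n) (\<lambda>\<omega>. S n \<omega> + R (t + n) (fst \<omega> (t + n)))"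
    if n: "t + Suc n \<le> T" for n
  proof -
    have l: "t \<le> t + n" "t + n < T" and n': "t + n \<le> T" using n by auto
    obtain B where B: "\<And>\<omega>. \<omega> \<in> space (?M (Suc n)) \<Longrightarrow> \<bar>H (Suc n) \<omega>\<bar> \<le> B"
      using H_bound[OF n] by blast
    have "E (Suc n) = (LINT \<omega>|?L n. LINT a|\<pi> (t + n) (fst \<omega> (t + n)). LINT y|P (t + n) (fst \<omega> (t + n)) a.
        H (Suc n) ((fst \<omega>)(t + Suc n := y), (snd \<omega>)(t + n := a)))"
      unfolding E_def by (rule path_law_Suc_integral[OF \<pi>[OF l] P[OF l] law[OF n'] H_meas[OF n] B])
    also have "\<dots> = (LINT \<omega>|?L n. S n \<omega> + R (t + n) (fst \<omega> (t + n)))"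
    proof (rule Bochner_Integration.integral_cong)
      fix \<omega> assume "\<omega> \<in> space (?L n)"
      then have \<omega>: "\<omega> \<in> space (?M n)" using law_space[OF n'] by simp
      define z where "z = fst \<omega> (t + n)"
      have z: "z \<in> X" unfolding z_def by (rule space_path_spaceD(1)[OF \<omega>]) auto
      interpret \<pi>: prob_space "\<pi> (t + n) z" using prob_borel_onD(1)[OF \<pi>_space[OF l z]] .
      \<comment> \<open>\<open>S n\<close> reads states up to time \<open>t + n\<close> and actions
        before it, so the update does not touch it; only the newly added summand sees
        \<open>a\<close> and \<open>y\<close>.\<close>
      have H_Suc: "H (Suc n) ((fst \<omega>)(t + Suc n := y), (snd \<omega>)(t + n := a))
          = S n \<omega> + (f (t + n) z a y + W (Suc (t + n)) y)" for a y
        unfolding H_def S_def by (simp add: z_def)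
      have "(LINT y|P (t + n) z a. H (Suc n) ((fst \<omega>)(t + Suc n := y), (snd \<omega>)(t + n := a))) = S n \<omega> + r (t + n) z a"
        if a: "a \<in> A" for a
      proof -
        interpret prob_space "P (t + n) z a" using prob_borel_onD(1)[OF P_space[OF l z a]] .
        have "integrable (P (t + n) z a) (\<lambda>y. f (t + n) z a y + W (Suc (t + n)) y)"
          by (rule integrable_continuous_on[OF X P_space[OF l z a] u_slice[OF l z a]])
        then show ?thesis
          unfolding H_Suc r_def by (subst Bochner_Integration.integral_add) (auto simp: prob_space)
      qed
      then have "(LINT a|\<pi> (t + n) z. LINT y|P (t + n) z a. H (Suc n) ((fst \<omega>)(t + Suc n := y), (snd \<omega>)(t + n := a)))
          = (LINT a|\<pi> (t + n) z. S n \<omega> + r (t + n) z a)"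
        using prob_borel_onD(3)[OF \<pi>_space[OF l z]] by (intro Bochner_Integration.integral_cong) auto
      also have "\<dots> = S n \<omega> + R (t + n) z"
        unfolding R_def using r_int[OF l z] by (subst Bochner_Integration.integral_add) (auto simp: \<pi>.prob_space)
      finally show "(LINT a|\<pi> (t + n) (fst \<omega> (t + n)). LINT y|P (t + n) (fst \<omega> (t + n)) a.
          H (Suc n) ((fst \<omega>)(t + Suc n := y), (snd \<omega>)(t + n := a))) = S n \<omega> + R (t + n) (fst \<omega> (t + n))"
        unfolding z_def .
    qed simp
    finally show "E (Suc n) = (LINT \<omega>|?L n. S n \<omega> + R (t + n) (fst \<omega> (t + n)))" .
    obtain B C where B: "\<forall>\<omega>\<in>space (?M n). \<bar>S n \<omega>\<bar> \<le> B" and C: "\<forall>x\<in>X. \<bar>R (t + n) x\<bar> \<le> C"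
      using S_bound[OF n'] R_bound[OF l] by blast
    have R_path: "(\<lambda>\<omega>. R (t + n) (fst \<omega> (t + n))) \<in> borel_measurable (?M n)"
      by (rule measurable_compose[OF measurable_path_state R_meas[OF l]]) auto
    show "integrable (?L n) (\<lambda>\<omega>. S n \<omega> + R (t + n) (fst \<omega> (t + n)))"
    proof (rule bounded_integrable[OF n' borel_measurable_add[OF S_meas[OF n'] R_path]])
      fix \<omega> assume \<omega>: "\<omega> \<in> space (?M n)"
      have "\<bar>R (t + n) (fst \<omega> (t + n))\<bar> \<le> C" using C space_path_spaceD(1)[OF \<omega>, of "t + n"] by simp
      then show "\<bar>S n \<omega> + R (t + n) (fst \<omega> (t + n))\<bar> \<le> B + C"
        using B \<omega> by (intro order_trans[OF abs_triangle_ineq add_mono]) auto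
    qed
  qed
  have H_int: "integrable (?L n) (H n)" if n: "t + n \<le> T" for n
    using H_bound[OF n] bounded_integrable[OF n H_meas[OF n]] by blast
  have E_0: "E 0 = W t x"
    unfolding E_def by (subst path_law_0(2)[OF x H_meas]) (use \<open>t \<le> T\<close> in \<open>auto simp: H_def S_def\<close>)
  have E_T: "E (T - t) = J"
    unfolding E_def J_def H_def S_def using \<open>t \<le> T\<close> by simp
  have path_state: "fst \<omega> (t + n) \<in> X" if "\<omega> \<in> space (?L n)" "t + n \<le> T" for \<omega> n
    using space_path_spaceD(1)[of \<omega> X A t n "t + n"] that law_space by simp
  show "W t x \<le> J" if le: "\<And>l x. t \<le> l \<Longrightarrow> l < T \<Longrightarrow> x \<in> X \<Longrightarrow> W l x \<le> (LINT a|\<pi> l x. r l x a)"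
  proof -
    have "W t x \<le> E n" if "t + n \<le> T" for n
      using that
    proof (induction n)
      case (Suc n)
      have "E n \<le> E (Suc n)"
        unfolding step[OF Suc.prems] unfolding E_def
      proof (rule integral_mono[OF H_int SR_int[OF Suc.prems]])
        fix \<omega> assume "\<omega> \<in> space (?L n)"
        then show "H n \<omega> \<le> S n \<omega> + R (t + n) (fst \<omega> (t + n))"
          using le[of "t + n" "fst \<omega> (t + n)"] path_state Suc.prems by (simp add: H_def R_def)
      qed (use Suc.prems in simp)
      with Suc show ?case by simp
    qed (simp add: E_0)
    from this[of "T - t"] show ?thesis using E_T \<open>t \<le> T\<close> by simp
  qed
  show "W t x = J" if eq: "\<And>l x. t \<le> l \<Longrightarrow> l < T \<Longrightarrow> x \<in> X \<Longrightarrow> W l x = (LINT a|\<pi> l x. r l x a)"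
  proof -
    have "W t x = E n" if "t + n \<le> T" for n
      using that
    proof (induction n)
      case (Suc n)
      have "E n = E (Suc n)"
        unfolding step[OF Suc.prems] unfolding E_def
      proof (rule Bochner_Integration.integral_cong)
        fix \<omega> assume "\<omega> \<in> space (?L n)"
        then show "H n \<omega> = S n \<omega> + R (t + n) (fst \<omega> (t + n))"
          using eq[of "t + n" "fst \<omega> (t + n)"] path_state Suc.prems by (simp add: H_def R_def)
      qed simp
      with Suc show ?case by simp
    qed (simp add: E_0)
    from this[of "T - t"] show ?thesis using E_T \<open>t \<le> T\<close> by simp
  qed
qed

lemma robust_value_eqI:
  fixes X :: "'x::euclidean_space set" and A :: "'a::euclidean_space set"
  assumes X: "compact X" and A: "compact A" and x: "x \<in> X" and t: "t \<le> T"
    and f: "\<And>l. l < T \<Longrightarrow> continuous_on (X \<times> A \<times> X) (\<lambda>(x, a, y). f l x a y)"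
    and W: "\<And>l. t \<le> l \<Longrightarrow> l \<le> T \<Longrightarrow> continuous_on X (W l)"
    and W_T: "\<And>x. x \<in> X \<Longrightarrow> W T x = g x"
    and \<pi>: "\<And>l. t \<le> l \<Longrightarrow> l < T \<Longrightarrow> \<pi> l \<in> borel_on X \<rightarrow>\<^sub>M prob_algebra (borel_on A)"
    and K: "K \<in> admissible_kernels X A T q \<epsilon> P0 t"
    and W_eq: "\<And>l x. t \<le> l \<Longrightarrow> l < T \<Longrightarrow> x \<in> X \<Longrightarrow> W l x = (LINT a|\<pi> l x. \<Gamma> l x a)"
    and \<Gamma>: "\<And>l x. t \<le> l \<Longrightarrow> l < T \<Longrightarrow> x \<in> X \<Longrightarrow> continuous_on A (\<Gamma> l x)"
    and attained: "\<And>l x a. t \<le> l \<Longrightarrow> l < T \<Longrightarrow> x \<in> X \<Longrightarrow> a \<in> A \<Longrightarrow>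
      \<Gamma> l x a = (LINT y|K l x a. f l x a y + W (Suc l) y)"
    and lower: "\<And>l x a Q. t \<le> l \<Longrightarrow> l < T \<Longrightarrow> x \<in> X \<Longrightarrow> a \<in> A \<Longrightarrow> Q \<in> wasserstein_ball X q \<epsilon> (P0 l x a) \<Longrightarrow>
      \<Gamma> l x a \<le> (LINT y|Q. f l x a y + W (Suc l) y)"
  shows "robust_value X A T q \<epsilon> f g P0 \<pi> t x = W t x"
proof -
  let ?J = "\<lambda>P. LINT \<omega>|path_law X A \<pi> P t x (T - t).
      (\<Sum>l = t..<T. f l (fst \<omega> l) (snd \<omega> l) (fst \<omega> (Suc l))) + W T (fst \<omega> T)"
  have \<pi>_space: "\<pi> l x \<in> space (prob_algebra (borel_on A))" if "t \<le> l" "l < T" "x \<in> X" for l x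
    using measurable_space[OF \<pi>[OF that(1,2)], of x] that(3) by (simp add: space_restrict_space)
  have adm: "markov_kernel X A (P l)" "\<And>x a. x \<in> X \<Longrightarrow> a \<in> A \<Longrightarrow> P l x a \<in> wasserstein_ball X q \<epsilon> (P0 l x a)"
    if "P \<in> admissible_kernels X A T q \<epsilon> P0 t" "t \<le> l" "l < T" for P l
    using that by (auto simp: admissible_kernels_def)
  have J: "(LINT (\<xi>, \<alpha>)|path_law X A \<pi> P t x (T - t). (\<Sum>l = t..<T. f l (\<xi> l) (\<alpha> l) (\<xi> (Suc l))) + g (\<xi> T)) = ?J P"
    if "P \<in> admissible_kernels X A T q \<epsilon> P0 t" for P
  proof (rule Bochner_Integration.integral_cong)
    have "path_law X A \<pi> P t x (T - t) \<in> space (prob_algebra (path_space X A t (T - t)))"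
      using adm(1)[OF that] t by (intro path_law_prob x \<pi>) auto
    then have "space (path_law X A \<pi> P t x (T - t)) = space (path_space X A t (T - t))"
      by (auto simp: space_prob_algebra simp del: path_law.simps dest: sets_eq_imp_space_eq)
    moreover fix \<omega> assume "\<omega> \<in> space (path_law X A \<pi> P t x (T - t))"
    ultimately have "fst \<omega> T \<in> X"
      using t by (intro space_path_spaceD(1)) auto
    then show "(case \<omega> of (\<xi>, \<alpha>) \<Rightarrow> (\<Sum>l = t..<T. f l (\<xi> l) (\<alpha> l) (\<xi> (Suc l))) + g (\<xi> T))
        = (\<Sum>l = t..<T. f l (fst \<omega> l) (snd \<omega> l) (fst \<omega> (Suc l))) + W T (fst \<omega> T)"
      by (simp add: W_T case_prod_beta)
  qed simp
  have "(INF P\<in>admissible_kernels X A T q \<epsilon> P0 t. ?J P) = W t x"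
  proof (rule cInf_eq_minimum)
    have "W t x = ?J K"
    proof (rule verification_eq[OF X A x t f W \<pi> adm(1)[OF K]])
      fix l x assume l: "t \<le> l" "l < T" and x: "x \<in> X"
      show "W l x = (LINT a|\<pi> l x. LINT y|K l x a. f l x a y + W (Suc l) y)"
        unfolding W_eq[OF l x] using attained[OF l x] prob_borel_onD(3)[OF \<pi>_space[OF l x]]
        by (intro Bochner_Integration.integral_cong) auto
    qed
    then show "W t x \<in> ?J ` admissible_kernels X A T q \<epsilon> P0 t"
      using K by (rule image_eqI)
    fix j assume "j \<in> ?J ` admissible_kernels X A T q \<epsilon> P0 t"
    then obtain P where P: "P \<in> admissible_kernels X A T q \<epsilon> P0 t" and j: "j = ?J P" by blast
    have "W t x \<le> ?J P"
    proof (rule verification_le[OF X A x t f W \<pi> adm(1)[OF P]])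
      fix l x assume l: "t \<le> l" "l < T" and x: "x \<in> X"
      show "W l x \<le> (LINT a|\<pi> l x. LINT y|P l x a. f l x a y + W (Suc l) y)"
        unfolding W_eq[OF l x]
      proof (rule integral_mono)
        show "integrable (\<pi> l x) (\<Gamma> l x)"
          by (rule integrable_continuous_on[OF A \<pi>_space[OF l x] \<Gamma>[OF l x]])
        show "integrable (\<pi> l x) (\<lambda>a. LINT y|P l x a. f l x a y + W (Suc l) y)"
          by (rule one_step_integrable[OF X A x t f W \<pi> adm(1)[OF P] l x])
        show "\<Gamma> l x a \<le> (LINT y|P l x a. f l x a y + W (Suc l) y)" if "a \<in> space (\<pi> l x)" for a
          using that prob_borel_onD(3)[OF \<pi>_space[OF l x]] adm(2)[OF P l x] by (intro lower[OF l x]) auto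
      qed
    qed
    then show "W t x \<le> j" by (simp add: j)
  qed
  then show ?thesis
    unfolding robust_value_def by (rule trans[OF INF_cong[OF refl J], rotated])
qed

section \<open>The policy gradient\<close>

theorem corollary3p2:
  fixes X :: "'x::euclidean_space set" and A :: "'a::euclidean_space set"
    and \<Theta> :: "'p::euclidean_space set"
    and T q :: nat and \<epsilon> :: real
    and f :: "nat \<Rightarrow> 'x \<Rightarrow> 'a \<Rightarrow> 'x \<Rightarrow> real" and g :: "'x \<Rightarrow> real"
    and P0 :: "nat \<Rightarrow> 'x \<Rightarrow> 'a \<Rightarrow> 'x measure"
    and \<nu> :: "'a measure" and p :: "nat \<Rightarrow> 'p \<Rightarrow> 'x \<Rightarrow> 'a \<Rightarrow> real"
    and lstar :: "nat \<Rightarrow> 'x \<Rightarrow> 'a \<Rightarrow> 'p \<Rightarrow> real"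
    and ystar :: "nat \<Rightarrow> 'x \<Rightarrow> 'a \<Rightarrow> 'x \<Rightarrow> 'p \<Rightarrow> 'x"
    and V :: "'p \<Rightarrow> nat \<Rightarrow> 'x \<Rightarrow> real"
    and u :: "'p \<Rightarrow> nat \<Rightarrow> 'x \<Rightarrow> 'a \<Rightarrow> 'x \<Rightarrow> real"
    and G :: "'p \<Rightarrow> nat \<Rightarrow> 'x \<Rightarrow> 'a \<Rightarrow> real"
  defines "V \<equiv> \<lambda>\<theta>. robust_value X A T q \<epsilon> f g P0 (policy \<nu> p \<theta>)"
    and "u \<equiv> \<lambda>\<theta> t x a y. f t x a y + V \<theta> (Suc t) y"
    and "G \<equiv> \<lambda>\<theta> t x a. dual_value X q \<epsilon> (u \<theta> t x a) (P0 t x a)"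
  assumes "compact X" "X \<noteq> {}" "compact A" "A \<noteq> {}" "compact \<Theta>"
    and "1 \<le> T" "1 \<le> q" "0 < \<epsilon>"
    and f_cont: "\<And>t. t < T \<Longrightarrow> continuous_on (X \<times> A \<times> X) (\<lambda>(x, a, y). f t x a y)"
    and g_cont: "continuous_on X g"
    and P0_kernel: "\<And>t. t < T \<Longrightarrow> markov_kernel X A (P0 t)"
    and P0_weak: "\<And>t. t < T \<Longrightarrow> weakly_continuous_on (X \<times> A) X (\<lambda>(x, a). P0 t x a)"
    and policies: "policy_class X A \<Theta> T \<nu> p"
    and regular: "regular_policy_class X A \<Theta> T \<nu> p"
    and unique_l: "\<And>t x a \<theta>. t < T \<Longrightarrow> x \<in> X \<Longrightarrow> a \<in> A \<Longrightarrow> \<theta> \<in> \<Theta> \<Longrightarrow>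
      dual_optimizers X q \<epsilon> (u \<theta> t x a) (P0 t x a) = {lstar t x a \<theta>}"
    and unique_y: "\<And>t x a \<theta> x'. t < T \<Longrightarrow> x \<in> X \<Longrightarrow> a \<in> A \<Longrightarrow> \<theta> \<in> \<Theta> \<Longrightarrow> x' \<in> X \<Longrightarrow>
      inner_optimizers X q (u \<theta> t x a) (lstar t x a \<theta>) x' = {ystar t x a x' \<theta>}"
  shows "\<forall>\<theta>\<in>\<Theta>. \<forall>x\<in>X.
    dir_differentiable \<Theta> (\<lambda>\<theta>. V \<theta> T x) \<theta> \<and> dir_gradient \<Theta> (\<lambda>\<theta>. V \<theta> T x) \<theta> = 0 \<and>
    (\<forall>t<T.
      (\<forall>a\<in>A. dir_differentiable \<Theta> (\<lambda>\<theta>. G \<theta> t x a) \<theta>) \<and>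
      integrable (policy \<nu> p \<theta> t x) (\<lambda>a.
        G \<theta> t x a *\<^sub>R dir_gradient \<Theta> (\<lambda>\<theta>. ln (p t \<theta> x a)) \<theta>
        + dir_gradient \<Theta> (\<lambda>\<theta>. G \<theta> t x a) \<theta>) \<and>
      dir_differentiable \<Theta> (\<lambda>\<theta>. V \<theta> t x) \<theta> \<and>
      dir_gradient \<Theta> (\<lambda>\<theta>. V \<theta> t x) \<theta> =
        (LINT a|policy \<nu> p \<theta> t x.
          G \<theta> t x a *\<^sub>R dir_gradient \<Theta> (\<lambda>\<theta>. ln (p t \<theta> x a)) \<theta>
          + dir_gradient \<Theta> (\<lambda>\<theta>. G \<theta> t x a) \<theta>))"
proof -
  let ?V_cont = "\<lambda>t. continuous_on (\<Theta> \<times> X) (\<lambda>(\<theta>, x). V \<theta> t x)"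
  note X = \<open>compact X\<close> \<open>X \<noteq> {}\<close> and A = \<open>compact A\<close> and \<Theta> = \<open>compact \<Theta>\<close>
  let ?\<pi> = "\<lambda>\<theta>. policy \<nu> p \<theta>"
  define S where "S t \<theta> x a = dir_gradient \<Theta> (\<lambda>\<theta>. ln (p t \<theta> x a)) \<theta>" for t \<theta> x a
  define K where "K \<theta> l x a = distr (P0 l x a) (borel_on X) (\<lambda>x'. ystar l x a x' \<theta>)" for \<theta> l x a
  define VG where "VG \<theta> t x = (LINT a|?\<pi> \<theta> t x. G \<theta> t x a)" for \<theta> t x

  \<comment> \<open>Policies and nominal laws as probability kernels\<close>
  have \<nu>: "sets \<nu> = sets (borel_on A)"
    using policies by (simp add: policy_class_def)
  have \<pi>_space: "?\<pi> \<theta> t x \<in> space (prob_algebra (borel_on A))" if "t < T" "\<theta> \<in> \<Theta>" "x \<in> X" for t \<theta> x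
    using policies that \<nu> by (simp add: policy_class_def space_prob_algebra policy_def)
  have \<pi>_weak: "weakly_continuous_on (\<Theta> \<times> X) A (\<lambda>(\<theta>, x). ?\<pi> \<theta> t x)" if "t < T" for t
    using regular that by (simp add: regular_policy_class_def)
  have \<pi>_meas: "?\<pi> \<theta> t \<in> borel_on X \<rightarrow>\<^sub>M prob_algebra (borel_on A)" if t: "t < T" and \<theta>: "\<theta> \<in> \<Theta>" for t \<theta>
  proof (rule measurable_weakly_continuous_kernel[OF _ _ A])
    have "continuous_on X (\<lambda>x. (\<theta>, x))" by (intro continuous_intros)
    from weakly_continuous_on_compose[OF \<pi>_weak[OF t] this] \<theta>
    show "weakly_continuous_on X A (?\<pi> \<theta> t)" by auto
  qed (use \<pi>_space[OF t \<theta>] in auto)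

  have P0_space: "P0 t x a \<in> space (prob_algebra (borel_on X))" if "t < T" "x \<in> X" "a \<in> A" for t x a
    using measurable_space[OF P0_kernel[OF that(1), unfolded markov_kernel_def], of "(x, a)"] that(2,3)
    by (simp add: space_pair_measure space_restrict_space)

  \<comment> \<open>At the terminal time no step remains: \<open>P0\<close> is admissible vacuously,
    and the value 0 for \<open>\<Gamma>\<close> is never consulted.\<close>
  have V_T: "V \<theta> T x = g x" if \<theta>: "\<theta> \<in> \<Theta>" and x: "x \<in> X" for \<theta> x
    unfolding V_def
    by (rule robust_value_eqI[where W="\<lambda>_. g" and K=P0 and \<Gamma>="\<lambda>_ _ _. 0", OF X(1) A x order_refl f_cont])
      (use g_cont in \<open>auto simp: admissible_kernels_def\<close>)

  \<comment> \<open>The one-stage robust problem, given a continuous next value\<close>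
  have u_cont: "continuous_on ((\<Theta> \<times> (X \<times> A)) \<times> X) (\<lambda>(s, y). u (fst s) t (fst (snd s)) (snd (snd s)) y)"
    if t: "t < T" and V: "?V_cont (Suc t)" for t
  proof -
    let ?D = "(\<Theta> \<times> (X \<times> A)) \<times> X"
    have "continuous_on ?D (\<lambda>w. (fst (snd (fst w)), snd (snd (fst w)), snd w))"
      by (intro continuous_intros)
    from continuous_on_compose2[OF f_cont[OF t] this]
    have "continuous_on ?D (\<lambda>w. f t (fst (snd (fst w))) (snd (snd (fst w))) (snd w))"
      by (simp add: case_prod_beta' image_subset_iff)
    moreover have "continuous_on ?D (\<lambda>w. (fst (fst w), snd w))"
      by (intro continuous_intros)
    from continuous_on_compose2[OF V this]
    have "continuous_on ?D (\<lambda>w. V (fst (fst w)) (Suc t) (snd w))"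
      by (simp add: case_prod_beta' image_subset_iff)
    ultimately have "continuous_on ?D (\<lambda>w. f t (fst (snd (fst w))) (snd (snd (fst w))) (snd w) + V (fst (fst w)) (Suc t) (snd w))"
      by (rule continuous_on_add)
    then show ?thesis by (simp add: u_def case_prod_beta')
  qed
  have u_slice: "continuous_on X (u \<theta> t x a)"
    if "t < T" "?V_cont (Suc t)" "\<theta> \<in> \<Theta>" "x \<in> X" "a \<in> A" for t \<theta> x a
    using continuous_on_slice(1)[OF u_cont[OF that(1,2)], of "(\<theta>, x, a)"] that by simp

  have P0_weak': "weakly_continuous_on (\<Theta> \<times> (X \<times> A)) X (\<lambda>s. P0 t (fst (snd s)) (snd (snd s)))" if "t < T" for t
  proof -
    have "continuous_on (\<Theta> \<times> (X \<times> A)) snd" by (intro continuous_intros)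
    from weakly_continuous_on_compose[OF P0_weak[OF that] this] show ?thesis
      by (simp add: case_prod_beta' image_subset_iff)
  qed

  \<comment> \<open>The duality results are used with the parameter \<open>(\<theta>, x, a)\<close>.
    Its domain is compact because \<open>\<Theta>\<close>, \<open>X\<close> and \<open>A\<close>
    are, which provides the uniform bound on the multipliers.\<close>
  note stage = X compact_Times[OF \<Theta> compact_Times[OF X(1) A]] \<open>1 \<le> q\<close> \<open>0 < \<epsilon>\<close>
  have K_ball: "K \<theta> t x a \<in> wasserstein_ball X q \<epsilon> (P0 t x a)"
    and K_attains: "(LINT y|K \<theta> t x a. u \<theta> t x a y) = G \<theta> t x a"
    if t: "t < T" and V: "?V_cont (Suc t)"
      and s: "\<theta> \<in> \<Theta>" "x \<in> X" "a \<in> A" for t \<theta> x a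
    unfolding K_def G_def
    using worst_case_kernel_in_ball[OF stage u_cont[OF t V] P0_weak'[OF t],
        where l="\<lambda>s. lstar t (fst (snd s)) (snd (snd s)) (fst s)" and \<eta>="\<lambda>s x'. ystar t (fst (snd s)) (snd (snd s)) x' (fst s)" and s="(\<theta>, x, a)"]
      worst_case_kernel_attains[OF stage u_cont[OF t V] P0_weak'[OF t],
        where l="\<lambda>s. lstar t (fst (snd s)) (snd (snd s)) (fst s)" and \<eta>="\<lambda>s x'. ystar t (fst (snd s)) (snd (snd s)) x' (fst s)" and s="(\<theta>, x, a)"]
      s P0_space[OF t] unique_l[OF t] unique_y[OF t]
    by auto
  have K_weak: "weakly_continuous_on (\<Theta> \<times> (X \<times> A)) X (\<lambda>s. K (fst s) t (fst (snd s)) (snd (snd s)))"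
    and G_cont: "continuous_on (\<Theta> \<times> (X \<times> A)) (\<lambda>(\<theta>, x, a). G \<theta> t x a)"
    if t: "t < T" and V: "?V_cont (Suc t)" for t
    unfolding K_def G_def
    using worst_case_kernel_weakly_continuous[OF stage u_cont[OF t V] P0_weak'[OF t],
        where l="\<lambda>s. lstar t (fst (snd s)) (snd (snd s)) (fst s)" and \<eta>="\<lambda>s x'. ystar t (fst (snd s)) (snd (snd s)) x' (fst s)"]
      continuous_on_dual_value[OF stage u_cont[OF t V] P0_weak'[OF t],
        where l="\<lambda>s. lstar t (fst (snd s)) (snd (snd s)) (fst s)" and \<eta>="\<lambda>s x'. ystar t (fst (snd s)) (snd (snd s)) x' (fst s)"]
      P0_space[OF t] unique_l[OF t] unique_y[OF t]
    by (auto simp: case_prod_beta')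
  have K_space: "K \<theta> t x a \<in> space (prob_algebra (borel_on X))"
    if "t < T" "?V_cont (Suc t)" "\<theta> \<in> \<Theta>" "x \<in> X" "a \<in> A" for t \<theta> x a
    using K_ball[OF that] by (simp add: wasserstein_ball_def)
  have K_kernel: "markov_kernel X A (K \<theta> t)"
    if t: "t < T" and V: "?V_cont (Suc t)" and \<theta>: "\<theta> \<in> \<Theta>" for t \<theta>
  proof -
    have "continuous_on (X \<times> A) (\<lambda>z. (\<theta>, z))" by (intro continuous_intros)
    from weakly_continuous_on_compose[OF K_weak[OF t V] this]
    have "weakly_continuous_on (X \<times> A) X (\<lambda>z. K \<theta> t (fst z) (snd z))"
      using \<theta> by (simp add: image_subset_iff)
    then have "(\<lambda>z. K \<theta> t (fst z) (snd z)) \<in> borel_on (X \<times> A) \<rightarrow>\<^sub>M prob_algebra (borel_on X)"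
      using K_space[OF t V \<theta>] by (intro measurable_weakly_continuous_kernel[OF _ _ X(1)]) auto
    from measurable_compose[OF measurable_pair_borel_on this] show ?thesis
      by (simp add: markov_kernel_def case_prod_beta')
  qed
  have G_slice: "continuous_on A (G \<theta> t x)"
    if "t < T" "?V_cont (Suc t)" "\<theta> \<in> \<Theta>" "x \<in> X" for t \<theta> x
  proof -
    have "continuous_on A (\<lambda>a. (\<theta>, x, a))" by (intro continuous_intros)
    from continuous_on_compose2[OF G_cont[OF that(1,2)] this] that show ?thesis by (simp add: image_subset_iff)
  qed

  \<comment> \<open>The Bellman recursion\<close>
  have VG_cont: "continuous_on (\<Theta> \<times> X) (\<lambda>(\<theta>, x). VG \<theta> t x)"
    if t: "t < T" and V: "?V_cont (Suc t)" for t
  proof -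
    have "continuous_on ((\<Theta> \<times> X) \<times> A) (\<lambda>w. (fst (fst w), snd (fst w), snd w))" by (intro continuous_intros)
    from continuous_on_compose2[OF G_cont[OF t V] this]
    have "continuous_on ((\<Theta> \<times> X) \<times> A) (\<lambda>(w, a). G (fst w) t (snd w) a)"
      by (simp add: case_prod_beta' image_subset_iff)
    from continuous_on_kernel_integral[OF \<pi>_weak[OF t] _ A this] show ?thesis
      using \<pi>_space[OF t] by (simp add: VG_def case_prod_beta' mem_Times_iff)
  qed

  have V_rec: "V \<theta> t x = VG \<theta> t x"
    if t: "t < T" and V: "\<And>l. t < l \<Longrightarrow> l \<le> T \<Longrightarrow> ?V_cont l"
      and rec: "\<And>l x. t < l \<Longrightarrow> l < T \<Longrightarrow> x \<in> X \<Longrightarrow> V \<theta> l x = VG \<theta> l x"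
      and \<theta>: "\<theta> \<in> \<Theta>" and x: "x \<in> X" for t \<theta> x
  proof -
    \<comment> \<open>At time \<open>t\<close> the candidate is the recursion formula, whose
      continuity is known; identifying it with the robust value is the goal. At later times the
      value itself can be used, since both facts hold there by assumption.\<close>
    define W where "W l = (if l = t then VG \<theta> t else V \<theta> l)" for l
    have V': "?V_cont (Suc l)" if "t \<le> l" "l < T" for l
      using that by (intro V) auto
    have "robust_value X A T q \<epsilon> f g P0 (?\<pi> \<theta>) t x = W t x"
    proof (rule robust_value_eqI[where K="K \<theta>" and \<Gamma>="G \<theta>", OF X(1) A x less_imp_le[OF t] f_cont])
      show "continuous_on X (W l)" if "t \<le> l" "l \<le> T" for l
        using continuous_on_slice(1)[OF VG_cont[OF t V'[OF order_refl t]] \<theta>] continuous_on_slice(1)[OF V[of l] \<theta>] that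
        by (auto simp: W_def)
      show "W T x = g x" if "x \<in> X" for x
        using t V_T[OF \<theta> that] by (simp add: W_def)
      show "K \<theta> \<in> admissible_kernels X A T q \<epsilon> P0 t"
        using K_kernel K_ball V' \<theta> by (auto simp: admissible_kernels_def)
      fix l assume l: "t \<le> l" "l < T"
      show "?\<pi> \<theta> l \<in> borel_on X \<rightarrow>\<^sub>M prob_algebra (borel_on A)"
        by (rule \<pi>_meas[OF l(2) \<theta>])
      fix x assume x: "x \<in> X"
      show "W l x = (LINT a|?\<pi> \<theta> l x. G \<theta> l x a)"
        using rec[of l x] l x by (auto simp: W_def VG_def)
      show "continuous_on A (G \<theta> l x)"
        by (rule G_slice[OF l(2) V'[OF l] \<theta> x])
      fix a assume a: "a \<in> A"
      have W_u: "f l x a y + W (Suc l) y = u \<theta> l x a y" for y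
        using l by (simp add: W_def u_def)
      show "G \<theta> l x a = (LINT y|K \<theta> l x a. f l x a y + W (Suc l) y)"
        unfolding W_u by (rule K_attains[OF l(2) V'[OF l] \<theta> x a, symmetric])
      show "G \<theta> l x a \<le> (LINT y|Q. f l x a y + W (Suc l) y)" if "Q \<in> wasserstein_ball X q \<epsilon> (P0 l x a)" for Q
        unfolding W_u G_def
        by (rule dual_value_le_integral[OF X P0_space[OF l(2) x a] that u_slice[OF l(2) V'[OF l] \<theta> x a] \<open>1 \<le> q\<close>])
    qed
    then show ?thesis by (simp add: V_def W_def)
  qed

  \<comment> \<open>Differentiability of the dual value and of the policy average\<close>
  have G_C1: "C1_on_segments \<Theta> (X \<times> A) (\<lambda>\<theta> (x, a). G \<theta> t x a)"
    if t: "t < T" and V: "?V_cont (Suc t)"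
      and C1: "C1_on_segments \<Theta> X (\<lambda>\<theta>. V \<theta> (Suc t))" for t
  proof (rule envelope_C1_on_segments[OF C1 X(1), where K="\<lambda>\<theta> z. K \<theta> t (fst z) (snd z)" and c="\<lambda>z. f t (fst z) (snd z)"])
    show "weakly_continuous_on (\<Theta> \<times> (X \<times> A)) X (\<lambda>(\<theta>, z). K \<theta> t (fst z) (snd z))"
      using K_weak[OF t V] by (simp add: case_prod_beta')
    fix \<theta> assume \<theta>: "\<theta> \<in> \<Theta>"
    show "continuous_on X (V \<theta> (Suc t))"
      by (rule continuous_on_slice(1)[OF V \<theta>])
    fix z assume "z \<in> X \<times> A"
    then have z: "fst z \<in> X" "snd z \<in> A" by auto
    show "K \<theta> t (fst z) (snd z) \<in> space (prob_algebra (borel_on X))"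
      by (rule K_space[OF t V \<theta> z])
    show "(case z of (x, a) \<Rightarrow> G \<theta> t x a) = (LINT y|K \<theta> t (fst z) (snd z). f t (fst z) (snd z) y + V \<theta> (Suc t) y)"
      using K_attains[OF t V \<theta> z] by (simp add: u_def case_prod_beta)
    \<comment> \<open>The worst-case law at \<open>\<theta>\<close> lies in the ball around the
      nominal law, which is the same ball for \<open>\<theta>'\<close>; weak duality at
      \<open>\<theta>'\<close> therefore applies to it.\<close>
    fix \<theta>' assume \<theta>': "\<theta>' \<in> \<Theta>"
    show "(case z of (x, a) \<Rightarrow> G \<theta>' t x a) \<le> (LINT y|K \<theta> t (fst z) (snd z). f t (fst z) (snd z) y + V \<theta>' (Suc t) y)"
      using dual_value_le_integral[OF X P0_space[OF t z] K_ball[OF t V \<theta> z] u_slice[OF t V \<theta>' z] \<open>1 \<le> q\<close>]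
      by (simp add: u_def G_def case_prod_beta)
  next
    fix z assume "z \<in> X \<times> A"
    then have z: "fst z \<in> X" "snd z \<in> A" by auto
    have "continuous_on X (\<lambda>y. (fst z, snd z, y))" by (intro continuous_intros)
    from continuous_on_compose2[OF f_cont[OF t] this] z
    show "continuous_on X (f t (fst z) (snd z))" by (simp add: image_subset_iff)
  qed

  have p: "p t \<theta> x \<in> borel_measurable \<nu>" "prob_space (?\<pi> \<theta> t x)"
    "\<And>a. a \<in> A \<Longrightarrow> 0 < p t \<theta> x a" "\<And>a. a \<in> A \<Longrightarrow> dir_differentiable \<Theta> (\<lambda>\<theta>. ln (p t \<theta> x a)) \<theta>"
    if "t < T" "\<theta> \<in> \<Theta>" "x \<in> X" for t \<theta> x
    using policies regular that by (auto simp: policy_class_def regular_policy_class_def)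
  obtain C where C: "\<And>t \<theta> x a. t < T \<Longrightarrow> \<theta> \<in> \<Theta> \<Longrightarrow> x \<in> X \<Longrightarrow> a \<in> A \<Longrightarrow> norm (S t \<theta> x a) \<le> C"
    using regular unfolding regular_policy_class_def S_def by blast

  have policy_step: "C1_on_segments \<Theta> X (\<lambda>\<theta>. VG \<theta> t)"
    "\<And>\<theta> x. \<theta> \<in> \<Theta> \<Longrightarrow> x \<in> X \<Longrightarrow> integrable (?\<pi> \<theta> t x)
      (\<lambda>a. G \<theta> t x a *\<^sub>R S t \<theta> x a + dir_gradient \<Theta> (\<lambda>\<theta>. G \<theta> t x a) \<theta>)"
    "\<And>\<theta> x. \<theta> \<in> \<Theta> \<Longrightarrow> x \<in> X \<Longrightarrow> dir_gradient \<Theta> (\<lambda>\<theta>. VG \<theta> t x) \<theta> =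
      (LINT a|?\<pi> \<theta> t x. G \<theta> t x a *\<^sub>R S t \<theta> x a + dir_gradient \<Theta> (\<lambda>\<theta>. G \<theta> t x a) \<theta>)"
    if t: "t < T" and V: "?V_cont (Suc t)"
      and C1: "C1_on_segments \<Theta> X (\<lambda>\<theta>. V \<theta> (Suc t))" for t
  proof -
    have regular': "\<exists>D. continuous_on (\<Theta> \<times> X) (\<lambda>(\<theta>, x). D \<theta> x) \<and>
        (\<forall>\<theta>\<in>\<Theta>. \<forall>x\<in>X. has_dir_gradient \<Theta> (\<lambda>\<theta>. LINT a|?\<pi> \<theta> t x. \<phi> a) \<theta> (D \<theta> x))"
      if "continuous_on A \<phi>" for \<phi> :: "'a \<Rightarrow> real"
      using regular t that by (simp add: regular_policy_class_def)
    have S_meas: "S t \<theta> x \<in> borel_measurable (borel_on A)" if "\<theta> \<in> \<Theta>" "x \<in> X" for \<theta> x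
    proof -
      have "(\<lambda>a. S t \<theta> x a) \<in> borel_measurable \<nu>"
        unfolding S_def
        by (rule score_measurable[OF \<nu> A, where C=C]) (use p[OF t] C[OF t] that in \<open>auto simp: S_def policy_def\<close>)
      then show ?thesis using \<nu> by (simp cong: measurable_cong_sets)
    qed
    have S_grad: "has_dir_gradient \<Theta> (\<lambda>\<theta>. LINT a|?\<pi> \<theta> t x. \<phi> a) \<theta> (LINT a|?\<pi> \<theta> t x. \<phi> a *\<^sub>R S t \<theta> x a)"
      if "\<theta> \<in> \<Theta>" "x \<in> X" "continuous_on A \<phi>" for \<theta> x \<phi>
      unfolding S_def policy_def
      by (rule has_dir_gradient_policy_integral[OF \<nu> A, where C=C])
        (use p[OF t] C[OF t] that in \<open>auto simp: S_def policy_def\<close>)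
    have S_span: "S t \<theta> x a \<in> span (feasible_directions \<Theta> \<theta>)" if "\<theta> \<in> \<Theta>" "x \<in> X" "a \<in> A" for \<theta> x a
      unfolding S_def by (intro dir_gradient_props(2) p(4)[OF t] that)
    note step = A \<pi>_weak[OF t] \<pi>_space[OF t] regular' S_meas C[OF t] S_span S_grad G_cont[OF t V] G_C1[OF t V C1]
    show "C1_on_segments \<Theta> X (\<lambda>\<theta>. VG \<theta> t)"
      unfolding VG_def by (rule policy_average_C1[where S="S t"]) (fact step)+
    show "integrable (?\<pi> \<theta> t x) (\<lambda>a. G \<theta> t x a *\<^sub>R S t \<theta> x a + dir_gradient \<Theta> (\<lambda>\<theta>. G \<theta> t x a) \<theta>)"
      if "\<theta> \<in> \<Theta>" "x \<in> X" for \<theta> x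
      by (rule policy_average_integrable[where S="S t" and \<pi>="\<lambda>\<theta>. ?\<pi> \<theta> t" and G="\<lambda>\<theta>. G \<theta> t"]) (fact step that)+
    show "dir_gradient \<Theta> (\<lambda>\<theta>. VG \<theta> t x) \<theta> =
        (LINT a|?\<pi> \<theta> t x. G \<theta> t x a *\<^sub>R S t \<theta> x a + dir_gradient \<Theta> (\<lambda>\<theta>. G \<theta> t x a) \<theta>)"
      if "\<theta> \<in> \<Theta>" "x \<in> X" for \<theta> x
      unfolding VG_def
      by (rule policy_average_dir_gradient[where S="S t" and \<pi>="\<lambda>\<theta>. ?\<pi> \<theta> t" and G="\<lambda>\<theta>. G \<theta> t"]) (fact step that)+
  qed

  \<comment> \<open>Backward induction in time\<close>
  have main: "\<forall>l. t \<le> l \<longrightarrow> l \<le> T \<longrightarrow> ?V_cont l \<and>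
      C1_on_segments \<Theta> X (\<lambda>\<theta>. V \<theta> l) \<and> (l < T \<longrightarrow> (\<forall>\<theta>\<in>\<Theta>. \<forall>x\<in>X. V \<theta> l x = VG \<theta> l x))" if "t \<le> T" for t
    using that
  proof (induction rule: inc_induct)
    case base
    have "continuous_on (\<Theta> \<times> X) (\<lambda>w. g (snd w))"
      by (rule continuous_on_compose2[OF g_cont]) (auto intro!: continuous_intros)
    then have "continuous_on (\<Theta> \<times> X) (\<lambda>(\<theta>, x). V \<theta> T x)"
      by (rule continuous_on_eq) (auto simp: V_T)
    moreover have "C1_on_segments \<Theta> X (\<lambda>\<theta> x. g x)"
      by (auto simp: C1_on_segments_def dir_gradient_const dir_differentiable_def intro!: exI[of _ 0] has_dir_gradient_const)
    then have "C1_on_segments \<Theta> X (\<lambda>\<theta>. V \<theta> T)"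
      by (rule C1_on_segments_cong) (simp add: V_T)
    ultimately show ?case by auto
  next
    \<comment> \<open>The induction hypothesis covers all times after \<open>t\<close>, not just
      \<open>Suc t\<close>: the robust value at \<open>t\<close> is an infimum over whole path laws,
      so its verification needs continuity and the recursion at every later time.\<close>
    case (step t)
    have t: "t < T" by fact
    have V: "?V_cont l" if "t < l" "l \<le> T" for l
      using step.IH that by auto
    have C1: "C1_on_segments \<Theta> X (\<lambda>\<theta>. V \<theta> (Suc t))"
      using step.IH t by auto
    have rec: "V \<theta> t x = VG \<theta> t x" if "\<theta> \<in> \<Theta>" "x \<in> X" for \<theta> x
      using V_rec[OF t V _ that] step.IH that by (metis Suc_leI less_imp_le)
    have V1: "?V_cont (Suc t)"
      using t by (intro V) auto
    have "?V_cont t"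
      by (rule continuous_on_eq[OF VG_cont[OF t V1]]) (auto simp: rec)
    moreover have "C1_on_segments \<Theta> X (\<lambda>\<theta>. V \<theta> t)"
      by (rule C1_on_segments_cong[OF policy_step(1)[OF t V1 C1]]) (simp add: rec)
    ultimately show ?case
      using step.IH rec by (metis Suc_leI le_neq_implies_less)
  qed
  have V: "?V_cont t" and C1: "C1_on_segments \<Theta> X (\<lambda>\<theta>. V \<theta> t)" if "t \<le> T" for t
    using main[OF that] that by auto
  have rec: "V \<theta> t x = VG \<theta> t x" if "t < T" "\<theta> \<in> \<Theta>" "x \<in> X" for t \<theta> x
    using main[of t] that by auto

  show ?thesis
  proof (intro ballI conjI allI impI)
    fix \<theta> x assume \<theta>: "\<theta> \<in> \<Theta>" and x: "x \<in> X"
    have V_diff: "dir_differentiable \<Theta> (\<lambda>\<theta>. V \<theta> t x) \<theta>" if "t \<le> T" for t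
      using C1[OF that] \<theta> x by (simp add: C1_on_segments_def)
    show "dir_differentiable \<Theta> (\<lambda>\<theta>. V \<theta> T x) \<theta>" by (rule V_diff) simp
    have "dir_gradient \<Theta> (\<lambda>\<theta>. V \<theta> T x) \<theta> = dir_gradient \<Theta> (\<lambda>\<theta>. g x) \<theta>"
      by (rule dir_gradient_cong(1)) (simp add: V_T x)
    then show "dir_gradient \<Theta> (\<lambda>\<theta>. V \<theta> T x) \<theta> = 0"
      by (simp add: dir_gradient_const)
    fix t assume t: "t < T"
    then have Suc_t: "Suc t \<le> T" by simp
    show "dir_differentiable \<Theta> (\<lambda>\<theta>. G \<theta> t x a) \<theta>" if "a \<in> A" for a
      using G_C1[OF t V[OF Suc_t] C1[OF Suc_t]] \<theta> x that by (auto simp: C1_on_segments_def)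
    show "dir_differentiable \<Theta> (\<lambda>\<theta>. V \<theta> t x) \<theta>"
      using t by (intro V_diff) simp
    show "integrable (?\<pi> \<theta> t x) (\<lambda>a. G \<theta> t x a *\<^sub>R dir_gradient \<Theta> (\<lambda>\<theta>. ln (p t \<theta> x a)) \<theta>
        + dir_gradient \<Theta> (\<lambda>\<theta>. G \<theta> t x a) \<theta>)"
      using policy_step(2)[OF t V[OF Suc_t] C1[OF Suc_t] \<theta> x] by (simp add: S_def)
    have "dir_gradient \<Theta> (\<lambda>\<theta>. V \<theta> t x) \<theta> = dir_gradient \<Theta> (\<lambda>\<theta>. VG \<theta> t x) \<theta>"
      by (rule dir_gradient_cong(1)) (simp add: rec t x)
    also have "\<dots> = (LINT a|?\<pi> \<theta> t x. G \<theta> t x a *\<^sub>R S t \<theta> x a + dir_gradient \<Theta> (\<lambda>\<theta>. G \<theta> t x a) \<theta>)"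
      by (rule policy_step(3)[OF t V[OF Suc_t] C1[OF Suc_t] \<theta> x])
    finally show "dir_gradient \<Theta> (\<lambda>\<theta>. V \<theta> t x) \<theta> = (LINT a|?\<pi> \<theta> t x.
        G \<theta> t x a *\<^sub>R dir_gradient \<Theta> (\<lambda>\<theta>. ln (p t \<theta> x a)) \<theta> + dir_gradient \<Theta> (\<lambda>\<theta>. G \<theta> t x a) \<theta>)"
      by (simp add: S_def)
  qed
qed

end
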